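(* Under the imbalanced goal distribution $p^a_1>p^a_2>\dots>p^a_k>0$, let $\pi^\star$ denote the ranked DFS policy. Then $\pi^\star\in\Pi_{\text{success}}(\mathcal P)=\{\pi:R(\pi;\mathcal P)=1\}$, and: 1. $H^{\pi^\star}(\mathcal P)<H^\pi(\mathcal P)$ for any $\pi\in\Pi_{\text{success}}(\mathcal P)$ whose reachable behavior differs from that of $\pi^\star$. 2. There exists an absolute constant $C>0$ such that for any $\gamma\in\big(1-C(p^a_k)^L,\,1\big)$, $\pi^\star=\arg\max_\pi J^\pi_\gamma(\mathcal P)$ up to reachable behavior (that is, $\pi^\star$ maximizes $J_\gamma^\pi(\mathcal P)$ over all policies, and every maximizer has the same reachable behavior as $\pi^\star$).
   Context: **Environment.** $k\ge2$, $L\ge2$, $N\ge\frac{k^{L+1}-1}{k-1}$, $[n]=\{1,\dots,n\}$. A full $k$-ary tree is a rooted tree in which each node has either $k$ (ordered, indexed $1,\dots,k$) children or none; its nodes are distinct elements of $[N]$; depth is the maximal distance from the root to a leaf. An environment is $\Phi=(\mathcal T,g(\mathcal T))$ with $g(\mathcal T)$ a leaf (the goal), not shown to the agent. The agent starts at the root $n_1$. At step $h$ it is at node $n_h$ and picks $a_h\in\{\mathrm{down}_1,\dots,\mathrm{down}_k,\mathrm{up}\}$ ($\mathrm{up}$: go to the parent; $\mathrm{down}_i$: go to the $i$-th child). An action is illegal if it is $\mathrm{up}$ at the root, or $\mathrm{down}_i$ at a leaf, or has already been taken at $n_h$ earlier in the episode. A legal action moves the agent deterministically to $n_{h+1}$.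 The agent observes $o_h=(n_h,c_h)$ with $c_h=0$ if $n_h$ is not a leaf, $c_h=\times$ if $n_h$ is a leaf other than the goal, $c_h=\checkmark$ if $n_h$ is the goal. The episode ends when $c_h=\checkmark$ (success) or an illegal action is taken; the maximum length is $H=2N$. The reward is $r_{h+1}=1$ if $n_{h+1}$ is the goal (reached by a legal action) and $0$ otherwise. The state is the history $s_h=(o_1,a_1,\dots,o_{h-1},a_{h-1},o_h)$, and a policy $\pi$ maps each state to a probability distribution over actions. **Environment distribution.** For $l\in[L]$ let $p^l_{\text{env,tree}}$ be the uniform distribution on all full $k$-ary trees with distinct nodes in $[N]$ and depth $l$. Given $\mathcal T$, the goal is the leaf reached by starting at the root and repeatedly moving to the $i$-th child with probability $p^a_i$, independently at each node, until a leaf is reached; the induced law is $p^a(\cdot\mid\mathcal T)$. The environment distribution is $\mathcal P(\mathcal T,g)=\big(\sum_{l=1}^L\omega_l\,p^l_{\text{env,tree}}(\mathcal T)\big)\,p^a(g\mid\mathcal T)$ with weights $\omega_l>0$, $\sum_{l=1}^L\omega_l=1$. **Quantities.** $R(\pi;\mathcal P)$ is the probability that $\pi$ reaches the goal when $\Phi\sim\mathcal P$. For $\pi\in\Pi_{\text{success}}(\mathcal P)$, $H^\pi(\mathcal P)$ is the expected number of steps (actions taken) until the goal is reached. For $\gamma\in(0,1]$, $J^\pi_\gamma(\mathcal P)=\mathbb E_{\Phi\sim\mathcal P,\pi}\big[\sum_{h=1}^H\gamma^{h-1}r_{h+1}\big]$. **Ranked DFS policy.** At any reachable, non-terminal state,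 if the current node has unvisited children, $\pi^\star$ moves to the unvisited child $j$ with the largest $p^a_j$; otherwise (including at a non-goal leaf) it takes $\mathrm{up}$. **Reachable behavior.** Two policies have the same reachable behavior if they agree at every non-terminal state reached with positive probability under the policy and $\mathcal P$; behavior at unreachable histories is ignored. *)

theory Defs
  imports "HOL-Probability.Probability"
begin

datatype ktree = Node (root: nat) (children: "ktree list")

fun full_ktree :: "nat \<Rightarrow> ktree \<Rightarrow> bool" where
  "full_ktree k (Node n ts) \<longleftrightarrow>
     (ts = [] \<or> length ts = k) \<and> (\<forall>t \<in> set ts. full_ktree k t)"

fun nodes :: "ktree \<Rightarrow> nat list" where
  "nodes (Node n ts) = n # concat (map nodes ts)"

fun depth :: "ktree \<Rightarrow> nat" where
  "depth (Node n ts) = (if ts = [] then 0 else Suc (Max (depth ` set ts)))"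

fun subtrees :: "ktree \<Rightarrow> ktree set" where
  "subtrees (Node n ts) = insert (Node n ts) (\<Union>t \<in> set ts. subtrees t)"

definition is_leaf :: "ktree \<Rightarrow> nat \<Rightarrow> bool" where
  "is_leaf T n \<longleftrightarrow> (\<exists>t \<in> subtrees T. root t = n \<and> children t = [])"

text \<open>Children are indexed from 1: \<open>is_child T n i m\<close> says that \<open>m\<close> is the \<open>i\<close>-th child
  of \<open>n\<close> in \<open>T\<close>.\<close>

definition is_child :: "ktree \<Rightarrow> nat \<Rightarrow> nat \<Rightarrow> nat \<Rightarrow> bool" where
  "is_child T n i m \<longleftrightarrow> (\<exists>t \<in> subtrees T. root t = n \<and>
     1 \<le> i \<and> i \<le> length (children t) \<and> root (children t ! (i - 1)) = m)"

definition ktrees :: "nat \<Rightarrow> nat \<Rightarrow> nat \<Rightarrow> ktree set" where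
  "ktrees k N l = {T. full_ktree k T \<and> distinct (nodes T) \<and> set (nodes T) \<subseteq> {1..N} \<and> depth T = l}"

fun goal_pmf :: "nat pmf \<Rightarrow> ktree \<Rightarrow> nat pmf" where
  "goal_pmf pa (Node n ts) =
     (if ts = [] then return_pmf n
      else bind_pmf pa (\<lambda>i. map (goal_pmf pa) ts ! (i - 1)))"

type_synonym environment = "ktree \<times> nat"

text \<open>The weights \<open>\<omega>\<close> on depths are represented by a probability mass function on \<open>nat\<close>, so
  that the mixture of the uniform laws is a monadic bind.\<close>

definition env_pmf :: "nat \<Rightarrow> nat \<Rightarrow> nat pmf \<Rightarrow> nat pmf \<Rightarrow> environment pmf" where
  "env_pmf k N \<omega> pa =
     do { l \<leftarrow> \<omega>;
          T \<leftarrow> pmf_of_set (ktrees k N l);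
          g \<leftarrow> goal_pmf pa T;
          return_pmf (T, g) }"

datatype action = Down nat | Up

datatype feedback = NonLeaf | WrongLeaf | Goal

type_synonym obs = "nat \<times> feedback"

text \<open>The history $o_1,a_1,\dots,o_{h-1},a_{h-1},o_h$ is represented as
  \<open>([(o\<^sub>1,a\<^sub>1),\<dots>,(o\<^sub>h\<^sub>-\<^sub>1,a\<^sub>h\<^sub>-\<^sub>1)], o\<^sub>h)\<close>.\<close>

type_synonym state = "(obs \<times> action) list \<times> obs"

type_synonym policy = "state \<Rightarrow> action pmf"

definition actions :: "nat \<Rightarrow> action set" where
  "actions k = insert Up (Down ` {1..k})"

definition policies :: "nat \<Rightarrow> policy set" where
  "policies k = {\<pi>. \<forall>s. set_pmf (\<pi> s) \<subseteq> actions k}"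

definition observe :: "environment \<Rightarrow> nat \<Rightarrow> obs" where
  "observe \<Phi> n = (n, if n = snd \<Phi> then Goal
                      else if is_leaf (fst \<Phi>) n then WrongLeaf
                      else NonLeaf)"

abbreviation current_node :: "state \<Rightarrow> nat" where
  "current_node s \<equiv> fst (snd s)"

definition at_goal :: "state \<Rightarrow> bool" where
  "at_goal s \<longleftrightarrow> snd (snd s) = Goal"

definition taken_here :: "state \<Rightarrow> action set" where
  "taken_here s = {a. \<exists>c. ((current_node s, c), a) \<in> set (fst s)}"

fun edge :: "ktree \<Rightarrow> nat \<Rightarrow> action \<Rightarrow> nat \<Rightarrow> bool" where
  "edge T n (Down i) m \<longleftrightarrow> is_child T n i m"
| "edge T n Up m \<longleftrightarrow> (\<exists>i. is_child T m i n)"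

definition legal :: "environment \<Rightarrow> state \<Rightarrow> action \<Rightarrow> bool" where
  "legal \<Phi> s a \<longleftrightarrow> (\<exists>m. edge (fst \<Phi>) (current_node s) a m) \<and> a \<notin> taken_here s"

definition successor :: "environment \<Rightarrow> state \<Rightarrow> action \<Rightarrow> state" where
  "successor \<Phi> s a =
     (fst s @ [(snd s, a)], observe \<Phi> (THE m. edge (fst \<Phi>) (current_node s) a m))"

text \<open>A configuration \<open>(b, s)\<close> consists of the history \<open>s\<close> so far and a flag \<open>b\<close> telling whether
  the episode has been ended by an illegal action taken in \<open>s\<close>. Ended configurations are absorbing,
  and an illegal action is not appended to the history.\<close>

type_synonym config = "bool \<times> state"

definition ended :: "config \<Rightarrow> bool" where
  "ended c \<longleftrightarrow> fst c \<or> at_goal (snd c)"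

definition step :: "environment \<Rightarrow> policy \<Rightarrow> config \<Rightarrow> config pmf" where
  "step \<Phi> \<pi> c =
     (if ended c then return_pmf c
      else map_pmf (\<lambda>a. if legal \<Phi> (snd c) a then (False, successor \<Phi> (snd c) a)
                        else (True, snd c)) (\<pi> (snd c)))"

primrec run :: "environment \<Rightarrow> policy \<Rightarrow> nat \<Rightarrow> config pmf" where
  "run \<Phi> \<pi> 0 = return_pmf (False, ([], observe \<Phi> (root (fst \<Phi>))))"
| "run \<Phi> \<pi> (Suc h) = bind_pmf (run \<Phi> \<pi> h) (step \<Phi> \<pi>)"

definition horizon :: "nat \<Rightarrow> nat" where
  "horizon N = 2 * N"

definition after :: "nat \<Rightarrow> nat \<Rightarrow> nat pmf \<Rightarrow> nat pmf \<Rightarrow> policy \<Rightarrow> nat \<Rightarrow> config pmf" where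
  "after k N \<omega> pa \<pi> h = bind_pmf (env_pmf k N \<omega> pa) (\<lambda>\<Phi>. run \<Phi> \<pi> h)"

definition episode :: "nat \<Rightarrow> nat \<Rightarrow> nat pmf \<Rightarrow> nat pmf \<Rightarrow> policy \<Rightarrow> config pmf" where
  "episode k N \<omega> pa \<pi> = after k N \<omega> pa \<pi> (horizon N)"

definition success_prob :: "nat \<Rightarrow> nat \<Rightarrow> nat pmf \<Rightarrow> nat pmf \<Rightarrow> policy \<Rightarrow> real" where
  "success_prob k N \<omega> pa \<pi> = measure_pmf.prob (episode k N \<omega> pa \<pi>) {c. at_goal (snd c)}"

definition success_policies :: "nat \<Rightarrow> nat \<Rightarrow> nat pmf \<Rightarrow> nat pmf \<Rightarrow> policy set" where
  "success_policies k N \<omega> pa = {\<pi> \<in> policies k. success_prob k N \<omega> pa \<pi> = 1}"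

text \<open>Since the goal is absorbing, the number of actions in the final history of a successful
  episode is the number of steps until the goal is reached. The value is only meaningful
  for policies in \<open>success_policies\<close>.\<close>

definition expected_steps :: "nat \<Rightarrow> nat \<Rightarrow> nat pmf \<Rightarrow> nat pmf \<Rightarrow> policy \<Rightarrow> real" where
  "expected_steps k N \<omega> pa \<pi> =
     measure_pmf.expectation (episode k N \<omega> pa \<pi>) (\<lambda>c. real (length (fst (snd c))))"

definition observations :: "state \<Rightarrow> obs list" where
  "observations s = map fst (fst s) @ [snd s]"

text \<open>\<open>reward s h\<close> is $r_{h+1}$; the observation $o_{h+1}$ has position \<open>h\<close> in the list
  \<open>observations s\<close>, which is counted from 0.\<close>

definition reward :: "state \<Rightarrow> nat \<Rightarrow> real" where
  "reward s h = (if h < length (observations s) \<and> snd (observations s ! h) = Goal then 1 else 0)"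

definition discounted_return ::
    "nat \<Rightarrow> nat \<Rightarrow> nat pmf \<Rightarrow> nat pmf \<Rightarrow> real \<Rightarrow> policy \<Rightarrow> real" where
  "discounted_return k N \<omega> pa \<gamma> \<pi> =
     measure_pmf.expectation (episode k N \<omega> pa \<pi>)
       (\<lambda>c. \<Sum>h = 1..horizon N. \<gamma> ^ (h - 1) * reward (snd c) h)"

definition reachable_nonterminal ::
    "nat \<Rightarrow> nat \<Rightarrow> nat pmf \<Rightarrow> nat pmf \<Rightarrow> policy \<Rightarrow> state set" where
  "reachable_nonterminal k N \<omega> pa \<pi> =
     {s. \<exists>h < horizon N. (False, s) \<in> set_pmf (after k N \<omega> pa \<pi> h) \<and> \<not> at_goal s}"

definition same_reachable_behavior ::
    "nat \<Rightarrow> nat \<Rightarrow> nat pmf \<Rightarrow> nat pmf \<Rightarrow> policy \<Rightarrow> policy \<Rightarrow> bool" where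
  "same_reachable_behavior k N \<omega> pa \<pi> \<pi>' \<longleftrightarrow>
     (\<forall>s \<in> reachable_nonterminal k N \<omega> pa \<pi> \<union> reachable_nonterminal k N \<omega> pa \<pi>'. \<pi> s = \<pi>' s)"

text \<open>The child of index \<open>j\<close> of a node can only be entered from that node by \<open>Down j\<close>, so it is
  unvisited iff \<open>Down j\<close> has not been taken at the node.\<close>

definition unvisited_children :: "nat \<Rightarrow> state \<Rightarrow> nat set" where
  "unvisited_children k s =
     {j \<in> {1..k}. snd (snd s) = NonLeaf \<and> Down j \<notin> taken_here s}"

definition ranked_dfs_action :: "nat \<Rightarrow> nat pmf \<Rightarrow> state \<Rightarrow> action" where
  "ranked_dfs_action k pa s =
     (if unvisited_children k s \<noteq> {} then Down (arg_max_on (pmf pa) (unvisited_children k s))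
      else Up)"

definition is_ranked_dfs :: "nat \<Rightarrow> nat \<Rightarrow> nat pmf \<Rightarrow> nat pmf \<Rightarrow> policy \<Rightarrow> bool" where
  "is_ranked_dfs k N \<omega> pa \<pi> \<longleftrightarrow> \<pi> \<in> policies k \<and>
     (\<forall>s \<in> reachable_nonterminal k N \<omega> pa \<pi>. \<pi> s = return_pmf (ranked_dfs_action k pa s))"

text \<open>Ranked DFS policies exist; they may differ only at unreachable or terminal histories.\<close>

lemma is_ranked_dfs_canonical:
  "is_ranked_dfs k N \<omega> pa (\<lambda>s. return_pmf (ranked_dfs_action k pa s))"
proof -
  have "ranked_dfs_action k pa s \<in> actions k" for s
  proof (cases "unvisited_children k s = {}")
    case False
    have fin: "finite (unvisited_children k s)"
      by (simp add: unvisited_children_def)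
    have "Max (pmf pa ` unvisited_children k s) \<in> pmf pa ` unvisited_children k s"
      using fin False by (intro Max_in) auto
    then obtain j where j: "j \<in> unvisited_children k s"
      "pmf pa j = Max (pmf pa ` unvisited_children k s)" by (metis imageE)
    have "is_arg_max (pmf pa) (\<lambda>x. x \<in> unvisited_children k s) j"
      using j fin by (auto simp: is_arg_max_def not_less)
    then have "arg_max_on (pmf pa) (unvisited_children k s) \<in> unvisited_children k s"
      unfolding arg_max_on_def arg_max_def by (metis is_arg_max_def someI_ex)
    then show ?thesis
      using False by (auto simp: ranked_dfs_action_def actions_def unvisited_children_def)
  qed (simp add: ranked_dfs_action_def actions_def)
  then show ?thesis
    by (simp add: is_ranked_dfs_def policies_def)
qed

definition setting :: "nat \<Rightarrow> nat \<Rightarrow> nat \<Rightarrow> nat pmf \<Rightarrow> nat pmf \<Rightarrow> bool" where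
  "setting k L N \<omega> pa \<longleftrightarrow>
     k \<ge> 2 \<and> L \<ge> 2 \<and> real N \<ge> (real k ^ (L + 1) - 1) / (real k - 1) \<and>
     set_pmf \<omega> = {1..L} \<and> set_pmf pa \<subseteq> {1..k}"

definition imbalanced :: "nat \<Rightarrow> nat pmf \<Rightarrow> bool" where
  "imbalanced k pa \<longleftrightarrow> strict_antimono_on {1..k} (pmf pa) \<and> pmf pa k > 0"

end

theory Submission
  imports Defs
begin

text \<open>
  Let \<open>f t\<close> be a payoff for reaching the goal at time \<open>t\<close> (and 0 for failure), where \<open>f\<close> is
  positive and strictly decreasing and no number of saved steps is worth the goal probability that
  is lost by skipping a subtree of that size. Both parts are instances: \<open>f t = \<gamma> ^ t\<close>, and
  \<open>f t = B - t\<close> with a large \<open>B\<close>.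

  Compare the policies that follow \<open>\<pi>\<close> for \<open>h\<close> steps and ranked depth-first search afterwards. The
  difference of the values for \<open>h\<close> and \<open>h + 1\<close> is a sum over histories \<open>s\<close> and actions \<open>a\<close> of the
  probability that \<open>\<pi>\<close> produces \<open>s\<close> and \<open>a\<close>, times the advantage of the ranked action over \<open>a\<close> in \<open>s\<close>.
  The advantage is nonnegative: an illegal action yields 0; going up too early loses by the
  condition on \<open>f\<close>; and entering a child \<open>j\<close> out of order is turned into the ranked order by
  exchanging neighbours \<open>i < j\<close> in the order of exploration. For such an exchange, pair each tree that is
  consistent with \<open>s\<close> with the tree in which the two unvisited subtrees are swapped; this tree is equally
  likely, consistent with \<open>s\<close>, and the sum over the pair is decided by \<open>p i > p j\<close>. At the first
  deviation from ranked depth-first search the advantage is positive.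
\<close>

section \<open>Trees\<close>

definition child :: "ktree \<Rightarrow> nat \<Rightarrow> ktree" where
  "child t i = children t ! (i - 1)"

definition tsize :: "ktree \<Rightarrow> nat" where
  "tsize t = length (nodes t)"

abbreviation indices :: "ktree \<Rightarrow> nat set" where
  "indices t \<equiv> {1..length (children t)}"

lemma subtree_refl: "t \<in> subtrees t"
  by (cases t) auto

lemma child_mem: "i \<in> indices t \<Longrightarrow> child t i \<in> set (children t)"
  by (auto simp: child_def)

lemma nodes_unfold: "nodes T = root T # concat (map nodes (children T))"
  by (cases T) auto

lemma subtrees_trans: "t \<in> subtrees T \<Longrightarrow> c \<in> set (children t) \<Longrightarrow> c \<in> subtrees T"
proof (induction T)
  case (Node n ts)
  then show ?case using subtree_refl by fastforce
qed

lemma subtree_child: "t \<in> subtrees T \<Longrightarrow> i \<in> indices t \<Longrightarrow> child t i \<in> subtrees T"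
  using subtrees_trans child_mem by blast

lemma nodes_subtree: "t \<in> subtrees T \<Longrightarrow> set (nodes t) \<subseteq> set (nodes T)"
  by (induction T) auto

lemma root_in_nodes: "root t \<in> set (nodes t)"
  by (cases t) auto

lemma root_subtree_in_nodes: "t \<in> subtrees T \<Longrightarrow> root t \<in> set (nodes T)"
  using nodes_subtree root_in_nodes by blast

lemma set_nodes_eq_roots: "set (nodes T) = root ` subtrees T"
  by (induction T) auto

lemma tsize_pos: "tsize t > 0"
  by (cases t) (auto simp: tsize_def)

lemma tsize_children: "c \<in> set (children t) \<Longrightarrow> tsize c < tsize t"
proof -
  have "c \<in> set ts \<Longrightarrow> length (nodes c) \<le> length (concat (map nodes ts))" for ts
    by (induction ts) auto
  then show "c \<in> set (children t) \<Longrightarrow> tsize c < tsize t"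
    unfolding tsize_def nodes_unfold[of t] by (metis length_Cons less_Suc_eq_le)
qed

lemma distinct_concat_inj:
  assumes "distinct (concat (map h xs))" "x \<in> set xs" "y \<in> set xs"
    "a \<in> set (h x)" "a \<in> set (h y)"
  shows "x = y"
  using assms by (induction xs) auto

lemma distinct_subtree: "distinct (nodes T) \<Longrightarrow> t \<in> subtrees T \<Longrightarrow> distinct (nodes t)"
proof (induction T)
  case (Node n ts)
  have "t' \<in> set ts \<Longrightarrow> distinct (nodes t')" for t'
    using Node.prems(1) by (auto simp: distinct_concat_iff)
  then show ?case using Node by auto
qed

lemma subtree_root_inj:
  assumes "distinct (nodes T)" "t \<in> subtrees T" "t' \<in> subtrees T" "root t = root t'"
  shows "t = t'"
  using assms
proof (induction T)
  case (Node n ts)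
  have d: "distinct (concat (map nodes ts))" and n: "n \<notin> set (concat (map nodes ts))"
    using Node.prems(1) by auto
  have nr: "u \<in> set ts \<Longrightarrow> v \<in> subtrees u \<Longrightarrow> root v = n \<Longrightarrow> False" for u v
    using n root_subtree_in_nodes by fastforce
  show ?case
  proof (cases "t = Node n ts \<or> t' = Node n ts")
    case True
    then show ?thesis using Node.prems by (auto dest: nr)
  next
    case False
    then obtain u u' where u: "u \<in> set ts" "t \<in> subtrees u" "u' \<in> set ts" "t' \<in> subtrees u'"
      using Node.prems by auto
    have "u = u'"
      using distinct_concat_inj[OF d u(1,3)] root_subtree_in_nodes u Node.prems(4) by metis
    moreover have "distinct (nodes u)" using d u(1) by (auto simp: distinct_concat_iff)
    ultimately show ?thesis using Node.IH u Node.prems(4) by blast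
  qed
qed

lemma child_inj:
  assumes "distinct (nodes t)" "i \<in> indices t" "j \<in> indices t"
    "a \<in> set (nodes (child t i))" "a \<in> set (nodes (child t j))"
  shows "i = j"
proof -
  have d: "distinct (concat (map nodes (children t)))"
    using assms(1) by (subst (asm) nodes_unfold) auto
  have "False" if "i \<in> indices t" "j \<in> indices t" "i < j"
    "a \<in> set (nodes (child t i))" "a \<in> set (nodes (child t j))" for i j
  proof -
    have "children t = take (j-1) (children t) @ drop (j-1) (children t)" by simp
    then have "set (concat (map nodes (take (j-1) (children t)))) \<inter>
       set (concat (map nodes (drop (j-1) (children t)))) = {}"
      using d by (metis concat_append distinct_append map_append)
    moreover have "child t i \<in> set (take (j-1) (children t))"
      using that by (auto simp: child_def in_set_conv_nth intro!: exI[of _ "i-1"])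
    moreover have "child t j \<in> set (drop (j-1) (children t))"
      using that by (auto simp: child_def in_set_conv_nth intro!: exI[of _ 0])
    ultimately show False using that by auto
  qed
  then show ?thesis using assms by (metis nat_neq_iff)
qed

lemma is_child_iff: "is_child T n i m \<longleftrightarrow>
    (\<exists>t \<in> subtrees T. root t = n \<and> i \<in> indices t \<and> root (child t i) = m)"
  by (auto simp: is_child_def child_def)

lemma is_child_nodes:
  assumes "distinct (nodes T)" "is_child T n i m"
  shows "n \<in> set (nodes T)" "m \<in> set (nodes T)" "m \<noteq> root T"
proof -
  obtain t where t: "t \<in> subtrees T" "root t = n" "i \<in> indices t" "root (child t i) = m"
    using assms(2) by (auto simp: is_child_iff)
  show "n \<in> set (nodes T)" using t root_subtree_in_nodes by blast
  show "m \<in> set (nodes T)" using t root_subtree_in_nodes subtree_child by blast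
  show "m \<noteq> root T"
  proof
    assume "m = root T"
    then have "child t i = T"
      using subtree_root_inj[OF assms(1)] t subtree_child subtree_refl by blast
    then have "T \<in> set (children t)" using t child_mem by metis
    then have "tsize T < tsize t" by (rule tsize_children)
    moreover have "tsize t \<le> tsize T"
      using t(1) assms(1) distinct_subtree nodes_subtree unfolding tsize_def
      by (metis List.finite_set card_mono distinct_card)
    ultimately show False by simp
  qed
qed

lemma is_child_child:
  assumes "distinct (nodes T)" "t \<in> subtrees T" "root t = n"
  shows "is_child T n i m \<longleftrightarrow> i \<in> indices t \<and> m = root (child t i)"
  using assms subtree_root_inj[OF assms(1)] unfolding is_child_iff by metis

lemma parent_unique:
  assumes "distinct (nodes T)" "is_child T n i m" "is_child T n' i' m"
  shows "n = n' \<and> i = i'"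
  using assms
proof (induction T)
  case (Node r ts)
  let ?T = "Node r ts"
  have d: "distinct (concat (map nodes ts))"
    using Node.prems(1) by auto
  have split: "(n = r \<and> i \<in> {1..length ts} \<and> m = root (child ?T i)) \<or>
     (\<exists>u \<in> set ts. is_child u n i m)" if "is_child ?T n i m" for n i
    using that unfolding is_child_iff by auto
  have du: "u \<in> set ts \<Longrightarrow> distinct (nodes u)" for u
    using d by (auto simp: distinct_concat_iff)
  have mixed: False if "i \<in> {1..length ts}" "m = root (child ?T i)" "u \<in> set ts" "is_child u n' i' m"
    for i n' i' u
  proof -
    have "m \<in> set (nodes u)" "m \<noteq> root u" using is_child_nodes[OF du] that by auto
    moreover have "child ?T i \<in> set ts" using that child_mem[of i ?T] by auto
    ultimately show False
      using distinct_concat_inj[OF d _ that(3), of "child ?T i" m] that(2) root_in_nodes by metis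
  qed
  consider (a) "n = r" "i \<in> {1..length ts}" "m = root (child ?T i)"
      "n' = r" "i' \<in> {1..length ts}" "m = root (child ?T i')"
    | (b) u u' where "u \<in> set ts" "is_child u n i m" "u' \<in> set ts" "is_child u' n' i' m"
    using split[OF Node.prems(2)] split[OF Node.prems(3)] mixed by blast
  then show ?case
  proof cases
    case a
    then show ?thesis
      using child_inj[OF Node.prems(1), of i i' m] root_in_nodes by (metis ktree.sel(2))
  next
    case b
    have "u = u'"
      using distinct_concat_inj[OF d b(1,3), of m] is_child_nodes(2)[OF du] b by blast
    then show ?thesis using Node.IH[OF b(1) du] b by blast
  qed
qed

lemma is_leaf_iff:
  assumes "distinct (nodes T)" "t \<in> subtrees T"
  shows "is_leaf T (root t) \<longleftrightarrow> children t = []"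
  using assms subtree_root_inj unfolding is_leaf_def by metis

lemma full_ktree_unfold: "full_ktree k t \<longleftrightarrow>
    (children t = [] \<or> length (children t) = k) \<and> (\<forall>c \<in> set (children t). full_ktree k c)"
  by (cases t) auto

lemma full_ktree_subtree: "full_ktree k T \<Longrightarrow> t \<in> subtrees T \<Longrightarrow> full_ktree k t"
  by (induction T) auto

lemma full_ktree_indices:
  "full_ktree k t \<Longrightarrow> children t \<noteq> [] \<Longrightarrow> indices t = {1..k}"
  by (subst (asm) full_ktree_unfold) auto

lemma depth_child: "i \<in> indices t \<Longrightarrow> depth (child t i) < depth t"
  using child_mem[of i t] by (cases t) (auto simp: less_Suc_eq_le intro!: Max_ge)

lemma sum_index_shift: "(\<Sum>i<n. h i) = (\<Sum>i\<in>{1..n}. h (i - 1))" for h :: "nat \<Rightarrow> 'a::comm_monoid_add"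
  by (rule sum.reindex_bij_witness[of _ "\<lambda>i. i - 1" Suc]) auto

lemma mset_nodes: "mset (nodes t) = add_mset (root t) (\<Sum>j\<in>indices t. mset (nodes (child t j)))"
proof -
  have "mset (concat (map nodes ts)) = (\<Sum>i<length ts. mset (nodes (ts ! i)))" for ts
    by (induction ts) (auto simp: sum.lessThan_Suc_shift simp del: sum.lessThan_Suc)
  then show ?thesis
    by (subst nodes_unfold) (simp add: sum_index_shift child_def)
qed

lemma size_mset_sum: "size (\<Sum>j\<in>A. h j) = (\<Sum>j\<in>A. size (h j))" for h :: "'a \<Rightarrow> 'b multiset"
  by (induction A rule: infinite_finite_induct) auto

lemma tsize_unfold: "tsize t = Suc (\<Sum>j\<in>indices t. tsize (child t j))"
proof -
  have "tsize t = size (mset (nodes t))" by (simp add: tsize_def)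
  then show ?thesis by (subst (asm) mset_nodes) (simp add: size_mset_sum tsize_def)
qed

lemma tsize_le: "full_ktree k t \<Longrightarrow> k \<ge> 2 \<Longrightarrow> tsize t \<le> 2 * k ^ depth t - 1"
proof (induction "depth t" arbitrary: t rule: less_induct)
  case less
  show ?case
  proof (cases "children t = []")
    case True
    then show ?thesis by (cases t) (auto simp: tsize_def)
  next
    case False
    then obtain d where d: "depth t = Suc d" by (cases t) auto
    have ind: "indices t = {1..k}" using full_ktree_indices less.prems False by blast
    have "tsize (child t j) \<le> 2 * k ^ d - 1" if "j \<in> indices t" for j
    proof -
      have "tsize (child t j) \<le> 2 * k ^ depth (child t j) - 1"
        using less.hyps[of "child t j"] depth_child[OF that] less.prems that
          full_ktree_subtree[OF _ subtree_child[OF subtree_refl that]] by blast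
      also have "\<dots> \<le> 2 * k ^ d - 1"
        using depth_child[OF that] d less.prems
        by (intro diff_le_mono mult_le_mono2 power_increasing) auto
      finally show ?thesis .
    qed
    then have "(\<Sum>j\<in>indices t. tsize (child t j)) \<le> (\<Sum>j\<in>indices t. 2 * k ^ d - 1)"
      by (rule sum_mono)
    also have "\<dots> = k * (2 * k ^ d - 1)" unfolding ind by simp
    finally have "tsize t \<le> Suc (k * (2 * k ^ d - 1))" by (subst tsize_unfold) simp
    also have "\<dots> \<le> 2 * k ^ Suc d - 1"
    proof -
      have "k ^ d \<ge> 1" using less.prems by simp
      then obtain y where "k ^ d = Suc y" by (cases "k ^ d") auto
      then show ?thesis using less.prems by (simp add: algebra_simps)
    qed
    finally show ?thesis using d by simp
  qed
qed

lemma finite_ktrees: "finite (ktrees k N l)"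
proof -
  let ?A = "\<lambda>l. {T. full_ktree k T \<and> set (nodes T) \<subseteq> {1..N} \<and> depth T \<le> l}"
  have "finite (?A l)"
  proof (induction l)
    case 0
    have "?A 0 \<subseteq> (\<lambda>n. Node n []) ` {1..N}"
    proof
      fix T assume "T \<in> ?A 0"
      then show "T \<in> (\<lambda>n. Node n []) ` {1..N}" by (cases T) (auto split: if_splits)
    qed
    then show ?case by (rule finite_subset) simp
  next
    case (Suc l)
    have "?A (Suc l) \<subseteq> (\<lambda>(n, ts). Node n ts) ` ({1..N} \<times> {ts. set ts \<subseteq> ?A l \<and> length ts \<le> k})"
    proof
      fix T assume T: "T \<in> ?A (Suc l)"
      obtain n ts where [simp]: "T = Node n ts" by (cases T)
      have "depth t \<le> l" if "t \<in> set ts" for t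
      proof -
        have "depth t \<le> Max (depth ` set ts)" using that by auto
        then show ?thesis using T that by (auto split: if_splits)
      qed
      then show "T \<in> (\<lambda>(n, ts). Node n ts) ` ({1..N} \<times> {ts. set ts \<subseteq> ?A l \<and> length ts \<le> k})"
        using T by (intro image_eqI[of _ _ "(n, ts)"]) fastforce+
    qed
    moreover have "finite ({1..N} \<times> {ts. set ts \<subseteq> ?A l \<and> length ts \<le> k})"
      using Suc by (intro finite_cartesian_product finite_lists_length_le) auto
    ultimately show ?case by (meson finite_imageI finite_subset)
  qed
  then show ?thesis by (rule finite_subset[rotated]) (auto simp: ktrees_def)
qed

fun csize :: "nat \<Rightarrow> nat \<Rightarrow> nat" where
  "csize k 0 = 1"
| "csize k (Suc d) = 1 + k * csize k d"

fun complete_tree :: "nat \<Rightarrow> nat \<Rightarrow> nat \<Rightarrow> ktree" where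
  "complete_tree k 0 r = Node r []"
| "complete_tree k (Suc d) r =
     Node r (map (\<lambda>i. complete_tree k d (Suc r + i * csize k d)) [0..<k])"

lemma concat_upt_blocks: "concat (map (\<lambda>i. [a + i * c..<a + i * c + c]) [0..<k]) = [a..<a + k * c]"
proof (induction k)
  case (Suc k)
  have "[a..<a + Suc k * c] = [a..<a + k * c] @ [a + k * c..<a + k * c + c]"
    using upt_add_eq_append[of a "a + k * c" c] by (simp add: algebra_simps)
  then show ?case using Suc by simp
qed simp

lemma nodes_complete_tree: "nodes (complete_tree k d r) = [r..<r + csize k d]"
proof (induction d arbitrary: r)
  case (Suc d)
  have "nodes (complete_tree k (Suc d) r) = r # [Suc r..<Suc r + k * csize k d]"
    by (simp only: complete_tree.simps nodes.simps map_map comp_def Suc concat_upt_blocks)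
  then show ?case by (simp add: upt_rec)
qed simp

lemma full_complete_tree: "full_ktree k (complete_tree k d r)"
  by (induction d arbitrary: r) auto

lemma depth_complete_tree: "k > 0 \<Longrightarrow> depth (complete_tree k d r) = d"
proof (induction d arbitrary: r)
  case (Suc d)
  then have "depth ` set (children (complete_tree k (Suc d) r)) = {d}"
    by (auto simp: image_iff)
  then show ?case using Suc by simp
qed simp

lemma csize_eq: "csize k d * (k - 1) + 1 = k ^ Suc d" if "k > 0"
proof (induction d)
  case 0
  then show ?case using that by simp
next
  case (Suc d)
  have "csize k (Suc d) * (k - 1) + 1 = k * (csize k d * (k - 1) + 1)"
    using that by (cases k) (simp_all add: algebra_simps)
  then show ?case by (simp only: Suc power_Suc)
qed

lemma csize_mono: "d \<le> d' \<Longrightarrow> k > 0 \<Longrightarrow> csize k d \<le> csize k d'"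
proof (induction rule: dec_induct)
  case (step n)
  have "csize k n \<le> k * csize k n" using step by (cases k) auto
  then have "csize k d \<le> k * csize k n" using step by (meson le_trans)
  then show ?case by simp
qed simp

lemma ktrees_nonempty:
  assumes "k \<ge> 2" "real N \<ge> (real k ^ (L + 1) - 1) / (real k - 1)" "l \<le> L"
  shows "ktrees k N l \<noteq> {}"
proof -
  have "real (csize k L) * (real k - 1) = real (csize k L * (k - 1) + 1) - 1"
    using assms(1) by (simp add: of_nat_diff)
  also have "\<dots> = real k ^ (L + 1) - 1"
    using assms(1) by (subst csize_eq) simp_all
  finally have "real (csize k L) = (real k ^ (L + 1) - 1) / (real k - 1)"
    using assms(1) by (simp add: field_simps)
  then have "csize k l \<le> N" using assms csize_mono[of l L k] by simp
  then have "complete_tree k l 1 \<in> ktrees k N l"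
    using assms full_complete_tree depth_complete_tree
    by (auto simp: ktrees_def nodes_complete_tree)
  then show ?thesis by blast
qed

section \<open>Swapping two subtrees\<close>

fun swap_children :: "nat \<Rightarrow> nat \<Rightarrow> nat \<Rightarrow> ktree \<Rightarrow> ktree" where
  "swap_children n i j (Node r ts) = Node r
     (if r \<noteq> n then map (swap_children n i j) ts
      else if i \<in> {1..length ts} \<and> j \<in> {1..length ts}
      then ts[i - 1 := ts ! (j - 1), j - 1 := ts ! (i - 1)] else ts)"

lemma root_swap_children [simp]: "root (swap_children n i j t) = root t"
  by (cases t) auto

lemma length_children_swap [simp]: "length (children (swap_children n i j t)) = length (children t)"
  by (cases t) auto

lemma swap_children_absent: "n \<notin> set (nodes t) \<Longrightarrow> swap_children n i j t = t"
  by (induction t) (auto intro!: map_idI)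

lemma mset_swap_list:
  assumes "i \<in> {1..length ts}" "j \<in> {1..length ts}"
  shows "mset (ts[i - 1 := ts ! (j - 1), j - 1 := ts ! (i - 1)]) = mset ts"
  using assms by (intro mset_swap) auto

lemma mset_concat_map_cong:
  "(\<And>x. x \<in> set xs \<Longrightarrow> mset (h x) = mset (h' x)) \<Longrightarrow>
     mset (concat (map h xs)) = mset (concat (map h' xs))"
  by (induction xs) auto

lemma mset_concat_map_perm:
  "mset xs = mset ys \<Longrightarrow> mset (concat (map h xs)) = mset (concat (map h ys))"
proof -
  have "mset (concat (map h xs)) = (\<Sum>x\<in>#mset xs. mset (h x))" for xs
    by (induction xs) auto
  then show "mset xs = mset ys \<Longrightarrow> mset (concat (map h xs)) = mset (concat (map h ys))"
    by simp
qed

lemma mset_nodes_swap [simp]: "mset (nodes (swap_children n i j t)) = mset (nodes t)"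
proof (induction t)
  case (Node r ts)
  show ?case
  proof (cases "r = n")
    case True
    then show ?thesis using mset_concat_map_perm[OF mset_swap_list] by auto
  next
    case False
    then show ?thesis using Node by (auto simp: comp_def intro: mset_concat_map_cong)
  qed
qed

lemma set_nodes_swap [simp]: "set (nodes (swap_children n i j t)) = set (nodes t)"
  by (metis mset_nodes_swap set_mset_mset)

lemma distinct_nodes_swap [simp]:
  "distinct (nodes (swap_children n i j t)) = distinct (nodes t)"
  using mset_nodes_swap mset_eq_imp_distinct_iff by blast

lemma tsize_swap [simp]: "tsize (swap_children n i j t) = tsize t"
  by (metis mset_nodes_swap size_mset tsize_def)

lemma swap_list_facts:
  assumes "i \<in> {1..length ts}" "j \<in> {1..length ts}"
  shows "set (ts[i - 1 := ts ! (j - 1), j - 1 := ts ! (i - 1)]) = set ts"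
  using mset_swap_list[OF assms] mset_eq_setD by blast

lemma full_ktree_swap [simp]: "full_ktree k (swap_children n i j t) = full_ktree k t"
  by (induction t) (auto simp: swap_list_facts simp del: One_nat_def)

lemma depth_swap [simp]: "depth (swap_children n i j t) = depth t"
proof (induction t)
  case (Node r ts)
  have "depth ` set (map (swap_children n i j) ts) = depth ` set ts"
    using Node by (auto simp: image_iff)
  then show ?case by (auto simp: swap_list_facts simp del: One_nat_def)
qed

lemma swap_children_involution: "swap_children n i j (swap_children n i j t) = t"
proof (induction t)
  case (Node r ts)
  show ?case
  proof (cases "r = n \<and> i \<in> {1..length ts} \<and> j \<in> {1..length ts}")
    case True
    then show ?thesis by (auto intro!: nth_equalityI simp: nth_list_update)
  next
    case False
    then show ?thesis using Node by (auto simp: map_idI)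
  qed
qed

lemma child_swap_other:
  "root t \<noteq> n \<Longrightarrow> x \<in> indices t \<Longrightarrow>
     child (swap_children n i j t) x = swap_children n i j (child t x)"
  by (cases t) (auto simp: child_def)

lemma child_swap_here:
  assumes "root t = n" "i \<in> indices t" "j \<in> indices t" "x \<in> indices t"
  shows "child (swap_children n i j t) x = child t (Transposition.transpose i j x)"
proof -
  have "i - 1 = x - 1 \<longleftrightarrow> i = x" "j - 1 = x - 1 \<longleftrightarrow> j = x" using assms by auto
  then show ?thesis using assms
    by (cases t) (auto simp: child_def nth_list_update Transposition.transpose_def)
qed

lemma is_child_Node: "is_child (Node r ts) m x c \<longleftrightarrow>
    (m = r \<and> x \<in> {1..length ts} \<and> c = root (child (Node r ts) x)) \<or> (\<exists>u\<in>set ts. is_child u m x c)"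
  by (auto simp: is_child_iff)

lemma is_child_swap:
  assumes "distinct (nodes T)" "full_ktree k T" "i \<in> {1..k}" "j \<in> {1..k}"
  shows "is_child (swap_children n i j T) m x c \<longleftrightarrow>
    is_child T m (if m = n then Transposition.transpose i j x else x) c"
  using assms(1,2)
proof (induction T)
  case (Node r ts)
  let ?T = "Node r ts" and ?S = "swap_children n i j (Node r ts)"
  have du: "u \<in> set ts \<Longrightarrow> distinct (nodes u)" "u \<in> set ts \<Longrightarrow> r \<notin> set (nodes u)" for u
    using Node.prems(1) by (auto simp: distinct_concat_iff)
  have not_r: "is_child u r x c = False" if "u \<in> set ts" for u x
    using is_child_nodes(1)[OF du(1)] du(2) that by blast
  show ?case
  proof (cases "ts = []")
    case True
    then show ?thesis by (auto simp: is_child_Node)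
  next
    case ne: False
    then have len: "length ts = k" using Node.prems(2) by auto
    show ?thesis
    proof (cases "r = n")
      case True
      have ij: "i \<in> {1..length ts}" "j \<in> {1..length ts}" using len assms by auto
      have S: "?S = Node r (ts[i - 1 := ts ! (j - 1), j - 1 := ts ! (i - 1)])"
        using True ij by simp
      have tr: "Transposition.transpose i j x \<in> {1..length ts} \<longleftrightarrow> x \<in> {1..length ts}"
        using ij by (auto simp: Transposition.transpose_def)
      have "is_child ?S m x c \<longleftrightarrow> (m = r \<and> x \<in> {1..length ts} \<and> c = root (child ?S x))
          \<or> (\<exists>u\<in>set ts. is_child u m x c)"
        unfolding S is_child_Node swap_list_facts[OF ij] by simp
      also have "\<dots> \<longleftrightarrow> (m = r \<and> x \<in> {1..length ts} \<and> c = root (child ?T (Transposition.transpose i j x)))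
          \<or> (\<exists>u\<in>set ts. is_child u m x c)"
        using child_swap_here[of ?T n i j x] True ij by auto
      also have "\<dots> \<longleftrightarrow> is_child ?T m (if m = n then Transposition.transpose i j x else x) c"
        unfolding is_child_Node[of r ts] using tr True not_r by auto
      finally show ?thesis .
    next
      case False
      have "is_child ?S m x c \<longleftrightarrow> (m = r \<and> x \<in> {1..length ts} \<and> c = root (child ?S x))
          \<or> (\<exists>u\<in>set ts. is_child (swap_children n i j u) m x c)"
        using False by (simp add: is_child_Node)
      also have "\<dots> \<longleftrightarrow> (m = r \<and> x \<in> {1..length ts} \<and> c = root (child ?T x))
          \<or> (\<exists>u\<in>set ts. is_child u m (if m = n then Transposition.transpose i j x else x) c)"
      proof -
        have "is_child (swap_children n i j u) m x c \<longleftrightarrow>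
            is_child u m (if m = n then Transposition.transpose i j x else x) c" if "u \<in> set ts" for u
          using Node.IH[OF that du(1)[OF that]] Node.prems(2) that by auto
        moreover have "x \<in> {1..length ts} \<Longrightarrow> root (child ?S x) = root (child ?T x)"
          using child_swap_other[of ?T n x i j] False by simp
        ultimately show ?thesis by auto
      qed
      also have "\<dots> \<longleftrightarrow> is_child ?T m (if m = n then Transposition.transpose i j x else x) c"
        unfolding is_child_Node[of r ts] using False by auto
      finally show ?thesis .
    qed
  qed
qed

lemma is_leaf_iff_no_child:
  assumes "distinct (nodes T)"
  shows "is_leaf T m \<longleftrightarrow> m \<in> set (nodes T) \<and> (\<forall>x c. \<not> is_child T m x c)"
proof (cases "m \<in> set (nodes T)")
  case True
  then obtain t where t: "t \<in> subtrees T" "m = root t" by (auto simp: set_nodes_eq_roots)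
  have "children t = [] \<longleftrightarrow> (\<forall>x. x \<notin> indices t)"
    by (cases "children t") (auto intro: exI[of _ 1])
  then show ?thesis using t True is_leaf_iff[OF assms t(1)] is_child_child[OF assms t(1)] by auto
next
  case False
  then show ?thesis using root_subtree_in_nodes by (auto simp: is_leaf_def)
qed

lemma is_leaf_swap:
  assumes "distinct (nodes T)" "full_ktree k T" "i \<in> {1..k}" "j \<in> {1..k}"
  shows "is_leaf (swap_children n i j T) m \<longleftrightarrow> is_leaf T m"
proof -
  have "(\<exists>x c. is_child (swap_children n i j T) m x c) \<longleftrightarrow> (\<exists>x c. is_child T m x c)"
    unfolding is_child_swap[OF assms] by (metis transpose_involutory)
  then show ?thesis using assms(1) by (simp add: is_leaf_iff_no_child) blast
qed

lemma edge_swap: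
  assumes "distinct (nodes T)" "full_ktree k T" "i \<in> {1..k}" "j \<in> {1..k}"
    "m = n \<Longrightarrow> a \<noteq> Down i \<and> a \<noteq> Down j"
  shows "edge (swap_children n i j T) m a c \<longleftrightarrow> edge T m a c"
proof (cases a)
  case (Down x)
  then show ?thesis using assms by (auto simp: is_child_swap Transposition.transpose_def)
next
  case Up
  then show ?thesis using assms(1-4) by (auto simp: is_child_swap) (metis transpose_involutory)+
qed

lemma ktrees_swap [simp]: "swap_children n i j T \<in> ktrees k N l \<longleftrightarrow> T \<in> ktrees k N l"
  by (simp add: ktrees_def)

lemma goal_pmf_unfold:
  assumes "full_ktree k t" "set_pmf pa \<subseteq> {1..k}"
  shows "goal_pmf pa t = (if children t = [] then return_pmf (root t)
    else bind_pmf pa (\<lambda>i. goal_pmf pa (child t i)))"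
proof (cases t)
  case (Node n ts)
  have "map (goal_pmf pa) ts ! (i - 1) = goal_pmf pa (child t i)" if "i \<in> set_pmf pa" "ts \<noteq> []" for i
  proof -
    have "i \<in> indices t" using that assms full_ktree_indices[OF assms(1)] Node by auto
    then have "i - 1 < length ts" using Node by auto
    then show ?thesis using Node by (simp add: child_def)
  qed
  then show ?thesis using Node by (auto intro!: bind_pmf_cong)
qed

lemma set_goal_pmf:
  assumes "full_ktree k t" "set_pmf pa \<subseteq> {1..k}"
  shows "set_pmf (goal_pmf pa t) \<subseteq> set (nodes t)"
  using assms(1)
proof (induction t)
  case (Node n ts)
  have "set_pmf (goal_pmf pa (child (Node n ts) i)) \<subseteq> set (nodes (Node n ts))"
    if "ts \<noteq> []" "i \<in> set_pmf pa" for i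
  proof -
    have "i \<in> indices (Node n ts)"
      using that assms(2) full_ktree_indices[OF Node.prems] by auto
    then have "child (Node n ts) i \<in> set ts" using child_mem[of i "Node n ts"] by simp
    then show ?thesis using Node.IH Node.prems by fastforce
  qed
  then show ?case using goal_pmf_unfold[OF Node.prems assms(2)] by auto
qed

lemma pmf_goal_child:
  assumes "full_ktree k t" "set_pmf pa \<subseteq> {1..k}" "distinct (nodes t)"
    "j \<in> indices t" "m \<in> set (nodes (child t j))"
  shows "pmf (goal_pmf pa t) m = pmf pa j * pmf (goal_pmf pa (child t j)) m"
proof -
  have ne: "children t \<noteq> []" using assms(4) by auto
  then have ind: "indices t = {1..k}" using assms(1) full_ktree_indices by blast
  have z: "pmf (goal_pmf pa (child t i)) m = 0" if "i \<in> {1..k}" "i \<noteq> j" for i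
  proof -
    have "full_ktree k (child t i)"
      using full_ktree_subtree[OF assms(1)] subtree_child[OF subtree_refl] that ind by blast
    moreover have "m \<notin> set (nodes (child t i))"
      using child_inj[OF assms(3)] assms(4,5) that ind by metis
    ultimately show ?thesis using set_goal_pmf[OF _ assms(2)] by (meson pmf_eq_0_set_pmf subsetD)
  qed
  have "pmf (goal_pmf pa t) m = (\<integral>i. pmf (goal_pmf pa (child t i)) m \<partial>measure_pmf pa)"
    using ne by (simp add: goal_pmf_unfold[OF assms(1,2)] pmf_bind)
  also have "\<dots> = (\<Sum>i\<in>{1..k}. pmf (goal_pmf pa (child t i)) m * pmf pa i)"
    using assms(2) by (intro integral_measure_pmf_real) auto
  also have "\<dots> = (\<Sum>i\<in>{j}. pmf (goal_pmf pa (child t i)) m * pmf pa i)"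
    using z assms(4) ind by (intro sum.mono_neutral_right) auto
  finally show ?thesis by simp
qed

lemma pmf_goal_root:
  assumes "full_ktree k t" "set_pmf pa \<subseteq> {1..k}" "distinct (nodes t)"
  shows "pmf (goal_pmf pa t) (root t) = (if children t = [] then 1 else 0)"
proof (cases "children t = []")
  case True
  then show ?thesis by (simp add: goal_pmf_unfold[OF assms(1,2)])
next
  case False
  then have ind: "indices t = {1..k}" using assms(1) full_ktree_indices by blast
  have "root t \<notin> set_pmf (goal_pmf pa (child t i))" if "i \<in> set_pmf pa" for i
  proof -
    have i: "i \<in> indices t" using that assms(2) ind by blast
    then have "full_ktree k (child t i)"
      using full_ktree_subtree[OF assms(1)] subtree_child[OF subtree_refl] by blast
    moreover have "root t \<notin> set (nodes (child t i))"
      using assms(3) child_mem[OF i] by (subst (asm) nodes_unfold) auto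
    ultimately show ?thesis using set_goal_pmf[OF _ assms(2)] by blast
  qed
  then show ?thesis using False by (simp add: goal_pmf_unfold[OF assms(1,2)] pmf_eq_0_set_pmf)
qed

section \<open>Values of depth-first search\<close>

fun sched :: "(nat \<Rightarrow> real) \<Rightarrow> (nat \<Rightarrow> nat \<Rightarrow> real) \<Rightarrow> (nat \<Rightarrow> nat) \<Rightarrow> nat \<Rightarrow> nat list \<Rightarrow> real" where
  "sched p E sz \<tau> [] = 0"
| "sched p E sz \<tau> (i # is) = p i * E i (\<tau> + 1) + sched p E sz (\<tau> + 2 * sz i) is"

lemma sched_cong [fundef_cong]:
  assumes "p = p'" "\<And>i s. i \<in> set is' \<Longrightarrow> E i s = E' i s" "\<And>i. i \<in> set is' \<Longrightarrow> sz i = sz' i"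
    "\<tau> = \<tau>'" "is = is'"
  shows "sched p E sz \<tau> is = sched p' E' sz' \<tau>' is'"
  using assms(2,3) unfolding assms(1,4,5) by (induction is' arbitrary: \<tau>') auto

lemma sched_append:
  "sched p E sz \<tau> (is @ js) = sched p E sz \<tau> is + sched p E sz (\<tau> + 2 * sum_list (map sz is)) js"
  by (induction "is" arbitrary: \<tau>) (auto simp: algebra_simps)

lemma sched_shift:
  "(\<And>i s. i \<in> set is \<Longrightarrow> E i (s + \<delta>) = E' i s) \<Longrightarrow> sched p E sz (\<tau> + \<delta>) is = sched p E' sz \<tau> is"
proof (induction "is" arbitrary: \<tau>)
  case (Cons i "is")
  have "E i (\<tau> + \<delta> + 1) = E' i (\<tau> + 1)" using Cons.prems[of i "\<tau> + 1"] by (simp add: add.commute add.left_commute)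
  moreover have "sched p E sz (\<tau> + \<delta> + 2 * sz i) is = sched p E' sz (\<tau> + 2 * sz i) is"
    using Cons.IH[of "\<tau> + 2 * sz i"] Cons.prems by (simp add: ac_simps)
  ultimately show ?case by simp
qed simp

lemma sched_linear:
  "(\<And>i s. i \<in> set is \<Longrightarrow> E i s = a * E1 i s + b * E2 i s) \<Longrightarrow>
    sched p E sz \<tau> is = a * sched p E1 sz \<tau> is + b * sched p E2 sz \<tau> is"
  by (induction "is" arbitrary: \<tau>) (auto simp: algebra_simps)

lemma sched_mono:
  "(\<And>i s. i \<in> set is \<Longrightarrow> E i s \<le> E' i s) \<Longrightarrow> (\<And>i. 0 \<le> p i) \<Longrightarrow>
    sched p E sz \<tau> is \<le> sched p E' sz \<tau> is"
  by (induction "is" arbitrary: \<tau>) (auto intro!: add_mono mult_left_mono)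

lemma sched_lower:
  assumes "antimono f" "\<And>i. 0 \<le> p i"
    "\<And>i s. i \<in> set is \<Longrightarrow> f (s + 2 * sz i) \<le> E i (s + 1)"
  shows "sum_list (map p is) * f (\<tau> + 2 * sum_list (map sz is)) \<le> sched p E sz \<tau> is"
  using assms(3)
proof (induction "is" arbitrary: \<tau>)
  case (Cons i "is")
  let ?u = "\<tau> + 2 * sum_list (map sz (i # is))"
  have "f ?u \<le> f (\<tau> + 2 * sz i)" by (rule antimonoD[OF assms(1)]) simp
  also have "\<dots> \<le> E i (\<tau> + 1)" using Cons.prems by simp
  finally have "p i * f ?u \<le> p i * E i (\<tau> + 1)" using assms(2) by (intro mult_left_mono)
  moreover have "?u = \<tau> + 2 * sz i + 2 * sum_list (map sz is)" by simp
  then have "sum_list (map p is) * f ?u \<le> sched p E sz (\<tau> + 2 * sz i) is"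
    using Cons.IH[of "\<tau> + 2 * sz i"] Cons.prems by (simp only: list.set_intros)
  ultimately have "p i * f ?u + sum_list (map p is) * f ?u
      \<le> p i * E i (\<tau> + 1) + sched p E sz (\<tau> + 2 * sz i) is"
    by (rule add_mono)
  then show ?case by (simp only: list.map sum_list.Cons sched.simps distrib_right)
qed simp

text \<open>\<open>tree_value p f \<tau> t\<close> is the expected value of \<open>f\<close> at the time at which a depth-first search that
  enters \<open>t\<close> at time \<open>\<tau>\<close> and descends in the order of the child indices finds the goal of \<open>t\<close>;
  a finished subtree with \<open>m\<close> nodes costs \<open>2m\<close> steps.\<close>

function tree_value :: "(nat \<Rightarrow> real) \<Rightarrow> (nat \<Rightarrow> real) \<Rightarrow> nat \<Rightarrow> ktree \<Rightarrow> real" where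
  "tree_value p f \<tau> t = (if children t = [] then f \<tau>
     else sched p (\<lambda>i s. tree_value p f s (child t i)) (\<lambda>i. tsize (child t i)) \<tau> [1..<Suc (length (children t))])"
  by auto
termination
proof (relation "Wellfounded.measure (\<lambda>(p, f, \<tau>, t). tsize t)", goal_cases)
  case (2 p f \<tau> t i s)
  then have "i \<in> indices t" by auto
  then show ?case using tsize_children[OF child_mem] by simp
qed simp

declare tree_value.simps [simp del]

abbreviation order_value :: "(nat \<Rightarrow> real) \<Rightarrow> (nat \<Rightarrow> real) \<Rightarrow> nat \<Rightarrow> ktree \<Rightarrow> nat list \<Rightarrow> real" where
  "order_value p f \<tau> t is \<equiv> sched p (\<lambda>i s. tree_value p f s (child t i)) (\<lambda>i. tsize (child t i)) \<tau> is"

lemma tree_value_leaf: "children t = [] \<Longrightarrow> tree_value p f \<tau> t = f \<tau>"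
  by (simp add: tree_value.simps)

lemma tree_value_inner: "children t \<noteq> [] \<Longrightarrow> tree_value p f \<tau> t = order_value p f \<tau> t [1..<Suc (length (children t))]"
  by (subst tree_value.simps) simp

lemma tree_value_shift: "tree_value p f (\<tau> + \<delta>) t = tree_value p (\<lambda>s. f (s + \<delta>)) \<tau> t"
proof (induction t arbitrary: \<tau> rule: measure_induct_rule[where f = tsize])
  case (less t)
  show ?case
  proof (cases "children t = []")
    case False
    show ?thesis unfolding tree_value_inner[OF False]
      using less tsize_children[OF child_mem] by (intro sched_shift) auto
  qed (simp add: tree_value_leaf)
qed

lemma tree_value_linear: "tree_value p (\<lambda>s. a * f s + b * g s) \<tau> t = a * tree_value p f \<tau> t + b * tree_value p g \<tau> t"
proof (induction t arbitrary: \<tau> rule: measure_induct_rule[where f = tsize])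
  case (less t)
  show ?case
  proof (cases "children t = []")
    case False
    show ?thesis unfolding tree_value_inner[OF False]
      using less tsize_children[OF child_mem] by (intro sched_linear) auto
  qed (simp add: tree_value_leaf)
qed

lemma tree_value_mono:
  assumes "\<And>s. f s \<le> g s" "\<And>i. 0 \<le> p i"
  shows "tree_value p f \<tau> t \<le> tree_value p g \<tau> t"
proof (induction t arbitrary: \<tau> rule: measure_induct_rule[where f = tsize])
  case (less t)
  show ?case
  proof (cases "children t = []")
    case False
    show ?thesis unfolding tree_value_inner[OF False]
      using less tsize_children[OF child_mem] assms(2) by (intro sched_mono) auto
  qed (simp add: tree_value_leaf assms(1))
qed

text \<open>The search is at the end of a path from the root, stored with the current node on top. A frame
  \<open>(w, t, U)\<close> consists of the probability \<open>w\<close> that the goal lies in the subtree \<open>t\<close> and the set \<open>U\<close> of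
  the child indices of \<open>t\<close> that have not been taken.\<close>

type_synonym frame = "real \<times> ktree \<times> nat set"

fun stack_value :: "(nat \<Rightarrow> real) \<Rightarrow> (nat \<Rightarrow> real) \<Rightarrow> nat \<Rightarrow> frame list \<Rightarrow> real" where
  "stack_value p f \<tau> [] = 0"
| "stack_value p f \<tau> ((w, t, U) # z) = w * order_value p f \<tau> t (sorted_list_of_set U)
     + stack_value p f (\<tau> + 2 * (\<Sum>j\<in>U. tsize (child t j)) + 1) z"

lemma stack_value_shift: "stack_value p f (\<tau> + \<delta>) z = stack_value p (\<lambda>s. f (s + \<delta>)) \<tau> z"
proof (induction z arbitrary: \<tau>)
  case (Cons fr z)
  obtain w t U where fr: "fr = (w, t, U)" by (cases fr)
  have "order_value p f (\<tau> + \<delta>) t is = order_value p (\<lambda>s. f (s + \<delta>)) \<tau> t is" for "is"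
    by (intro sched_shift tree_value_shift)
  then show ?case using Cons[of "\<tau> + 2 * (\<Sum>j\<in>U. tsize (child t j)) + 1"]
    by (simp add: fr ac_simps)
qed simp

lemma order_value_linear: "order_value p (\<lambda>s. a * f s + b * g s) \<tau> t is
    = a * order_value p f \<tau> t is + b * order_value p g \<tau> t is"
  by (intro sched_linear tree_value_linear)

lemma stack_value_linear:
  "stack_value p (\<lambda>s. a * f s + b * g s) \<tau> z = a * stack_value p f \<tau> z + b * stack_value p g \<tau> z"
proof (induction z arbitrary: \<tau>)
  case (Cons fr z)
  then show ?case by (cases fr) (simp add: order_value_linear algebra_simps)
qed simp

lemma stack_value_mono:
  assumes "\<And>s. f s \<le> g s" "\<And>i. 0 \<le> p i" "\<forall>(w, t, U)\<in>set z. 0 \<le> w"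
  shows "stack_value p f \<tau> z \<le> stack_value p g \<tau> z"
  using assms(3)
proof (induction z arbitrary: \<tau>)
  case (Cons fr z)
  obtain w t U where fr: "fr = (w, t, U)" by (cases fr)
  have "order_value p f \<tau> t is \<le> order_value p g \<tau> t is" for \<tau> "is"
    using assms(1,2) by (intro sched_mono tree_value_mono) auto
  then show ?case using Cons by (auto simp: fr intro!: add_mono mult_left_mono)
qed simp

fun stack_time :: "frame list \<Rightarrow> nat" where
  "stack_time [] = 0"
| "stack_time ((w, t, U) # z) = 2 * (\<Sum>j\<in>U. tsize (child t j)) + 1 + stack_time z"

lemma sum_list_sorted: "finite U \<Longrightarrow> sum_list (map h (sorted_list_of_set U)) = (\<Sum>j\<in>U. h j)"
  by (simp add: sum_list_distinct_conv_sum_set)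

lemma sorted_list_min:
  assumes "finite U" "U \<noteq> {}"
  shows "sorted_list_of_set U = Min U # sorted_list_of_set (U - {Min U})"
  using assms sorted_list_of_set_nonempty by blast

lemma tree_value_step:
  "tree_value p f \<tau> t = (if children t = [] then f \<tau> else 0)
     + order_value p f \<tau> t (sorted_list_of_set (indices t))"
proof (cases "children t = []")
  case False
  have "sorted_list_of_set (indices t) = [1..<Suc (length (children t))]"
    by (simp add: atLeastLessThanSuc_atLeastAtMost[symmetric] del: upt_Suc)
  then show ?thesis using False by (simp add: tree_value_inner)
qed (simp add: tree_value_leaf)

lemma stack_value_down:
  assumes "finite U" "j \<in> U"
  shows "(if children (child t j) = [] then w * p j * f (\<tau> + 1) else 0)
      + stack_value p f (\<tau> + 1) ((w * p j, child t j, indices (child t j)) # (w, t, U - {j}) # z)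
    = w * order_value p f \<tau> t (j # sorted_list_of_set (U - {j}))
      + stack_value p f (\<tau> + 2 * (\<Sum>j\<in>U. tsize (child t j)) + 1) z"
proof -
  have "(\<Sum>j\<in>U. tsize (child t j)) = tsize (child t j) + (\<Sum>j\<in>U - {j}. tsize (child t j))"
    using assms by (simp add: sum.remove)
  then have total: "\<tau> + 2 * (\<Sum>j\<in>U. tsize (child t j)) + 1
      = \<tau> + 2 * tsize (child t j) + 2 * (\<Sum>j\<in>U - {j}. tsize (child t j)) + 1"
    by simp
  have finished: "\<tau> + 1 + 2 * (\<Sum>i\<in>indices (child t j). tsize (child (child t j) i)) + 1
      = \<tau> + 2 * tsize (child t j)"
    by (subst tsize_unfold[of "child t j"]) simp
  show ?thesis
    unfolding stack_value.simps sched.simps finished total tree_value_step[of p f "\<tau> + 1" "child t j"]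
    by (simp add: distrib_left)
qed

lemma stack_time_down:
  assumes "finite U" "j \<in> U"
  shows "Suc (stack_time ((v, child t j, indices (child t j)) # (w, t, U - {j}) # z))
    = stack_time ((w, t, U) # z)"
proof -
  have "(\<Sum>j\<in>U. tsize (child t j)) = tsize (child t j) + (\<Sum>j\<in>U - {j}. tsize (child t j))"
    using assms by (simp add: sum.remove)
  then show ?thesis by (subst (asm) (2) tsize_unfold) simp
qed

locale search =
  fixes k L N :: nat and \<omega> pa :: "nat pmf"
  assumes setting: "setting k L N \<omega> pa" and imbalanced: "imbalanced k pa"
begin

abbreviation p :: "nat \<Rightarrow> real" where "p \<equiv> pmf pa"

lemma k_ge: "k \<ge> 2" and set_\<omega>: "set_pmf \<omega> = {1..L}"
  and set_pa: "set_pmf pa \<subseteq> {1..k}"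
  using setting by (auto simp: setting_def)

lemma p_less: "i \<in> {1..k} \<Longrightarrow> j \<in> {1..k} \<Longrightarrow> i < j \<Longrightarrow> p j < p i"
  using imbalanced by (auto simp: imbalanced_def monotone_on_def)

lemma p_k_pos: "p k > 0"
  using imbalanced by (simp add: imbalanced_def)

lemma p_k_le: "i \<in> {1..k} \<Longrightarrow> p k \<le> p i"
  using p_less[of i k] k_ge by (cases "i = k") auto

lemma p_pos: "i \<in> {1..k} \<Longrightarrow> p i > 0"
  using p_k_le p_k_pos by fastforce

lemma sum_p: "(\<Sum>i\<in>{1..k}. p i) = 1"
  using set_pa by (intro sum_pmf_eq_1) auto

lemma k_p_k_le: "real k * p k \<le> 1"
proof -
  have "(\<Sum>i\<in>{1..k}. p k) \<le> (\<Sum>i\<in>{1..k}. p i)" by (intro sum_mono p_k_le)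
  then show ?thesis using sum_p by simp
qed

lemma tree_value_pos:
  assumes "full_ktree k t" "\<And>s. f s > 0"
  shows "tree_value p f \<tau> t > 0"
  using assms(1)
proof (induction t arbitrary: \<tau> rule: measure_induct_rule[where f = tsize])
  case (less t)
  show ?case
  proof (cases "children t = []")
    case True
    then show ?thesis by (simp add: tree_value_leaf assms(2))
  next
    case False
    then have ind: "indices t = {1..k}" using full_ktree_indices less.prems by blast
    have ev1: "tree_value p f s (child t i) > 0" if "i \<in> {1..k}" for i s
      using that less.IH tsize_children[OF child_mem] ind
        full_ktree_subtree[OF less.prems subtree_child[OF subtree_refl]] by blast
    have "order_value p f \<tau> t is > 0" if "set is \<subseteq> {1..k}" "is \<noteq> []" for \<tau> "is"
      using that
    proof (induction "is" arbitrary: \<tau>)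
      case (Cons i "is")
      have "p i * tree_value p f (\<tau> + 1) (child t i) > 0" using Cons.prems p_pos ev1 by auto
      moreover have "order_value p f s t is \<ge> 0" for s
        using Cons by (cases "is = []") (auto simp: less_imp_le)
      ultimately show ?case by (simp add: add_pos_nonneg)
    qed simp
    from this[of "[1..<Suc k]" \<tau>] have "order_value p f \<tau> t [1..<Suc k] > 0"
      using k_ge by (simp add: atLeastLessThanSuc_atLeastAtMost del: upt_Suc)
    moreover have "length (children t) = k" using False less.prems full_ktree_unfold by blast
    ultimately show ?thesis by (subst tree_value_inner[OF False]) metis
  qed
qed

lemma order_value_nonneg:
  assumes "\<And>s. 0 \<le> f s"
  shows "0 \<le> order_value p f \<tau> t is"
proof -
  have "0 \<le> tree_value p f s u" for s u
    using tree_value_mono[of "\<lambda>_. 0" f p s u] tree_value_linear[of p 0 f 0 f s u] assms by simp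
  then show ?thesis by (induction "is" arbitrary: \<tau>) auto
qed

lemma tree_value_lower:
  assumes "full_ktree k t" "antimono f"
  shows "f (\<tau> + 2 * tsize t - 1) \<le> tree_value p f \<tau> t"
  using assms(1)
proof (induction t arbitrary: \<tau> rule: measure_induct_rule[where f = tsize])
  case (less t)
  show ?case
  proof (cases "children t = []")
    case True
    then show ?thesis using tsize_pos[of t] by (auto simp: tree_value_leaf intro!: antimonoD[OF assms(2)])
  next
    case False
    then have ind: "indices t = {1..k}" using full_ktree_indices less.prems by blast
    let ?is = "sorted_list_of_set (indices t)"
    have "f (s + 2 * tsize (child t i)) \<le> tree_value p f (s + 1) (child t i)" if "i \<in> set ?is" for i s
      using that less.IH[of "child t i" "s + 1"] tsize_children[OF child_mem] ind
        full_ktree_subtree[OF less.prems subtree_child[OF subtree_refl]] by auto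
    then have "sum_list (map p ?is) * f (\<tau> + 2 * sum_list (map (\<lambda>i. tsize (child t i)) ?is))
      \<le> order_value p f \<tau> t ?is"
      using assms(2) by (intro sched_lower) auto
    moreover have "sum_list (map p ?is) = 1" using sum_p unfolding ind by (simp add: sum_list_sorted)
    moreover have "sum_list (map (\<lambda>i. tsize (child t i)) ?is) = (\<Sum>i\<in>indices t. tsize (child t i))"
      by (rule sum_list_sorted) simp
    moreover have "f (\<tau> + 2 * tsize t - 1) \<le> f (\<tau> + 2 * (\<Sum>i\<in>indices t. tsize (child t i)))"
      using tsize_unfold[of t] by (intro antimonoD[OF assms(2)]) linarith
    moreover have "tree_value p f \<tau> t = order_value p f \<tau> t ?is"
      using False tree_value_step[of p f \<tau> t] by simp
    ultimately show ?thesis by simp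
  qed
qed

lemma order_value_lower:
  assumes "full_ktree k t" "antimono f" "U \<subseteq> indices t"
  shows "(\<Sum>j\<in>U. p j) * f (\<tau> + 2 * (\<Sum>j\<in>U. tsize (child t j)))
    \<le> order_value p f \<tau> t (sorted_list_of_set U)"
proof -
  have fin: "finite U" using assms(3) finite_subset by blast
  have "f (s + 2 * tsize (child t i)) \<le> tree_value p f (s + 1) (child t i)" if "i \<in> U" for i s
    using tree_value_lower[of "child t i" f "s + 1"] that assms
      full_ktree_subtree[OF assms(1) subtree_child[OF subtree_refl]] by auto
  then show ?thesis
    using sched_lower[of f p "sorted_list_of_set U" "\<lambda>i. tsize (child t i)"
        "\<lambda>i s. tree_value p f s (child t i)" \<tau>] assms(2) fin
    by (simp add: sum_list_sorted)
qed

end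

section \<open>Histories and the stack of the search\<close>

definition visited :: "state \<Rightarrow> nat set" where
  "visited s = insert (current_node s) ((fst \<circ> fst) ` set (fst s))"

definition taken :: "state \<Rightarrow> nat \<Rightarrow> action set" where
  "taken s n = {a. \<exists>c. ((n, c), a) \<in> set (fst s)}"

lemma taken_here_eq: "taken_here s = taken s (current_node s)"
  by (simp add: taken_here_def taken_def)

lemma taken_snoc: "taken (xs @ [(ob, a)], ob') n = taken (xs, ob) n \<union> (if n = fst ob then {a} else {})"
  by (cases ob) (auto simp: taken_def)

lemma taken_subset_visited: "n \<notin> visited s \<Longrightarrow> taken s n = {}"
  by (force simp: visited_def taken_def)

lemma visited_snoc: "visited (xs @ [(ob, a)], ob') = insert (fst ob') (visited (xs, ob))"
  by (auto simp: visited_def)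

inductive compat :: "environment \<Rightarrow> state \<Rightarrow> bool" for \<Phi> where
  start: "compat \<Phi> ([], observe \<Phi> (root (fst \<Phi>)))"
| move: "compat \<Phi> s \<Longrightarrow> \<not> at_goal s \<Longrightarrow> legal \<Phi> s a \<Longrightarrow> compat \<Phi> (successor \<Phi> s a)"

lemma compat_Nil: "compat \<Phi> ([], ob) \<longleftrightarrow> ob = observe \<Phi> (root (fst \<Phi>))"
  by (auto intro: compat.start elim: compat.cases simp: successor_def)

lemma compat_snoc: "compat \<Phi> (xs @ [(ob, a)], ob') \<longleftrightarrow> compat \<Phi> (xs, ob) \<and> \<not> at_goal (xs, ob)
    \<and> legal \<Phi> (xs, ob) a \<and> successor \<Phi> (xs, ob) a = (xs @ [(ob, a)], ob')"
proof
  assume "compat \<Phi> (xs @ [(ob, a)], ob')"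
  then show "compat \<Phi> (xs, ob) \<and> \<not> at_goal (xs, ob)
    \<and> legal \<Phi> (xs, ob) a \<and> successor \<Phi> (xs, ob) a = (xs @ [(ob, a)], ob')"
    by cases (auto simp: successor_def)
next
  assume "compat \<Phi> (xs, ob) \<and> \<not> at_goal (xs, ob)
    \<and> legal \<Phi> (xs, ob) a \<and> successor \<Phi> (xs, ob) a = (xs @ [(ob, a)], ob')"
  then show "compat \<Phi> (xs @ [(ob, a)], ob')"
    using compat.move[of \<Phi> "(xs, ob)" a] by simp
qed

definition act :: "environment \<Rightarrow> action \<Rightarrow> state \<Rightarrow> config" where
  "act \<Phi> a s = (if legal \<Phi> s a then (False, successor \<Phi> s a) else (True, s))"

lemma edge_unique:
  assumes "distinct (nodes T)" "edge T n a m" "edge T n a m'"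
  shows "m = m'"
proof (cases a)
  case (Down i)
  then show ?thesis using assms by (auto simp: is_child_iff dest: subtree_root_inj)
next
  case Up
  then show ?thesis using assms parent_unique[OF assms(1)] by auto
qed

lemma successor_edge:
  assumes "distinct (nodes T)" "edge T (current_node s) a m"
  shows "successor (T, g) s a = (fst s @ [(snd s, a)], observe (T, g) m)"
proof -
  have "(THE m. edge T (current_node s) a m) = m"
    using assms edge_unique by blast
  then show ?thesis by (simp add: successor_def)
qed

lemma edge_nodes:
  assumes "distinct (nodes T)" "edge T n a m"
  shows "m \<in> set (nodes T)"
  using assms is_child_nodes[OF assms(1)] by (cases a) auto

text \<open>Labels are positive, so \<open>(T, 0)\<close> is the tree \<open>T\<close> without a goal.\<close>

locale tree_in =
  fixes k :: nat and T :: ktree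
  assumes full: "full_ktree k T" and distinct: "distinct (nodes T)" and zero: "0 \<notin> set (nodes T)"
begin

lemma observe_no_goal: "m \<in> set (nodes T) \<Longrightarrow> m \<noteq> g \<Longrightarrow> observe (T, g) m = observe (T, 0) m"
  using zero by (cases "m = 0") (auto simp: observe_def)

lemma legal_iff: "legal (T, g) s a \<longleftrightarrow> legal (T, 0) s a"
  by (simp add: legal_def)

lemma legal_obtain:
  assumes "legal (T, g) s a"
  obtains m where "edge T (current_node s) a m" "m \<in> set (nodes T)"
    "successor (T, h) s a = (fst s @ [(snd s, a)], observe (T, h) m)" "a \<notin> taken_here s"
  using assms successor_edge[OF distinct] edge_nodes[OF distinct] unfolding legal_def by auto

lemma compat_no_goal_not_at_goal:
  assumes "compat (T, 0) s"
  shows "\<not> at_goal s"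
  using assms
proof cases
  case start
  have "root T \<noteq> 0" using zero root_in_nodes[of T] by metis
  then show ?thesis using start by (simp add: at_goal_def observe_def)
next
  case (move s a)
  then obtain m where "m \<in> set (nodes T)" "successor (T, 0) s a = (fst s @ [(snd s, a)], observe (T, 0) m)"
    using legal_obtain by metis
  moreover from this have "m \<noteq> 0" using zero by metis
  ultimately show ?thesis using move by (simp add: at_goal_def observe_def)
qed

lemma visited_successor:
  assumes "edge T (current_node s) a m"
  shows "visited (successor (T, g) s a) = insert m (visited s)"
  using successor_edge[OF distinct assms] visited_snoc[of "fst s" "snd s"]
  by (simp add: observe_def)

lemma compat_goal_iff:
  assumes "\<not> at_goal s"
  shows "compat (T, g) s \<longleftrightarrow> compat (T, 0) s \<and> g \<notin> visited s"
proof
  show "compat (T, 0) s \<and> g \<notin> visited s" if "compat (T, g) s"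
    using that assms
  proof induction
    case start
    then have "root T \<noteq> g" by (auto simp: at_goal_def observe_def)
    then show ?case using observe_no_goal[OF root_in_nodes] compat.start[of "(T, 0)"]
      by (auto simp: visited_def observe_def)
  next
    case (move s a)
    obtain m where m: "edge T (current_node s) a m" "m \<in> set (nodes T)"
      "successor (T, h) s a = (fst s @ [(snd s, a)], observe (T, h) m)" for h
      using legal_obtain[OF move(3)] successor_edge[OF distinct] by metis
    then have "m \<noteq> g" using move.prems by (auto simp: at_goal_def observe_def)
    then have eq: "successor (T, g) s a = successor (T, 0) s a"
      using m observe_no_goal by simp
    have "compat (T, 0) (successor (T, 0) s a)"
      using compat.move move legal_iff by blast
    moreover have "g \<notin> visited (successor (T, 0) s a)"
      using visited_successor[OF m(1)] move \<open>m \<noteq> g\<close> by auto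
    ultimately show ?case unfolding eq by blast
  qed
  have "compat (T, g) s" if "compat (T, 0) s" "g \<notin> visited s"
    using that
  proof induction
    case start
    then have "root T \<noteq> g" by (auto simp: visited_def observe_def)
    then show ?case using observe_no_goal[OF root_in_nodes] compat.start[of "(T, g)"] by auto
  next
    case (move s a)
    obtain m where m: "edge T (current_node s) a m" "m \<in> set (nodes T)"
      "successor (T, h) s a = (fst s @ [(snd s, a)], observe (T, h) m)" for h
      using legal_obtain[OF move(3)] successor_edge[OF distinct] by metis
    have "g \<notin> visited s" "m \<noteq> g" using move.prems visited_successor[OF m(1)] by auto
    then have "successor (T, g) s a = successor (T, 0) s a"
      using m observe_no_goal by simp
    moreover have "compat (T, g) (successor (T, g) s a)"
      using compat.move[of "(T, g)" s a] move \<open>g \<notin> visited s\<close> legal_iff by blast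
    ultimately show ?case by simp
  qed
  then show "compat (T, 0) s \<and> g \<notin> visited s \<Longrightarrow> compat (T, g) s" by blast
qed

end

lemma compat_swap:
  assumes "tree_in k T" "i \<in> {1..k}" "j \<in> {1..k}" "compat (T, 0) s" "{Down i, Down j} \<inter> taken s n = {}"
  shows "compat (swap_children n i j T, 0) s"
proof -
  interpret tree_in k T by fact
  have obs: "observe (swap_children n i j T, 0) m = observe (T, 0) m" for m
    using is_leaf_swap[OF distinct full assms(2,3)] by (simp add: observe_def)
  show ?thesis
    using assms(4,5)
  proof induction
    case start
    show ?case using compat.start[of "(swap_children n i j T, 0)"] by (simp add: obs)
  next
    case (move s a)
    have tk: "taken (successor (T, 0) s a) n = taken s n \<union> (if n = current_node s then {a} else {})"
      using taken_snoc[of "fst s" "snd s" a] by (simp add: successor_def)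
    have "edge (swap_children n i j T) (current_node s) a c \<longleftrightarrow> edge T (current_node s) a c" for c
      using tk move.prems by (intro edge_swap[OF distinct full assms(2,3)]) auto
    then have "legal (swap_children n i j T, 0) s a"
      "successor (swap_children n i j T, 0) s a = successor (T, 0) s a"
      using move.hyps by (simp_all add: legal_def successor_def obs)
    then show ?case using compat.move[of "(swap_children n i j T, 0)" s a] move tk by auto
  qed
qed

fun labels :: "frame list \<Rightarrow> nat multiset" where
  "labels [] = {#}"
| "labels ((w, t, U) # z) = add_mset (root t) ((\<Sum>j\<in>U. mset (nodes (child t j))) + labels z)"

lemma mem_labels:
  assumes "(w, t, U) \<in> set z"
  shows "root t \<in># labels z" "finite U \<Longrightarrow> j \<in> U \<Longrightarrow> x \<in> set (nodes (child t j)) \<Longrightarrow> x \<in># labels z"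
  using assms by (induction z rule: labels.induct) (auto simp: set_mset_sum)

lemma top_label_unique:
  assumes "labels ((w, t, U) # z) \<subseteq># mset (nodes T)" "distinct (nodes T)" "finite U"
  shows "root t \<notin># labels z" "j \<in> U \<Longrightarrow> root t \<notin> set (nodes (child t j))"
proof -
  have "count (labels ((w, t, U) # z)) (root t) \<le> 1"
    using mset_subset_eq_count[OF assms(1), of "root t"] distinct_count_atmost_1[of "nodes T"] assms(2)
    by (metis count_mset_gt_0 less_one not_gr_zero order_trans le_refl linorder_le_cases zero_le_one)
  then have "count ((\<Sum>j\<in>U. mset (nodes (child t j))) + labels z) (root t) = 0" by simp
  then have "root t \<notin># (\<Sum>j\<in>U. mset (nodes (child t j))) + labels z"
    by (simp add: count_eq_zero_iff)
  then show "root t \<notin># labels z" "j \<in> U \<Longrightarrow> root t \<notin> set (nodes (child t j))"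
    using assms(3) by (auto simp: set_mset_sum)
qed

context search
begin

inductive stack :: "ktree \<Rightarrow> frame list \<Rightarrow> bool" for T where
  bottom: "U \<subseteq> indices T \<Longrightarrow> stack T [(1, T, U)]"
| push: "stack T ((w, t, U) # z) \<Longrightarrow> j \<in> indices t - U \<Longrightarrow> V \<subseteq> indices (child t j) \<Longrightarrow>
    stack T ((w * p j, child t j, V) # (w, t, U) # z)"

lemma stack_not_Nil: "\<not> stack T []"
  by (auto elim: stack.cases)

lemma stack_pop: "stack T (fr # fr' # z) \<Longrightarrow> stack T (fr' # z)"
  by (auto elim: stack.cases)

lemma stack_top:
  assumes "stack T ((w, t, U) # z)"
  shows "U \<subseteq> indices t"
  using assms by cases simp_all

lemma stack_restrict: "stack T ((w, t, U) # z) \<Longrightarrow> U' \<subseteq> U \<Longrightarrow> stack T ((w, t, U') # z)"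
  by (erule stack.cases) (auto intro!: stack.intros)

lemma stack_subtree: "stack T z \<Longrightarrow> (w, t, U) \<in> set z \<Longrightarrow> t \<in> subtrees T"
proof (induction arbitrary: w t U rule: stack.induct)
  case (push w' t' U' z j V)
  have "child t' j \<in> subtrees T"
    using push.IH[of w' t' U'] push.hyps by (intro subtree_child) auto
  then show ?case using push.IH push.prems by auto
qed (simp add: subtree_refl)

lemma stack_indices: "stack T z \<Longrightarrow> (w, t, U) \<in> set z \<Longrightarrow> U \<subseteq> indices t"
  by (induction arbitrary: w t U rule: stack.induct) auto

lemma stack_finite: "stack T z \<Longrightarrow> (w, t, U) \<in> set z \<Longrightarrow> finite U"
  using finite_subset[OF stack_indices finite_atLeastAtMost] .

lemma stack_depth: "stack T ((w, t, U) # z) \<Longrightarrow> depth t + length z \<le> depth T"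
proof (induction "(w, t, U) # z" arbitrary: w t U z rule: stack.induct)
  case (push w t U z j V)
  then show ?case using depth_child[of j t] by fastforce
qed simp

lemma stack_Down_p: "full_ktree k T \<Longrightarrow> stack T z \<Longrightarrow> (w, t, U) \<in> set z \<Longrightarrow> indices t \<subseteq> {1..k}"
  using full_ktree_indices[OF full_ktree_subtree[OF _ stack_subtree]]
  by (metis atLeastatMost_empty_iff2 empty_subsetI list.size(3) not_one_le_zero order_refl)

lemma stack_weight:
  assumes "full_ktree k T" "stack T ((w, t, U) # z)"
  shows "p k ^ length z \<le> w"
  using assms(2)
proof (induction "(w, t, U) # z" arbitrary: w t U z rule: stack.induct)
  case (push w t U z j V)
  have "j \<in> {1..k}" using stack_Down_p[OF assms(1) push(1), of w t U] push(3) by auto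
  then have "p k ^ length z * p k \<le> w * p j"
    using push(2) p_k_le p_k_pos by (intro mult_mono) (auto intro: order_trans[OF _ push(2)])
  then show ?case by (simp add: mult.commute)
qed simp

lemma stack_weight_pos:
  "full_ktree k T \<Longrightarrow> stack T ((w, t, U) # z) \<Longrightarrow> 0 < w"
  using stack_weight p_k_pos by (meson less_le_trans zero_less_power)

lemma stack_weights_nonneg:
  assumes "stack T z"
  shows "\<forall>(w, t, U)\<in>set z. 0 \<le> w"
  using assms by induction auto

lemma stack_goal:
  assumes "full_ktree k T" "distinct (nodes T)" "stack T ((w, t, U) # z)" "m \<in> set (nodes t)"
  shows "pmf (goal_pmf pa T) m = w * pmf (goal_pmf pa t) m"
  using assms(3,4)
proof (induction "(w, t, U) # z" arbitrary: w t U z rule: stack.induct)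
  case (push w t U z j V)
  have t: "t \<in> subtrees T" using stack_subtree[OF push(1)] by auto
  have "set (nodes (child t j)) \<subseteq> set (nodes t)"
    using nodes_subtree[OF subtree_child[OF subtree_refl]] push by blast
  then have "pmf (goal_pmf pa T) m = w * pmf (goal_pmf pa t) m" using push by blast
  also have "pmf (goal_pmf pa t) m = p j * pmf (goal_pmf pa (child t j)) m"
    using push assms full_ktree_subtree[OF _ t] distinct_subtree[OF _ t] set_pa
    by (intro pmf_goal_child) auto
  finally show ?case by simp
qed simp

lemma stack_unique:
  assumes "distinct (nodes T)" "stack T ((w, t, U) # z)" "stack T ((w', t', U') # z')" "root t = root t'"
  shows "w = w' \<and> t = t'"
  using assms(2-)
proof (induction "(w, t, U) # z" arbitrary: w t U z w' t' U' z' rule: stack.induct)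
  case (bottom U)
  from bottom(2) show ?case
  proof cases
    case (push w t V z j)
    then have "is_child T (root t) j (root T)"
      using stack_subtree[of T "(w, t, V) # z" w t V] bottom by (auto simp: is_child_iff)
    then show ?thesis using is_child_nodes(3)[OF assms(1)] by blast
  qed simp
next
  case (push w t U z j V)
  have c: "is_child T (root t) j (root (child t j))"
    using stack_subtree[OF push(1), of w t U] push(3) by (auto simp: is_child_iff)
  note root_eq = push.prems(2) and IH = push.hyps(2)
  from push.prems(1) show ?case
  proof cases
    case bottom
    then show ?thesis using is_child_nodes(3)[OF assms(1) c] root_eq by simp
  next
    case 2: (push w2 t2 U2 z2 j2)
    have "is_child T (root t2) j2 (root (child t2 j2))"
      using stack_subtree[of T "(w2, t2, U2) # z2" w2 t2 U2] 2 by (auto simp: is_child_iff)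
    then have "root t = root t2 \<and> j = j2"
      using parent_unique[OF assms(1) c] root_eq 2 by metis
    then show ?thesis using IH[of w2 t2 U2 z2] 2 by auto
  qed
qed

definition tracks :: "ktree \<Rightarrow> state \<Rightarrow> frame list \<Rightarrow> bool" where
  "tracks T s z \<longleftrightarrow> stack T z \<and> snd s = observe (T, 0) (root (fst (snd (hd z)))) \<and>
     (\<forall>(w, t, U)\<in>set z. U = {j \<in> indices t. Down j \<notin> taken s (root t)} \<and> Up \<notin> taken s (root t) \<and>
        (\<forall>j\<in>U. visited s \<inter> set (nodes (child t j)) = {})) \<and>
     labels z \<subseteq># mset (nodes T) \<and> length (fst s) + stack_time z < 2 * tsize T"

end

lemma sum_children_swap:
  fixes h :: "ktree \<Rightarrow> 'a::comm_monoid_add"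
  assumes "U \<subseteq> indices t" "root t = n \<Longrightarrow> i \<in> U \<and> j \<in> U" "\<And>u. h (swap_children n i j u) = h u"
  shows "(\<Sum>x\<in>U. h (child (swap_children n i j t) x)) = (\<Sum>x\<in>U. h (child t x))"
proof (cases "root t = n")
  case True
  then have ij: "i \<in> U" "j \<in> U" using assms by auto
  have "(\<Sum>x\<in>U. h (child (swap_children n i j t) x))
      = (\<Sum>x\<in>U. h (child t (Transposition.transpose i j x)))"
    using child_swap_here[OF True, of i j] ij assms(1) by (intro sum.cong refl) (metis subsetD)
  also have "\<dots> = (\<Sum>x\<in>U. h (child t x))"
    using ij by (intro sum.reindex_bij_witness[of _ "Transposition.transpose i j" "Transposition.transpose i j"])
      (auto simp: Transposition.transpose_def)
  finally show ?thesis .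
next
  case False
  then show ?thesis using child_swap_other[OF False] assms by (intro sum.cong refl) (metis subsetD)
qed

definition swap_frame :: "nat \<Rightarrow> nat \<Rightarrow> nat \<Rightarrow> frame \<Rightarrow> frame" where
  "swap_frame n i j = (\<lambda>(w, t, U). (w, swap_children n i j t, U))"

lemma labels_swap:
  assumes "\<forall>(w, t, U)\<in>set z. U \<subseteq> indices t \<and> (root t = n \<longrightarrow> i \<in> U \<and> j \<in> U)"
  shows "labels (map (swap_frame n i j) z) = labels z"
  using assms
proof (induction z)
  case (Cons fr z)
  obtain w t U where fr: "fr = (w, t, U)" by (cases fr)
  have "(\<Sum>x\<in>U. mset (nodes (child (swap_children n i j t) x))) = (\<Sum>x\<in>U. mset (nodes (child t x)))"
    using Cons.prems by (intro sum_children_swap[where h = "\<lambda>u. mset (nodes u)"]) (auto simp: fr)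
  then show ?case using Cons by (simp add: fr swap_frame_def)
qed simp

lemma stack_time_swap:
  assumes "\<forall>(w, t, U)\<in>set z. U \<subseteq> indices t \<and> (root t = n \<longrightarrow> i \<in> U \<and> j \<in> U)"
  shows "stack_time (map (swap_frame n i j) z) = stack_time z"
  using assms
proof (induction z)
  case (Cons fr z)
  obtain w t U where fr: "fr = (w, t, U)" by (cases fr)
  have "(\<Sum>x\<in>U. tsize (child (swap_children n i j t) x)) = (\<Sum>x\<in>U. tsize (child t x))"
    using Cons.prems by (intro sum_children_swap) (auto simp: fr)
  then show ?case using Cons by (simp add: fr swap_frame_def)
qed simp

context search
begin

lemma stack_swap:
  assumes "stack T z" "\<forall>fr\<in>set (tl z). root (fst (snd fr)) \<noteq> n"
  shows "stack (swap_children n i j T) (map (swap_frame n i j) z)"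
  using assms
proof induction
  case (bottom U)
  then show ?case using stack.bottom[of U "swap_children n i j T"] by (simp add: swap_frame_def)
next
  case (push w t U z l V)
  have c: "child (swap_children n i j t) l = swap_children n i j (child t l)"
    using push by (intro child_swap_other) auto
  have "stack (swap_children n i j T) ((w, swap_children n i j t, U) # map (swap_frame n i j) z)"
    using push by (simp add: swap_frame_def)
  then have "stack (swap_children n i j T)
     ((w * p l, child (swap_children n i j t) l, V) # (w, swap_children n i j t, U) # map (swap_frame n i j) z)"
    using push c by (intro stack.push) auto
  then show ?case by (simp add: swap_frame_def c)
qed

end

locale search_tree = search k L N \<omega> pa + tree_in k T
  for k L N :: nat and \<omega> pa :: "nat pmf" and T :: ktree
begin

lemma tracks_stack: "tracks T s z \<Longrightarrow> stack T z"
  by (simp only: tracks_def)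

lemma tracks_labels: "tracks T s z \<Longrightarrow> labels z \<subseteq># mset (nodes T)"
  by (simp only: tracks_def)

lemma tracks_time: "tracks T s z \<Longrightarrow> length (fst s) + stack_time z < 2 * tsize T"
  by (simp only: tracks_def)

lemma tracks_observe: "tracks T s ((w, t, U) # z) \<Longrightarrow> snd s = observe (T, 0) (root t)"
  by (simp add: tracks_def)

lemma tracks_top: "tracks T s ((w, t, U) # z) \<Longrightarrow> current_node s = root t"
  by (simp add: tracks_def observe_def)

lemma tracks_frame:
  assumes "tracks T s z" "(w, t, U) \<in> set z"
  shows "U = {j \<in> indices t. Down j \<notin> taken s (root t)} \<and> Up \<notin> taken s (root t) \<and>
        (\<forall>j\<in>U. visited s \<inter> set (nodes (child t j)) = {})"
  using bspec[OF conjunct1[OF conjunct2[OF conjunct2[OF iffD1[OF tracks_def assms(1)]]]] assms(2)]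
  unfolding prod.case .

lemma ballI2: "(\<And>v u V. (v, u, V) \<in> A \<Longrightarrow> P v u V) \<Longrightarrow> \<forall>(v, u, V)\<in>A. P v u V"
  by blast

lemma tracksI:
  assumes "stack T ((w, t, U) # z)" "snd s = observe (T, 0) (root t)"
    "labels ((w, t, U) # z) \<subseteq># mset (nodes T)"
    "length (fst s) + stack_time ((w, t, U) # z) < 2 * tsize T"
    "\<And>v u V. (v, u, V) \<in> set ((w, t, U) # z) \<Longrightarrow>
       V = {j \<in> indices u. Down j \<notin> taken s (root u)} \<and> Up \<notin> taken s (root u) \<and>
        (\<forall>j\<in>V. visited s \<inter> set (nodes (child u j)) = {})"
  shows "tracks T s ((w, t, U) # z)"
  unfolding tracks_def list.sel fst_conv snd_conv
  by (intro conjI assms(1-4) ballI2; drule assms(5); elim conjE; assumption)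

lemma tracks_U: "tracks T s z \<Longrightarrow> (w, t, U) \<in> set z \<Longrightarrow> U = {j \<in> indices t. Down j \<notin> taken s (root t)}"
  by (auto simp: tracks_def)

lemma tracks_subtree: "tracks T s z \<Longrightarrow> (w, t, U) \<in> set z \<Longrightarrow> t \<in> subtrees T"
  using stack_subtree by (auto simp: tracks_def)

lemma tracks_finite: "tracks T s z \<Longrightarrow> (w, t, U) \<in> set z \<Longrightarrow> finite U"
  using stack_finite by (auto simp: tracks_def)

lemma tracks_start: "tracks T ([], observe (T, 0) (root T)) [(1, T, indices T)]"
proof -
  have "root T \<notin> set (nodes (child T j))" if "j \<in> indices T" for j
    using distinct child_mem[OF that] by (subst (asm) nodes_unfold) auto
  moreover have "tsize T = Suc (\<Sum>j\<in>indices T. tsize (child T j))" by (rule tsize_unfold)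
  ultimately show ?thesis
    using stack.bottom[of "indices T" T] mset_nodes[of T]
    by (auto simp: tracks_def taken_def visited_def observe_def)
qed

lemma tracks_down:
  assumes tr: "tracks T s ((w, t, U) # z)" and j: "j \<in> U"
  shows "tracks T (fst s @ [(snd s, Down j)], observe (T, 0) (root (child t j)))
    ((w * p j, child t j, indices (child t j)) # (w, t, U - {j}) # z)"
proof -
  let ?c = "child t j" and ?s = "(fst s @ [(snd s, Down j)], observe (T, 0) (root (child t j)))"
  let ?z = "(w * p j, child t j, indices (child t j)) # (w, t, U - {j}) # z"
  have st: "stack T ((w, t, U) # z)" by (rule tracks_stack[OF tr])
  have fin: "finite U" using stack_finite[OF st] by auto
  have jt: "j \<in> indices t" using stack_top[OF st] j by blast
  have st': "stack T ?z"
    using stack_restrict[OF st, of "U - {j}"] jt by (intro stack.push) auto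
  have lab: "labels ?z = labels ((w, t, U) # z)"
    using mset_nodes[of ?c] sum.remove[OF fin j, of "\<lambda>j. mset (nodes (child t j))"] by simp
  then have sub: "labels ?z \<subseteq># mset (nodes T)" using tracks_labels[OF tr] by argo
  note uniq = top_label_unique[OF sub distinct finite_atLeastAtMost]
  have sub_t: "labels ((w, t, U - {j}) # z) \<subseteq># mset (nodes T)"
    using sub by (auto intro: subset_mset.order_trans[rotated])
  note uniq_t = top_label_unique[OF sub_t distinct finite_Diff[OF fin]]
  have fresh: "root ?c \<notin> visited s" using tr j root_in_nodes by (auto simp: tracks_def)
  have tk: "taken ?s n = taken s n \<union> (if n = root t then {Down j} else {})" for n
    using taken_snoc[of "fst s" "snd s" "Down j"] tracks_top[OF tr] by simp
  have vis: "visited ?s = insert (root ?c) (visited s)"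
    using visited_snoc[of "fst s" "snd s"] by (simp add: observe_def)
  have c_t: "root ?c \<noteq> root t" using uniq(1) mem_labels(1)[of w t "U - {j}"] by (metis list.set_intros(1))
  have old: "V = {j \<in> indices u. Down j \<notin> taken s (root u)} \<and> Up \<notin> taken s (root u) \<and>
        (\<forall>j\<in>V. visited s \<inter> set (nodes (child u j)) = {})" if "(v, u, V) \<in> set ((w, t, U) # z)" for v u V
    by (rule tracks_frame[OF tr that])
  have "V = {j \<in> indices u. Down j \<notin> taken ?s (root u)} \<and> Up \<notin> taken ?s (root u) \<and>
        (\<forall>j\<in>V. visited ?s \<inter> set (nodes (child u j)) = {})" if vuV: "(v, u, V) \<in> set ?z" for v u V
  proof -
    from vuV consider "u = ?c" "V = indices ?c" | "u = t" "V = U - {j}" | "(v, u, V) \<in> set z" by auto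
    then show ?thesis
    proof cases
      case 1
      have "taken s (root ?c) = {}" using fresh taken_subset_visited by blast
      moreover have "visited s \<inter> set (nodes (child ?c i)) = {}" if "i \<in> indices ?c" for i
        using old[of w t U] j nodes_subtree[OF subtree_child[OF subtree_refl that]] by auto
      moreover have "root ?c \<notin> set (nodes (child ?c i))" if "i \<in> indices ?c" for i
        using uniq(2)[OF that] .
      ultimately show ?thesis using 1 c_t by (auto simp: tk vis)
    next
      case 2
      have "root ?c \<notin> set (nodes (child t i))" if "i \<in> U - {j}" for i
        using uniq(1) mem_labels(2)[of w t "U - {j}" _ i "root ?c"] that fin by (metis finite_Diff list.set_intros(1))
      then show ?thesis using 2 old[of w t U] by (auto simp: tk vis)
    next
      case 3
      have "finite V" using stack_finite[OF st] 3 by (metis list.set_intros(2))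
      then have "root ?c \<notin> set (nodes (child u i))" if "i \<in> V" for i
        using uniq(1) mem_labels(2)[of v u V _ i "root ?c"] that 3 by (metis list.set_intros(2))
      moreover have "root u \<noteq> root t" using uniq_t(1) mem_labels(1)[OF 3] by metis
      ultimately show ?thesis using old[of v u V] 3 by (auto simp: tk vis)
    qed
  qed
  moreover have "length (fst ?s) + stack_time ?z < 2 * tsize T"
  proof -
    have "length (fst ?s) = Suc (length (fst s))" by simp
    then show ?thesis
      using stack_time_down[OF fin j, of "w * p j" t w z] tracks_time[OF tr] by linarith
  qed
  ultimately show ?thesis by (intro tracksI[OF st' _ sub]) simp_all
qed

lemma tracks_up:
  assumes tr: "tracks T s ((w, t, U) # (w', t', U') # z)"
  shows "tracks T (fst s @ [(snd s, Up)], observe (T, 0) (root t')) ((w', t', U') # z)"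
proof -
  let ?s = "(fst s @ [(snd s, Up)], observe (T, 0) (root t'))" and ?z = "(w', t', U') # z"
  have st: "stack T ((w, t, U) # ?z)" by (rule tracks_stack[OF tr])
  have fin: "finite U" "finite U'" using stack_finite[OF st] by auto
  have sub0: "labels ((w, t, U) # ?z) \<subseteq># mset (nodes T)" by (rule tracks_labels[OF tr])
  have sub: "labels ?z \<subseteq># mset (nodes T)"
    using sub0 by (auto intro: subset_mset.order_trans[rotated])
  note uniq = top_label_unique[OF sub0 distinct fin(1)] and uniq' = top_label_unique[OF sub distinct fin(2)]
  have tk: "taken ?s n = taken s n \<union> (if n = root t then {Up} else {})" for n
    using taken_snoc[of "fst s" "snd s" Up] tracks_top[OF tr] by simp
  have vis: "visited ?s = insert (root t') (visited s)"
    using visited_snoc[of "fst s" "snd s"] by (simp add: observe_def)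
  have "V = {j \<in> indices u. Down j \<notin> taken ?s (root u)} \<and> Up \<notin> taken ?s (root u) \<and>
        (\<forall>j\<in>V. visited ?s \<inter> set (nodes (child u j)) = {})" if vuV: "(v, u, V) \<in> set ?z" for v u V
  proof -
    have old: "V = {j \<in> indices u. Down j \<notin> taken s (root u)} \<and> Up \<notin> taken s (root u) \<and>
        (\<forall>j\<in>V. visited s \<inter> set (nodes (child u j)) = {})"
      by (rule tracks_frame[OF tr, of v]) (use that in auto)
    have "root u \<noteq> root t" using uniq(1) mem_labels(1)[OF vuV] by metis
    moreover have "root t' \<notin> set (nodes (child u i))" if "i \<in> V" for i
    proof (cases "(v, u, V) \<in> set z")
      case True
      have "finite V" using stack_finite[OF st, of v u V] vuV by auto
      then show ?thesis using uniq'(1) mem_labels(2)[OF True] that by metis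
    next
      case False
      then show ?thesis using vuV uniq'(2) that by auto
    qed
    ultimately show ?thesis using old by (auto simp: tk vis)
  qed
  moreover have "length (fst ?s) + stack_time ?z < 2 * tsize T"
    using tracks_time[OF tr] by simp
  ultimately show ?thesis by (intro tracksI[OF stack_pop[OF st] _ sub]) simp_all
qed

lemma edge_down:
  assumes "tracks T s ((w, t, U) # z)"
  shows "edge T (current_node s) (Down j) m \<longleftrightarrow> j \<in> indices t \<and> m = root (child t j)"
  using is_child_child[OF distinct tracks_subtree[OF assms, of w t U]] tracks_top[OF assms] by simp

lemma edge_up:
  assumes "tracks T s ((w, t, U) # z)"
  shows "edge T (current_node s) Up m \<longleftrightarrow> (\<exists>w' t' U' z'. z = (w', t', U') # z' \<and> m = root t')"
proof -
  have st: "stack T ((w, t, U) # z)" by (rule tracks_stack[OF assms])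
  show ?thesis
    using st
  proof cases
    case bottom
    then show ?thesis using is_child_nodes(3)[OF distinct] tracks_top[OF assms] by auto
  next
    case (push w' t' U' z' j)
    have "is_child T (root t') j (root t)"
      using stack_subtree[of T "(w', t', U') # z'" w' t' U'] push by (auto simp: is_child_iff)
    then show ?thesis using push tracks_top[OF assms] parent_unique[OF distinct] by auto
  qed
qed

lemma legal_down:
  assumes "tracks T s ((w, t, U) # z)"
  shows "legal (T, g) s (Down j) \<longleftrightarrow> j \<in> U"
  using edge_down[OF assms] tracks_U[OF assms, of w t U] tracks_top[OF assms]
  by (auto simp: legal_def taken_here_eq)

lemma legal_up:
  assumes "tracks T s ((w, t, U) # z)"
  shows "legal (T, g) s Up \<longleftrightarrow> z \<noteq> []"
proof -
  have "Up \<notin> taken_here s" using assms tracks_top[OF assms] by (simp add: tracks_def taken_here_eq)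
  then show ?thesis using edge_up[OF assms] by (cases z) (auto simp: legal_def)
qed

lemma successor_down:
  assumes "tracks T s ((w, t, U) # z)" "j \<in> U"
  shows "successor (T, g) s (Down j) = (fst s @ [(snd s, Down j)], observe (T, g) (root (child t j)))"
  using assms edge_down[OF assms(1)] tracks_U[OF assms(1), of w t U]
  by (intro successor_edge[OF distinct]) auto

lemma successor_up:
  assumes "tracks T s ((w, t, U) # (w', t', U') # z)"
  shows "successor (T, g) s Up = (fst s @ [(snd s, Up)], observe (T, g) (root t'))"
  using edge_up[OF assms(1)] by (intro successor_edge[OF distinct]) auto

lemma compat_tracks: "compat (T, 0) s \<Longrightarrow> \<exists>z. tracks T s z"
proof (induction rule: compat.induct)
  case start
  then show ?case using tracks_start by auto
next
  case (move s a)
  then obtain z0 where z0: "tracks T s z0" by blast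
  moreover have "z0 \<noteq> []" using z0 stack_not_Nil by (auto simp: tracks_def)
  ultimately obtain w t U z where z: "tracks T s ((w, t, U) # z)"
    by (metis list.exhaust prod_cases3)
  show ?case
  proof (cases a)
    case (Down j)
    then have "j \<in> U" using legal_down[OF z] move by simp
    then show ?thesis using tracks_down[OF z] successor_down[OF z] Down by metis
  next
    case Up
    then obtain w' t' U' z' where "z = (w', t', U') # z'"
      using legal_up[OF z] move by (metis list.exhaust prod_cases3)
    then show ?thesis using tracks_up successor_up z Up by metis
  qed
qed

lemma tracks_unvisited:
  assumes "tracks T s ((w, t, U) # z)"
  shows "unvisited_children k s = U"
proof -
  have t: "t \<in> subtrees T" using tracks_subtree[OF assms, of w t U] by simp
  have obs: "snd s = observe (T, 0) (root t)" using assms by (simp add: tracks_def)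
  have U: "U = {j \<in> indices t. Down j \<notin> taken_here s}"
    using tracks_U[OF assms, of w t U] tracks_top[OF assms] by (simp add: taken_here_eq)
  have nz: "root t \<noteq> 0" using root_subtree_in_nodes[OF t] zero by metis
  show ?thesis
  proof (cases "children t = []")
    case True
    then show ?thesis using U obs nz is_leaf_iff[OF distinct t]
      by (simp add: unvisited_children_def observe_def)
  next
    case False
    then show ?thesis using U obs nz is_leaf_iff[OF distinct t]
        full_ktree_unfold[of k t] full_ktree_subtree[OF full t]
      by (simp add: unvisited_children_def observe_def)
  qed
qed

lemma ranked_action:
  assumes "tracks T s ((w, t, U) # z)"
  shows "ranked_dfs_action k pa s = (if U = {} then Up else Down (Min U))"
proof -
  note uc = tracks_unvisited[OF assms]
  show ?thesis
  proof (cases "U = {}")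
    case False
    have fin: "finite U" and Uk: "U \<subseteq> {1..k}" using uc by (auto simp: unvisited_children_def)
    have min: "Min U \<in> U" "\<And>j. j \<in> U \<Longrightarrow> Min U \<le> j" using fin False by auto
    have "is_arg_max p (\<lambda>x. x \<in> U) j \<longleftrightarrow> j = Min U" for j
    proof
      assume am: "is_arg_max p (\<lambda>x. x \<in> U) j"
      show "j = Min U"
      proof (rule ccontr)
        assume "j \<noteq> Min U"
        then have "p j < p (Min U)" using am min Uk
          by (intro p_less) (auto simp: is_arg_max_def le_neq_implies_less)
        then show False using am min by (auto simp: is_arg_max_def)
      qed
    next
      assume j: "j = Min U"
      have "p x \<le> p (Min U)" if "x \<in> U" for x
        using that min p_less[of "Min U" x] Uk by (cases "x = Min U") (auto simp: less_imp_le le_neq_implies_less subset_iff)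
      then show "is_arg_max p (\<lambda>x. x \<in> U) j" using j min by (auto simp: is_arg_max_def not_less)
    qed
    then have "arg_max_on p U = Min U" by (simp add: arg_max_on_def arg_max_def)
    then show ?thesis using False uc by (simp add: ranked_dfs_action_def)
  qed (simp add: ranked_dfs_action_def uc)
qed

lemma tracks_swap:
  assumes tr: "tracks T s ((w, t, U) # z)" and ij: "i \<in> U" "j \<in> U"
  shows "tracks (swap_children (root t) i j T) s (map (swap_frame (root t) i j) ((w, t, U) # z))"
    "\<And>v u V. (v, u, V) \<in> set z \<Longrightarrow> root u \<noteq> root t"
    "stack_value p f \<tau> (map (swap_frame (root t) i j) z) = stack_value p f \<tau> z"
    "(\<Sum>x\<in>U. tsize (child (swap_children (root t) i j t) x)) = (\<Sum>x\<in>U. tsize (child t x))"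
proof -
  let ?n = "root t" and ?z = "(w, t, U) # z"
  let ?sw = "swap_children ?n i j"
  have st: "stack T ?z" and sub: "labels ?z \<subseteq># mset (nodes T)" using tr by (simp_all only: tracks_def)
  have fin: "finite U" using stack_finite[OF st] by auto
  have Ut: "U \<subseteq> indices t" using stack_top[OF st] .
  note uniq = top_label_unique[OF sub distinct fin]
  show ne: "root u \<noteq> ?n" if "(v, u, V) \<in> set z" for v u V
    using uniq(1) mem_labels(1)[OF that] by metis
  have inner: "?n \<notin> set (nodes (child u x))" if "(v, u, V) \<in> set z" "x \<in> V" for v u V x
    using uniq(1) mem_labels(2)[OF that(1) stack_finite[OF st] that(2)] that by (metis list.set_intros(2))
  have sub_ind: "V \<subseteq> indices u" if "(v, u, V) \<in> set ?z" for v u V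
    using stack_indices[OF st that] .
  have cond: "\<forall>(v, u, V)\<in>set ?z. V \<subseteq> indices u \<and> (root u = ?n \<longrightarrow> i \<in> V \<and> j \<in> V)"
    using sub_ind ne ij by auto
  have ch: "child (?sw u) x = child u x" if "(v, u, V) \<in> set z" "x \<in> V" for v u V x
    using child_swap_other[OF ne[OF that(1)], of x i j] swap_children_absent[OF inner[OF that]]
      sub_ind[of v u V] that by auto
  show "stack_value p f \<tau> (map (swap_frame ?n i j) z) = stack_value p f \<tau> z"
  proof -
    have "set z' \<subseteq> set z \<Longrightarrow> stack_value p f \<tau> (map (swap_frame ?n i j) z') = stack_value p f \<tau> z'" for z'
    proof (induction z' arbitrary: \<tau>)
      case (Cons fr z')
      obtain v u V where fr: "fr = (v, u, V)" by (cases fr)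
      have V: "(v, u, V) \<in> set z" using Cons.prems fr by auto
      have "finite V" using stack_finite[OF st, of v u V] V by auto
      then have "order_value p f \<tau> (?sw u) (sorted_list_of_set V) = order_value p f \<tau> u (sorted_list_of_set V)"
        using ch[OF V] by (intro sched_cong) auto
      moreover have "(\<Sum>x\<in>V. tsize (child (?sw u) x)) = (\<Sum>x\<in>V. tsize (child u x))"
        using ch[OF V] by (intro sum.cong) auto
      ultimately show ?case using Cons by (simp add: fr swap_frame_def)
    qed simp
    then show ?thesis by blast
  qed
  show "(\<Sum>x\<in>U. tsize (child (?sw t) x)) = (\<Sum>x\<in>U. tsize (child t x))"
    using ij Ut by (intro sum_children_swap) auto
  have top: "visited s \<inter> set (nodes (child (?sw t) x)) = {}" if "x \<in> U" for x
  proof -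
    have "Transposition.transpose i j x \<in> U" using that ij by (auto simp: Transposition.transpose_def)
    moreover have "child (?sw t) x = child t (Transposition.transpose i j x)"
      using ij that Ut by (intro child_swap_here) auto
    ultimately show ?thesis using tr by (auto simp: tracks_def)
  qed
  have obs: "observe (?sw T, 0) m = observe (T, 0) m" for m
  proof -
    have "U \<subseteq> {1..k}" using Ut stack_Down_p[OF full st, of w t U] by auto
    then have "i \<in> {1..k}" "j \<in> {1..k}" using ij by auto
    then show ?thesis using is_leaf_swap[OF distinct full] by (simp add: observe_def)
  qed
  have "\<forall>(v, u, V)\<in>set (map (swap_frame ?n i j) ?z).
      V = {j \<in> indices u. Down j \<notin> taken s (root u)} \<and> Up \<notin> taken s (root u) \<and>
        (\<forall>j\<in>V. visited s \<inter> set (nodes (child u j)) = {})"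
  proof clarify
    fix v u' V assume "(v, u', V) \<in> set (map (swap_frame ?n i j) ?z)"
    then obtain u where u: "(v, u, V) \<in> set ?z" "u' = ?sw u" by (auto simp: swap_frame_def)
    have old: "V = {j \<in> indices u. Down j \<notin> taken s (root u)} \<and> Up \<notin> taken s (root u) \<and>
        (\<forall>j\<in>V. visited s \<inter> set (nodes (child u j)) = {})"
      by (rule tracks_frame[OF tr u(1)])
    moreover have "\<forall>x\<in>V. visited s \<inter> set (nodes (child u' x)) = {}"
    proof (cases "(v, u, V) \<in> set z")
      case True
      then show ?thesis using ch[OF True] u old by auto
    next
      case False
      then show ?thesis using u top by auto
    qed
    ultimately show "V = {j \<in> indices u'. Down j \<notin> taken s (root u')} \<and> Up \<notin> taken s (root u') \<and>
        (\<forall>j\<in>V. visited s \<inter> set (nodes (child u' j)) = {})"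
      using u(2) by simp
  qed
  moreover have "stack (?sw T) (map (swap_frame ?n i j) ?z)"
    using stack_swap[OF st, of ?n i j] ne by force
  moreover have "snd s = observe (?sw T, 0) (root (fst (snd (hd (map (swap_frame ?n i j) ?z)))))"
    using tracks_observe[OF tr] obs by (simp add: swap_frame_def)
  ultimately show "tracks (?sw T) s (map (swap_frame ?n i j) ?z)"
    unfolding tracks_def labels_swap[OF cond] mset_nodes_swap stack_time_swap[OF cond] tsize_swap
    using sub tracks_time[OF tr] by blast
qed

end

section \<open>Gain of an action for a fixed tree\<close>

definition payoff :: "(nat \<Rightarrow> real) \<Rightarrow> config \<Rightarrow> real" where
  "payoff f c = (if at_goal (snd c) then f (length (fst (snd c))) else 0)"

definition good_reward :: "nat \<Rightarrow> nat \<Rightarrow> real \<Rightarrow> (nat \<Rightarrow> real) \<Rightarrow> bool" where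
  "good_reward k L q f \<longleftrightarrow> (\<forall>t. 0 < f t) \<and> (\<forall>s t. s < t \<longrightarrow> f t < f s) \<and>
     (\<forall>t t' d u m. t \<le> t' \<longrightarrow> d < L \<longrightarrow> 1 \<le> u \<longrightarrow> u \<le> k \<longrightarrow> m \<le> 2 * u * k ^ (L - d - 1) \<longrightarrow>
        2 * (f t' - f (t' + 2 * m)) \<le> real u * q ^ (d + 1) * f (t + 2 * m))"

lemma good_reward_antimono: "good_reward k L q f \<Longrightarrow> antimono f"
  unfolding good_reward_def by (intro antimonoI) (metis less_eq_real_def order_le_less)

context search
begin

definition ranked_step :: "environment \<Rightarrow> config \<Rightarrow> config" where
  "ranked_step \<Phi> c = (if ended c then c else act \<Phi> (ranked_dfs_action k pa (snd c)) (snd c))"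

definition ranked_run :: "environment \<Rightarrow> nat \<Rightarrow> config \<Rightarrow> config" where
  "ranked_run \<Phi> n = ranked_step \<Phi> ^^ n"

lemma ranked_run_0 [simp]: "ranked_run \<Phi> 0 c = c"
  by (simp add: ranked_run_def)

lemma ranked_run_Suc: "ranked_run \<Phi> (Suc n) c = ranked_run \<Phi> n (ranked_step \<Phi> c)"
  by (simp add: ranked_run_def funpow_Suc_right del: funpow.simps)

lemma ranked_run_ended: "ended c \<Longrightarrow> ranked_run \<Phi> n c = c"
  by (induction n) (auto simp: ranked_run_Suc ranked_step_def)

definition ranked_gain :: "(nat \<Rightarrow> real) \<Rightarrow> nat \<Rightarrow> ktree \<Rightarrow> state \<Rightarrow> real" where
  "ranked_gain f n T s = (\<Sum>g\<in>{1..N}. pmf (goal_pmf pa T) g *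
     (if g \<in> visited s then 0 else payoff f (ranked_run (T, g) n (False, s))))"

definition action_gain :: "(nat \<Rightarrow> real) \<Rightarrow> nat \<Rightarrow> ktree \<Rightarrow> state \<Rightarrow> action \<Rightarrow> real" where
  "action_gain f n T s a = (\<Sum>g\<in>{1..N}. pmf (goal_pmf pa T) g *
     (if g \<in> visited s then 0 else payoff f (ranked_run (T, g) n (act (T, g) a s))))"

lemma ranked_gain_Suc:
  "\<not> at_goal s \<Longrightarrow> ranked_gain f (Suc n) T s = action_gain f n T s (ranked_dfs_action k pa s)"
  by (simp add: ranked_gain_def action_gain_def ranked_run_Suc ranked_step_def ended_def cong: if_cong)

lemma action_gain_illegal:
  assumes "\<not> at_goal s" "\<And>g. \<not> legal (T, g) s a"
  shows "action_gain f n T s a = 0"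
  using assms by (simp add: action_gain_def act_def ranked_run_ended ended_def payoff_def cong: if_cong)

lemma tree_value_strict:
  assumes "full_ktree k t" "\<And>s t. s < t \<Longrightarrow> f t < f s" "\<delta> > 0"
  shows "tree_value p f (\<tau> + \<delta>) t < tree_value p f \<tau> t"
proof -
  have "tree_value p (\<lambda>s. 1 * f s + (-1) * f (s + \<delta>)) \<tau> t > 0"
    using assms by (intro tree_value_pos) auto
  then show ?thesis unfolding tree_value_linear by (simp add: tree_value_shift)
qed

text \<open>Exchanging the subtrees below \<open>i\<close> and \<open>j\<close> makes the sizes and contents of the two subtrees
  symmetric, so that only the goal probabilities of the two indices decide.\<close>

lemma order_value_exchange:
  assumes full: "full_ktree k t" and dec: "\<And>s t. s < t \<Longrightarrow> f t < f s"
    and ij: "i \<in> indices t" "j \<in> indices t" "i < j"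
    and rest: "set (xs @ ys) \<subseteq> indices t - {i, j}"
  defines "t' \<equiv> swap_children (root t) i j t"
  shows "order_value p f \<tau> t (xs @ j # i # ys) + order_value p f \<tau> t' (xs @ j # i # ys)
    < order_value p f \<tau> t (xs @ i # j # ys) + order_value p f \<tau> t' (xs @ i # j # ys)"
proof -
  have ch: "x \<in> indices t \<Longrightarrow> child t' x = child t (Transposition.transpose i j x)" for x
    unfolding t'_def using ij by (intro child_swap_here) auto
  have ci: "child t' i = child t j" and cj: "child t' j = child t i"
    using ch[of i] ch[of j] ij by auto
  have cx: "child t' x = child t x" if "x \<in> set (xs @ ys)" for x
  proof -
    have "x \<in> indices t - {i, j}" using that rest by blast
    then show ?thesis using ch[of x] by (simp add: Transposition.transpose_def)
  qed
  have eq: "order_value p f s t' zs = order_value p f s t zs" if "set zs \<subseteq> set (xs @ ys)" for s zs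
    using cx that by (intro sched_cong) (auto simp: subset_iff)
  have sz: "sum_list (map (\<lambda>x. tsize (child t' x)) xs) = sum_list (map (\<lambda>x. tsize (child t x)) xs)"
    using cx by (intro arg_cong[where f = sum_list] map_cong) auto
  define \<sigma> where "\<sigma> = \<tau> + 2 * sum_list (map (\<lambda>x. tsize (child t x)) xs)"
  let ?a = "\<lambda>s. tree_value p f s (child t i)" and ?b = "\<lambda>s. tree_value p f s (child t j)"
  let ?x = "tsize (child t i)" and ?y = "tsize (child t j)"
  have sub: "full_ktree k (child t l)" if "l \<in> indices t" for l
    using full_ktree_subtree[OF full subtree_child[OF subtree_refl that]] .
  have "?a (\<sigma> + 1 + 2 * ?y) < ?a (\<sigma> + 1)"
    by (rule tree_value_strict[where f = f, OF sub[OF ij(1)] dec]) (simp_all add: tsize_pos)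
  moreover have "?b (\<sigma> + 1 + 2 * ?x) < ?b (\<sigma> + 1)"
    by (rule tree_value_strict[where f = f, OF sub[OF ij(2)] dec]) (simp_all add: tsize_pos)
  moreover have "p j < p i"
    using full_ktree_indices[OF full] ij by (intro p_less) (cases "children t", auto)+
  ultimately have "0 < (p i - p j) * ((?a (\<sigma> + 1) - ?a (\<sigma> + 1 + 2 * ?y)) + (?b (\<sigma> + 1) - ?b (\<sigma> + 1 + 2 * ?x)))"
    by (intro mult_pos_pos) auto
  then have main: "(p j * ?b (\<sigma> + 1) + p i * ?a (\<sigma> + 1 + 2 * ?y)) + (p j * ?a (\<sigma> + 1) + p i * ?b (\<sigma> + 1 + 2 * ?x))
     < (p i * ?a (\<sigma> + 1) + p j * ?b (\<sigma> + 1 + 2 * ?x)) + (p i * ?b (\<sigma> + 1) + p j * ?a (\<sigma> + 1 + 2 * ?y))"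
    by (simp add: algebra_simps)
  have times: "\<sigma> + 2 * ?x + 1 = \<sigma> + 1 + 2 * ?x" "\<sigma> + 2 * ?y + 1 = \<sigma> + 1 + 2 * ?y"
    "\<sigma> + 2 * ?y + 2 * ?x = \<sigma> + 2 * ?x + 2 * ?y" by simp_all
  show ?thesis
    using main unfolding sched_append sz \<sigma>_def[symmetric] sched.simps ci cj eq[OF order_refl[of "set xs", THEN order_trans]] times
    using eq[of xs \<tau>] eq[of ys] by simp
qed

end

locale placed_tree = search_tree +
  assumes nodes_range: "set (nodes T) \<subseteq> {1..N}" and depth_le: "depth T \<le> L"
begin

lemma tsize_le_N: "tsize T \<le> N"
  using card_mono[OF _ nodes_range] distinct_card[OF distinct] by (simp add: tsize_def)

lemma action_gain_legal:
  assumes "edge T (current_node s) a m" "legal (T, 0) s a"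
  shows "action_gain f n T s a =
    (if m \<in> visited s then 0 else pmf (goal_pmf pa T) m * f (Suc (length (fst s))))
     + ranked_gain f n T (successor (T, 0) s a)"
proof -
  let ?q = "pmf (goal_pmf pa T)" and ?s = "successor (T, 0) s a"
  have m: "m \<in> set (nodes T)" using edge_nodes[OF distinct assms(1)] .
  have succ: "successor (T, g) s a = (fst s @ [(snd s, a)], observe (T, g) m)" for g
    using successor_edge[OF distinct assms(1)] .
  have vis: "visited ?s = insert m (visited s)" using visited_successor[OF assms(1)] .
  have each: "(if g \<in> visited s then 0 else payoff f (ranked_run (T, g) n (act (T, g) a s)))
    = (if g = m then (if m \<in> visited s then 0 else f (Suc (length (fst s)))) else 0)
      + (if g \<in> visited ?s then 0 else payoff f (ranked_run (T, g) n (False, ?s)))" for g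
  proof -
    have act: "act (T, g) a s = (False, successor (T, g) s a)"
      using assms(2) by (simp add: act_def legal_iff[of g])
    show ?thesis
    proof (cases "g = m")
      case True
      then have "at_goal (successor (T, g) s a)" by (simp add: succ at_goal_def observe_def)
      then have "ranked_run (T, g) n (act (T, g) a s) = (False, successor (T, g) s a)"
        by (simp add: act ranked_run_ended ended_def)
      moreover have "length (fst (successor (T, g) s a)) = Suc (length (fst s))"
        by (simp add: succ)
      ultimately show ?thesis
        using True \<open>at_goal (successor (T, g) s a)\<close>
          \<open>length (fst (successor (T, g) s a)) = Suc (length (fst s))\<close>
        by (simp add: payoff_def vis)
    next
      case False
      then have "successor (T, g) s a = ?s" using succ observe_no_goal[OF m] by metis
      then show ?thesis using False by (simp add: act vis)
    qed
  qed
  have "action_gain f n T s a = (\<Sum>g\<in>{1..N}. ?q g *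
      (if g = m then (if m \<in> visited s then 0 else f (Suc (length (fst s)))) else 0))
     + ranked_gain f n T ?s"
    unfolding action_gain_def ranked_gain_def each by (simp add: distrib_left sum.distrib)
  also have "(\<Sum>g\<in>{1..N}. ?q g * (if g = m then (if m \<in> visited s then 0 else f (Suc (length (fst s)))) else 0))
     = (\<Sum>g\<in>{1..N}. if g = m then ?q m * (if m \<in> visited s then 0 else f (Suc (length (fst s)))) else 0)"
    by (intro sum.cong) auto
  also have "\<dots> = ?q m * (if m \<in> visited s then 0 else f (Suc (length (fst s))))"
    using m nodes_range by (subst sum.delta) auto
  finally show ?thesis by simp
qed

lemma tracks_not_goal:
  assumes "tracks T s ((w, t, U) # z)"
  shows "\<not> at_goal s"
proof -
  have "root t \<noteq> 0"
    using root_subtree_in_nodes[OF tracks_subtree[OF assms, of w t U]] zero by (metis list.set_intros(1))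
  then show ?thesis using tracks_observe[OF assms] by (simp add: at_goal_def observe_def)
qed

lemma action_gain_down_aux:
  assumes tr: "tracks T s ((w, t, U) # z)" and j: "j \<in> U" and n: "stack_time ((w, t, U) # z) \<le> Suc n"
    and IH: "\<And>s z. tracks T s z \<Longrightarrow> stack_time z \<le> n \<Longrightarrow>
      ranked_gain f n T s = stack_value p f (length (fst s)) z"
  shows "action_gain f n T s (Down j) =
    w * order_value p f (length (fst s)) t (j # sorted_list_of_set (U - {j}))
      + stack_value p f (length (fst s) + 2 * (\<Sum>j\<in>U. tsize (child t j)) + 1) z"
proof -
  let ?c = "child t j" and ?z = "(w * p j, child t j, indices (child t j)) # (w, t, U - {j}) # z"
  have fin: "finite U" using tracks_finite[OF tr, of w t U] by simp
  have edge: "edge T (current_node s) (Down j) (root ?c)"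
    using edge_down[OF tr] tracks_U[OF tr, of w t U] j by auto
  have tr': "tracks T (successor (T, 0) s (Down j)) ?z"
    using tracks_down[OF tr j] successor_down[OF tr j] by simp
  have c: "?c \<in> subtrees T" using tracks_subtree[OF tr', of "w * p j" ?c "indices ?c"] by simp
  have "root ?c \<notin> visited s" using tracks_frame[OF tr, of w t U] j root_in_nodes by auto
  moreover have "pmf (goal_pmf pa T) (root ?c) = (if children ?c = [] then w * p j else 0)"
    using stack_goal[OF full distinct tracks_stack[OF tr'] root_in_nodes]
      pmf_goal_root[OF full_ktree_subtree[OF full c] set_pa distinct_subtree[OF distinct c]] by simp
  moreover have "ranked_gain f n T (successor (T, 0) s (Down j)) = stack_value p f (length (fst s) + 1) ?z"
    using IH[OF tr'] stack_time_down[OF fin j, of "w * p j" t w z] n successor_down[OF tr j, of 0] by simp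
  ultimately have "action_gain f n T s (Down j) =
      (if children (child t j) = [] then w * p j * f (length (fst s) + 1) else 0)
      + stack_value p f (length (fst s) + 1) ?z"
    using action_gain_legal[OF edge, of f n] legal_down[OF tr] j by simp
  then show ?thesis unfolding stack_value_down[OF fin j] .
qed

lemma action_gain_up_aux:
  assumes tr: "tracks T s ((w, t, U) # z)" and n: "stack_time ((w, t, U) # z) \<le> Suc n"
    and IH: "\<And>s z. tracks T s z \<Longrightarrow> stack_time z \<le> n \<Longrightarrow>
      ranked_gain f n T s = stack_value p f (length (fst s)) z"
  shows "action_gain f n T s Up = stack_value p f (length (fst s) + 1) z"
proof (cases z)
  case Nil
  then show ?thesis using action_gain_illegal[OF tracks_not_goal[OF tr]] legal_up[OF tr] by simp
next
  case (Cons fr z')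
  then obtain w' t' U' where z: "z = (w', t', U') # z'" by (cases fr) auto
  note tr2 = tr[unfolded z]
  have edge: "edge T (current_node s) Up (root t')" using edge_up[OF tr] z by auto
  have tr': "tracks T (successor (T, 0) s Up) ((w', t', U') # z')"
    using tracks_up[OF tr2] successor_up[OF tr2] by simp
  have c: "t' \<in> subtrees T" using tracks_subtree[OF tr', of w' t' U'] by simp
  have "children t' \<noteq> []"
    using tracks_stack[OF tr2] by (cases rule: stack.cases) auto
  then have "pmf (goal_pmf pa T) (root t') = 0"
    using stack_goal[OF full distinct tracks_stack[OF tr'] root_in_nodes]
      pmf_goal_root[OF full_ktree_subtree[OF full c] set_pa distinct_subtree[OF distinct c]] by simp
  moreover have "ranked_gain f n T (successor (T, 0) s Up) = stack_value p f (length (fst s) + 1) z"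
    using IH[OF tr'] n successor_up[OF tr2, of 0] z by simp
  ultimately show ?thesis
    using action_gain_legal[OF edge, of f n] legal_up[OF tr] z by simp
qed

lemma tracks_cases:
  assumes "tracks T s z0"
  obtains w t U z where "z0 = (w, t, U) # z"
  using tracks_stack[OF assms] stack_not_Nil by (metis list.exhaust prod_cases3)

lemma ranked_gain_eq:
  "tracks T s z \<Longrightarrow> stack_time z \<le> n \<Longrightarrow> ranked_gain f n T s = stack_value p f (length (fst s)) z"
proof (induction n arbitrary: s z)
  case 0
  then show ?case by (elim tracks_cases) auto
next
  case (Suc n)
  from Suc.prems(1) obtain w t U z' where z: "z = (w, t, U) # z'" by (rule tracks_cases)
  note tr = Suc.prems(1)[unfolded z] and n = Suc.prems(2)[unfolded z]
  have fin: "finite U" using tracks_finite[OF tr, of w t U] by simp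
  have step: "ranked_gain f (Suc n) T s = action_gain f n T s (if U = {} then Up else Down (Min U))"
    using ranked_gain_Suc[OF tracks_not_goal[OF tr]] ranked_action[OF tr] by simp
  show ?case
  proof (cases "U = {}")
    case True
    then show ?thesis using step action_gain_up_aux[OF tr n Suc.IH] z by simp
  next
    case False
    then show ?thesis
      using step action_gain_down_aux[OF tr _ n Suc.IH, of "Min U"] z fin sorted_list_min[OF fin False] by simp
  qed
qed

lemmas action_gain_down = action_gain_down_aux[OF _ _ _ ranked_gain_eq]
lemmas action_gain_up = action_gain_up_aux[OF _ _ ranked_gain_eq]

lemma ranked_gain_one_le:
  "ranked_gain (\<lambda>_. 1) n T s \<le> 1"
proof -
  have "ranked_gain (\<lambda>_. 1) n T s \<le> (\<Sum>g\<in>{1..N}. pmf (goal_pmf pa T) g)"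
    unfolding ranked_gain_def by (intro sum_mono) (auto simp: payoff_def mult_left_le)
  also have "\<dots> \<le> 1" using measure_pmf.prob_le_1[of "goal_pmf pa T" "{1..N}"]
    by (simp add: measure_measure_pmf_finite)
  finally show ?thesis .
qed

text \<open>Leaving a node with \<open>m\<close> unexplored nodes below it loses at least the goal probability of its
  unvisited children, and makes the later leaves at most \<open>2m\<close> steps earlier.\<close>

lemma skip_loses:
  assumes good: "good_reward k L (p k) f"
    and tr: "tracks T s ((w, t, U) # z)" and ne: "U \<noteq> {}" and n: "stack_time ((w, t, U) # z) \<le> Suc n"
  shows "action_gain f n T s Up < ranked_gain f (Suc n) T s"
proof -
  let ?\<tau> = "length (fst s)" and ?m = "\<Sum>j\<in>U. tsize (child t j)"
  define d where "d = length z"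
  define D where "D = real (card U) * p k ^ (d + 1) * f (?\<tau> + 2 * ?m)"
  note st = tracks_stack[OF tr]
  have fin: "finite U" using tracks_finite[OF tr, of w t U] by simp
  have Ut: "U \<subseteq> indices t" using stack_top[OF st] .
  have t: "t \<in> subtrees T" using tracks_subtree[OF tr, of w t U] by simp
  have Uk: "U \<subseteq> {1..k}" using Ut stack_Down_p[OF full st, of w t U] by auto
  have f0: "0 < f x" for x using good by (simp add: good_reward_def)
  have mono: "antimono f" using good good_reward_antimono by blast
  have dep: "depth t + d \<le> L" using stack_depth[OF st] depth_le d_def by simp
  have dchild: "depth (child t j) \<le> L - d - 1" if "j \<in> U" for j
    using depth_child[of j t] that Ut dep by fastforce
  have dL: "d < L"
  proof -
    obtain j where "j \<in> U" using ne by blast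
    then show ?thesis using depth_child[of j t] Ut dep by fastforce
  qed
  have cardU: "1 \<le> card U" "card U \<le> k"
    using ne fin card_mono[OF _ Uk] by (auto simp: Suc_le_eq card_gt_0_iff)
  have "?m \<le> (\<Sum>j\<in>U. 2 * k ^ (L - d - 1))"
  proof (rule sum_mono)
    fix j assume j: "j \<in> U"
    have "tsize (child t j) \<le> 2 * k ^ depth (child t j) - 1"
      using Ut j k_ge by (intro tsize_le full_ktree_subtree[OF full_ktree_subtree[OF full t]]
          subtree_child[OF subtree_refl]) auto
    also have "\<dots> \<le> 2 * k ^ depth (child t j)" by simp
    also have "\<dots> \<le> 2 * k ^ (L - d - 1)"
      using dchild[OF j] k_ge by (intro mult_le_mono2 power_increasing) auto
    finally show "tsize (child t j) \<le> 2 * k ^ (L - d - 1)" .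
  qed
  then have m: "?m \<le> 2 * card U * k ^ (L - d - 1)" by simp
  have skip: "2 * (f t' - f (t' + 2 * ?m)) \<le> D" if "?\<tau> \<le> t'" for t'
    using good that dL cardU m unfolding good_reward_def D_def by blast
  have D0: "D > 0" unfolding D_def using cardU p_k_pos f0 by simp
  have "D \<le> w * order_value p f ?\<tau> t (sorted_list_of_set U)"
  proof -
    have "real (card U) * p k = (\<Sum>j\<in>U. p k)" by simp
    also have "\<dots> \<le> (\<Sum>j\<in>U. p j)" using Uk by (intro sum_mono p_k_le) auto
    finally have "real (card U) * p k * f (?\<tau> + 2 * ?m) \<le> (\<Sum>j\<in>U. p j) * f (?\<tau> + 2 * ?m)"
      using f0[of "?\<tau> + 2 * ?m"] by (intro mult_right_mono) auto
    also have "\<dots> \<le> order_value p f ?\<tau> t (sorted_list_of_set U)"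
      by (rule order_value_lower[OF full_ktree_subtree[OF full t] mono Ut])
    finally have "p k ^ d * (real (card U) * p k * f (?\<tau> + 2 * ?m))
        \<le> w * order_value p f ?\<tau> t (sorted_list_of_set U)"
      using stack_weight[OF full st] stack_weight_pos[OF full st] p_k_pos f0[of "?\<tau> + 2 * ?m"]
      unfolding d_def by (intro mult_mono) (auto simp: less_imp_le)
    then show ?thesis by (simp add: D_def ac_simps)
  qed
  moreover have "stack_value p f (?\<tau> + 1) z - stack_value p f (?\<tau> + 2 * ?m + 1) z \<le> D / 2"
  proof -
    have one: "stack_value p (\<lambda>_. 1) x z = stack_value p (\<lambda>_. 1) 0 z" for x
      using stack_value_shift[of p "\<lambda>_. 1" 0 x z] by simp
    have "stack_value p (\<lambda>_. 1) ?\<tau> ((w, t, U) # z) \<le> 1"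
      using ranked_gain_eq[OF tr n, of "\<lambda>_. 1"] ranked_gain_one_le[of "Suc n" s] by simp
    moreover have "0 \<le> w * order_value p (\<lambda>_. 1) ?\<tau> t (sorted_list_of_set U)"
      using order_value_nonneg[of "\<lambda>_. 1"] stack_weight_pos[OF full st] by simp
    ultimately have "stack_value p (\<lambda>_. 1) (?\<tau> + 2 * ?m + 1) z \<le> 1" by simp
    then have mass: "stack_value p (\<lambda>_. 1) 0 z \<le> 1" unfolding one[of "?\<tau> + 2 * ?m + 1"] .
    have tail_weights: "\<forall>(w, t, U)\<in>set z. 0 \<le> w"
      using stack_weights_nonneg[OF st] by simp
    have "stack_value p f (?\<tau> + 1) z - stack_value p f (?\<tau> + 2 * ?m + 1) z
        = stack_value p (\<lambda>s. 1 * f (s + (?\<tau> + 1)) + (-1) * f (s + (?\<tau> + 2 * ?m + 1))) 0 z"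
      unfolding stack_value_linear using stack_value_shift[of p f 0 _ z] by simp
    also have "\<dots> \<le> stack_value p (\<lambda>s. D / 2 * 1 + 0 * 1) 0 z"
    proof (rule stack_value_mono[OF _ _ tail_weights])
      fix x show "1 * f (x + (?\<tau> + 1)) + (-1) * f (x + (?\<tau> + 2 * ?m + 1)) \<le> D / 2 * 1 + 0 * 1"
        using skip[of "x + (?\<tau> + 1)"] by (simp add: ac_simps)
    qed simp
    also have "\<dots> = D / 2 * stack_value p (\<lambda>s. 1) 0 z" unfolding stack_value_linear by simp
    also have "\<dots> \<le> D / 2" using mass D0 by (simp add: mult_left_le)
    finally show ?thesis .
  qed
  ultimately show ?thesis
    using ranked_gain_eq[OF tr n, of f] action_gain_up[OF tr n, of f] D0 by simp
qed

end

section \<open>Advantage over all trees consistent with a history\<close>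

context search
begin

definition trees :: "ktree set" where
  "trees = (\<Union>l\<in>{1..L}. ktrees k N l)"

definition tree_pmf :: "ktree pmf" where
  "tree_pmf = bind_pmf \<omega> (\<lambda>l. pmf_of_set (ktrees k N l))"

lemma finite_trees: "finite trees"
  by (simp add: trees_def finite_ktrees)

lemma ktrees_ne: "l \<in> {1..L} \<Longrightarrow> ktrees k N l \<noteq> {}"
  using setting by (intro ktrees_nonempty) (auto simp: setting_def)

lemma set_tree_pmf: "set_pmf tree_pmf = trees"
  using ktrees_ne finite_ktrees by (auto simp: tree_pmf_def set_\<omega> trees_def)

lemma trees_placed: "T \<in> trees \<Longrightarrow> placed_tree k L N \<omega> pa T"
  unfolding trees_def by unfold_locales (auto simp: ktrees_def)

lemma trees_swap: "swap_children n i j T \<in> trees \<longleftrightarrow> T \<in> trees"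
  by (simp add: trees_def)

lemma pmf_tree_swap: "pmf tree_pmf (swap_children n i j T) = pmf tree_pmf T"
  unfolding tree_pmf_def pmf_bind
proof (rule integral_cong_AE)
  show "AE l in measure_pmf \<omega>. pmf (pmf_of_set (ktrees k N l)) (swap_children n i j T)
      = pmf (pmf_of_set (ktrees k N l)) T"
    using ktrees_ne finite_ktrees by (auto simp: AE_measure_pmf_iff set_\<omega> indicator_def)
qed simp_all

definition possible :: "state \<Rightarrow> ktree set" where
  "possible s = {T \<in> trees. compat (T, 0) s}"

lemma finite_possible: "finite (possible s)"
  using finite_trees by (simp add: possible_def)

lemma possible_tracks:
  assumes "T \<in> possible s"
  obtains w t z where "tracks T s ((w, t, unvisited_children k s) # z)" "current_node s = root t"
proof -
  interpret placed_tree k L N \<omega> pa T using assms trees_placed by (simp add: possible_def)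
  obtain z0 where z0: "tracks T s z0" using compat_tracks[of s] assms unfolding possible_def by blast
  then obtain w t U z where "tracks T s ((w, t, U) # z)" by (metis tracks_cases)
  then show ?thesis using tracks_unvisited tracks_top that by metis
qed

lemma pmf_tree_pos: "T \<in> possible s \<Longrightarrow> 0 < pmf tree_pmf T"
  using set_tree_pmf by (simp add: possible_def pmf_positive)

definition top_frame :: "ktree \<Rightarrow> state \<Rightarrow> real \<times> ktree" where
  "top_frame T s = (SOME x. \<exists>U z. tracks T s ((fst x, snd x, U) # z))"

lemma top_frame_eq:
  assumes "T \<in> trees" "tracks T s ((w, t, U) # z)"
  shows "top_frame T s = (w, t)"
proof -
  interpret placed_tree k L N \<omega> pa T using assms trees_placed by simp
  have "x = (w, t)" if "tracks T s ((fst x, snd x, V) # z')" for x V z'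
    using stack_unique[OF distinct tracks_stack[OF that] tracks_stack[OF assms(2)]]
      tracks_top[OF that] tracks_top[OF assms(2)] by (simp add: prod_eq_iff)
  moreover have "\<exists>U z. tracks T s ((fst (w, t), snd (w, t), U) # z)" using assms(2) by auto
  ultimately show ?thesis unfolding top_frame_def by (intro some_equality) auto
qed

definition list_gain :: "(nat \<Rightarrow> real) \<Rightarrow> state \<Rightarrow> nat list \<Rightarrow> ktree \<Rightarrow> real" where
  "list_gain f s is T =
     fst (top_frame T s) * order_value p f (length (fst s)) (snd (top_frame T s)) is"

lemma exchange_sum:
  assumes dec: "\<And>s t. s < t \<Longrightarrow> f t < f s" and ne: "possible s \<noteq> {}"
    and ij: "i \<in> unvisited_children k s" "j \<in> unvisited_children k s" "i < j"
    and rest: "set (xs @ ys) \<subseteq> unvisited_children k s - {i, j}"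
  shows "(\<Sum>T\<in>possible s. pmf tree_pmf T * list_gain f s (xs @ j # i # ys) T)
    < (\<Sum>T\<in>possible s. pmf tree_pmf T * list_gain f s (xs @ i # j # ys) T)"
proof -
  let ?q = "pmf tree_pmf" and ?sw = "swap_children (current_node s) i j"
  define D where "D T = list_gain f s (xs @ i # j # ys) T - list_gain f s (xs @ j # i # ys) T" for T
  have sw: "?sw T \<in> possible s" and D: "D T + D (?sw T) > 0" if T: "T \<in> possible s" for T
  proof -
    interpret placed_tree k L N \<omega> pa T using T trees_placed by (simp add: possible_def)
    obtain w t z where tr: "tracks T s ((w, t, unvisited_children k s) # z)" and n: "current_node s = root t"
      using possible_tracks[OF T] .
    have Ut: "unvisited_children k s \<subseteq> indices t" using stack_top[OF tracks_stack[OF tr]] .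
    have t: "t \<in> subtrees T" using tracks_subtree[OF tr, of w t "unvisited_children k s"] by simp
    have "{Down i, Down j} \<inter> taken s (current_node s) = {}"
      using ij by (auto simp: unvisited_children_def taken_here_eq)
    then have "compat (?sw T, 0) s"
      using T ij by (intro compat_swap[of k] tree_in_axioms) (auto simp: possible_def unvisited_children_def)
    then show "?sw T \<in> possible s" using T by (simp add: possible_def trees_swap)
    have tr': "tracks (?sw T) s ((w, ?sw t, unvisited_children k s) # map (swap_frame (root t) i j) z)"
      using tracks_swap(1)[OF tr ij(1,2)] n by (simp add: swap_frame_def)
    have top: "top_frame T s = (w, t)" "top_frame (?sw T) s = (w, ?sw t)"
      using top_frame_eq[OF _ tr] top_frame_eq[OF _ tr'] T by (simp_all add: possible_def trees_swap)
    have "0 < w" using stack_weight_pos[OF full tracks_stack[OF tr]] .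
    moreover have "order_value p f \<tau> t (xs @ j # i # ys) + order_value p f \<tau> (?sw t) (xs @ j # i # ys)
      < order_value p f \<tau> t (xs @ i # j # ys) + order_value p f \<tau> (?sw t) (xs @ i # j # ys)" for \<tau>
      unfolding n using ij rest Ut
      by (intro order_value_exchange[OF full_ktree_subtree[OF full t] dec]) auto
    ultimately have "0 < w * (order_value p f (length (fst s)) t (xs @ i # j # ys)
        + order_value p f (length (fst s)) (?sw t) (xs @ i # j # ys)
        - (order_value p f (length (fst s)) t (xs @ j # i # ys)
        + order_value p f (length (fst s)) (?sw t) (xs @ j # i # ys)))"
      by (intro mult_pos_pos) (simp_all only: diff_gt_0_iff_gt)
    then show "D T + D (?sw T) > 0"
      unfolding D_def list_gain_def top by (simp add: algebra_simps)
  qed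
  have "(\<Sum>T\<in>possible s. ?q T * D T) = (\<Sum>T\<in>possible s. ?q T * D (?sw T))"
    by (rule sum.reindex_bij_witness[of _ ?sw ?sw])
      (auto simp: sw swap_children_involution pmf_tree_swap)
  then have "2 * (\<Sum>T\<in>possible s. ?q T * D T) = (\<Sum>T\<in>possible s. ?q T * (D T + D (?sw T)))"
    by (simp add: distrib_left sum.distrib)
  also have "\<dots> > 0"
    using D pmf_tree_pos ne finite_possible by (intro sum_pos) auto
  finally show ?thesis by (simp add: D_def right_diff_distrib sum_subtractf)
qed

text \<open>Postponing \<open>j\<close> behind a list of smaller indices is a sequence of exchanges of neighbours.\<close>

lemma postpone_sum:
  assumes dec: "\<And>s t. s < t \<Longrightarrow> f t < f s" and ne: "possible s \<noteq> {}"
    and "distinct (pre @ j # xs @ ys)" "set (pre @ j # xs @ ys) \<subseteq> unvisited_children k s" "\<forall>x\<in>set xs. x < j"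
    and "xs \<noteq> []"
  shows "(\<Sum>T\<in>possible s. pmf tree_pmf T * list_gain f s (pre @ j # xs @ ys) T)
    < (\<Sum>T\<in>possible s. pmf tree_pmf T * list_gain f s (pre @ xs @ j # ys) T)"
  using assms(3-)
proof (induction xs arbitrary: pre)
  case (Cons x xs)
  have "(\<Sum>T\<in>possible s. pmf tree_pmf T * list_gain f s (pre @ j # x # (xs @ ys)) T)
    < (\<Sum>T\<in>possible s. pmf tree_pmf T * list_gain f s (pre @ x # j # (xs @ ys)) T)"
    using Cons.prems by (intro exchange_sum dec ne) auto
  also have "\<dots> \<le> (\<Sum>T\<in>possible s. pmf tree_pmf T * list_gain f s ((pre @ [x]) @ xs @ j # ys) T)"
    using Cons.IH[of "pre @ [x]"] Cons.prems by (cases "xs = []") (auto intro: less_imp_le)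
  finally show ?case by simp
qed simp

definition advantage :: "(nat \<Rightarrow> real) \<Rightarrow> nat \<Rightarrow> state \<Rightarrow> action \<Rightarrow> real" where
  "advantage f n s a = (\<Sum>T\<in>possible s. pmf tree_pmf T *
     (ranked_gain f (Suc n) T s - action_gain f n T s a))"

lemma ranked_gain_nonneg: "(\<And>t. 0 < f t) \<Longrightarrow> 0 \<le> ranked_gain f n T s"
  unfolding ranked_gain_def by (intro sum_nonneg) (auto simp: payoff_def less_imp_le)

lemma advantage_cases:
  assumes good: "good_reward k L (p k) f" and n: "length (fst s) + Suc n = 2 * N"
    and ne: "possible s \<noteq> {}" and a: "a \<in> actions k"
  shows "a = ranked_dfs_action k pa s \<and> advantage f n s a = 0 \<or> 0 < advantage f n s a \<or>
    advantage f n s a = (\<Sum>T\<in>possible s. pmf tree_pmf T * ranked_gain f (Suc n) T s)"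
proof -
  let ?U = "unvisited_children k s"
  have fin: "finite ?U" by (simp add: unvisited_children_def)
  have f0: "\<And>t. 0 < f t" and dec: "\<And>s t. s < t \<Longrightarrow> f t < f s"
    using good by (auto simp: good_reward_def)
  have time: "stack_time z \<le> Suc n" if "T \<in> possible s" "tracks T s z" for T z
  proof -
    interpret placed_tree k L N \<omega> pa T using that trees_placed by (simp add: possible_def)
    show ?thesis using tracks_time[OF that(2)] n tsize_le_N by linarith
  qed
  have not_goal: "\<not> at_goal s"
  proof -
    obtain T where "T \<in> possible s" using ne by blast
    then interpret placed_tree k L N \<omega> pa T using trees_placed by (simp add: possible_def)
    show ?thesis using \<open>T \<in> possible s\<close> compat_no_goal_not_at_goal by (simp add: possible_def)
  qed
  have ranked_eq: "ranked_dfs_action k pa s = (if ?U = {} then Up else Down (Min ?U))"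
  proof -
    obtain T where T: "T \<in> possible s" using ne by blast
    then interpret placed_tree k L N \<omega> pa T using trees_placed by (simp add: possible_def)
    obtain w t z where "tracks T s ((w, t, ?U) # z)" using possible_tracks[OF T] .
    then show ?thesis by (rule ranked_action)
  qed
  consider (ranked) "a = ranked_dfs_action k pa s" | (skip) "a = Up" "?U \<noteq> {}"
    | (illegal) j where "a = Down j" "j \<notin> ?U" | (wrong) j where "a = Down j" "j \<in> ?U" "j \<noteq> Min ?U"
  proof (cases a)
    case (Down j)
    show ?thesis
    proof (cases "j \<in> ?U")
      case True
      then have "ranked_dfs_action k pa s = Down (Min ?U)" using ranked_eq by auto
      then show ?thesis using that(1) that(4)[OF Down True] Down by (cases "j = Min ?U") auto
    qed (rule that(3)[OF Down])
  next
    case Up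
    then show ?thesis using ranked_eq that(1,2) by (cases "?U = {}") auto
  qed
  then show ?thesis
  proof cases
    case ranked
    then show ?thesis using ranked_gain_Suc[OF not_goal] by (simp add: advantage_def)
  next
    case skip
    have "action_gain f n T s a < ranked_gain f (Suc n) T s" if T: "T \<in> possible s" for T
    proof -
      interpret placed_tree k L N \<omega> pa T using T trees_placed by (simp add: possible_def)
      obtain w t z where tr: "tracks T s ((w, t, ?U) # z)" using possible_tracks[OF T] .
      show ?thesis using skip_loses[OF good tr skip(2) time[OF T tr]] skip(1) by simp
    qed
    then have "0 < advantage f n s a"
      unfolding advantage_def using pmf_tree_pos ne finite_possible by (intro sum_pos) auto
    then show ?thesis by blast
  next
    case (illegal j)
    have "action_gain f n T s a = 0" if T: "T \<in> possible s" for T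
    proof -
      interpret placed_tree k L N \<omega> pa T using T trees_placed by (simp add: possible_def)
      obtain w t z where tr: "tracks T s ((w, t, ?U) # z)" using possible_tracks[OF T] .
      show ?thesis using action_gain_illegal[OF not_goal] legal_down[OF tr] illegal by simp
    qed
    then show ?thesis by (simp add: advantage_def)
  next
    case (wrong j)
    obtain xs ys where split: "sorted_list_of_set ?U = xs @ j # ys"
      using wrong fin by (metis in_set_conv_decomp set_sorted_list_of_set)
    have dist: "distinct (xs @ j # ys)" and sorted: "sorted (xs @ j # ys)"
      using split by (metis distinct_sorted_list_of_set, metis sorted_sorted_list_of_set)
    have setU: "set (xs @ j # ys) = ?U" using split fin by (metis set_sorted_list_of_set)
    have rest: "sorted_list_of_set (?U - {j}) = xs @ ys"
      using dist fin by (subst sorted_list_of_set_remove) (auto simp: split remove1_append)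
    have less: "\<forall>x\<in>set xs. x < j" using dist sorted by (auto simp: sorted_append order_le_less)
    have "xs \<noteq> []"
    proof
      assume "xs = []"
      then have "Min ?U = j"
        using split sorted_list_min[OF fin] wrong by auto
      then show False using wrong by simp
    qed
    then have sum: "(\<Sum>T\<in>possible s. pmf tree_pmf T * list_gain f s (j # sorted_list_of_set (?U - {j})) T)
      < (\<Sum>T\<in>possible s. pmf tree_pmf T * list_gain f s (sorted_list_of_set ?U) T)"
      using postpone_sum[where f = f and pre = "[]" and j = j and xs = xs and ys = ys, OF dec ne]
        dist setU less unfolding rest split by auto
    have "ranked_gain f (Suc n) T s - action_gain f n T s a
       = list_gain f s (sorted_list_of_set ?U) T - list_gain f s (j # sorted_list_of_set (?U - {j})) T"
      if T: "T \<in> possible s" for T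
    proof -
      interpret placed_tree k L N \<omega> pa T using T trees_placed by (simp add: possible_def)
      obtain w t z where tr: "tracks T s ((w, t, ?U) # z)" using possible_tracks[OF T] .
      have "top_frame T s = (w, t)" using top_frame_eq[OF _ tr] T by (simp add: possible_def)
      then show ?thesis
        using ranked_gain_eq[OF tr time[OF T tr]] action_gain_down[OF tr wrong(2) time[OF T tr]] wrong(1)
        by (simp add: list_gain_def)
    qed
    then have "advantage f n s a = (\<Sum>T\<in>possible s. pmf tree_pmf T * list_gain f s (sorted_list_of_set ?U) T)
       - (\<Sum>T\<in>possible s. pmf tree_pmf T * list_gain f s (j # sorted_list_of_set (?U - {j})) T)"
      by (simp add: advantage_def right_diff_distrib sum_subtractf)
    then show ?thesis using sum by simp
  qed
qed

lemma advantage_nonneg: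
  assumes "good_reward k L (p k) f" "length (fst s) + Suc n = 2 * N" "a \<in> actions k"
  shows "0 \<le> advantage f n s a"
proof (cases "possible s = {}")
  case False
  have "0 \<le> (\<Sum>T\<in>possible s. pmf tree_pmf T * ranked_gain f (Suc n) T s)"
    using assms(1) by (intro sum_nonneg mult_nonneg_nonneg ranked_gain_nonneg) (auto simp: good_reward_def)
  then show ?thesis using advantage_cases[OF assms(1,2) False assms(3)] by auto
qed (simp add: advantage_def)

lemma advantage_pos:
  assumes "good_reward k L (p k) f" "length (fst s) + Suc n = 2 * N" "a \<in> actions k"
    "a \<noteq> ranked_dfs_action k pa s" "T \<in> possible s" "0 < ranked_gain f (Suc n) T s"
  shows "0 < advantage f n s a"
proof -
  have "0 < (\<Sum>T\<in>possible s. pmf tree_pmf T * ranked_gain f (Suc n) T s)"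
    using assms(1,5,6) pmf_tree_pos finite_possible
    by (intro sum_pos2[of _ T] mult_nonneg_nonneg ranked_gain_nonneg mult_pos_pos) (auto simp: good_reward_def)
  moreover have "possible s \<noteq> {}" using assms(5) by blast
  ultimately show ?thesis using advantage_cases[OF assms(1,2) _ assms(3)] assms(4) by auto
qed

end

section \<open>Runs of policies\<close>

definition path_weight :: "policy \<Rightarrow> state \<Rightarrow> real" where
  "path_weight \<pi> s =
     (\<Prod>i<length (fst s). pmf (\<pi> (take i (fst s), fst (fst s ! i))) (snd (fst s ! i)))"

lemma path_weight_Nil [simp]: "path_weight \<pi> ([], ob) = 1"
  by (simp add: path_weight_def)

lemma path_weight_snoc:
  "path_weight \<pi> (xs @ [(ob, a)], ob') = path_weight \<pi> (xs, ob) * pmf (\<pi> (xs, ob)) a"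
  by (simp add: path_weight_def nth_append)

lemma path_weight_nonneg: "0 \<le> path_weight \<pi> s"
  by (simp add: path_weight_def prod_nonneg)

lemma step_ended: "ended c \<Longrightarrow> step \<Phi> \<pi> c = return_pmf c"
  by (simp add: step_def)

lemma step_running:
  "\<not> at_goal s \<Longrightarrow> step \<Phi> \<pi> (False, s) = map_pmf (\<lambda>a. act \<Phi> a s) (\<pi> s)"
  by (simp add: step_def ended_def act_def cong: if_cong)

lemma pmf_step_snoc:
  assumes "\<not> at_goal (xs @ [(ob, a)], ob')"
  shows "pmf (step \<Phi> \<pi> c) (False, (xs @ [(ob, a)], ob')) =
    (if c = (False, (xs, ob)) \<and> \<not> at_goal (xs, ob) \<and> legal \<Phi> (xs, ob) a
        \<and> successor \<Phi> (xs, ob) a = (xs @ [(ob, a)], ob') then pmf (\<pi> (xs, ob)) a else 0)"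
proof (cases "ended c")
  case True
  then have "c \<noteq> (False, (xs @ [(ob, a)], ob'))" using assms by (auto simp: ended_def)
  moreover have "c = (False, (xs, ob)) \<Longrightarrow> at_goal (xs, ob)" using True by (auto simp: ended_def)
  ultimately show ?thesis using True by (auto simp: step_ended)
next
  case False
  then obtain s where c: "c = (False, s)" "\<not> at_goal s" by (cases c) (auto simp: ended_def)
  let ?P = "s = (xs, ob) \<and> legal \<Phi> (xs, ob) a \<and> successor \<Phi> (xs, ob) a = (xs @ [(ob, a)], ob')"
  have "(\<lambda>a. act \<Phi> a s) -` {(False, (xs @ [(ob, a)], ob'))} = (if ?P then {a} else {})"
    by (cases s) (auto simp: act_def successor_def split: if_splits)
  then have "pmf (step \<Phi> \<pi> c) (False, (xs @ [(ob, a)], ob')) = measure (measure_pmf (\<pi> s)) (if ?P then {a} else {})"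
    using c by (simp add: step_running pmf_map)
  then show ?thesis using c by (auto simp: measure_pmf_single)
qed

lemma pmf_step_Nil:
  assumes "\<not> at_goal ([], ob)"
  shows "pmf (step \<Phi> \<pi> c) (False, ([], ob)) = 0"
proof (cases "ended c")
  case True
  then show ?thesis using assms by (cases c) (auto simp: step_ended ended_def indicator_def)
next
  case False
  then obtain s where c: "c = (False, s)" "\<not> at_goal s" by (cases c) (auto simp: ended_def)
  have "(\<lambda>a. act \<Phi> a s) -` {(False, ([], ob))} = {}"
    by (auto simp: act_def successor_def split: if_splits)
  then show ?thesis using c by (simp add: step_running pmf_map)
qed

lemma pmf_run:
  "\<not> at_goal s \<Longrightarrow> pmf (run \<Phi> \<pi> h) (False, s) =
    (if length (fst s) = h \<and> compat \<Phi> s then path_weight \<pi> s else 0)"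
proof (induction h arbitrary: s)
  case 0
  obtain xs ob where s: "s = (xs, ob)" by (cases s)
  show ?case by (cases xs) (auto simp: s compat_Nil)
next
  case (Suc h)
  obtain xs ob' where s: "s = (xs, ob')" by (cases s)
  show ?case
  proof (cases xs rule: rev_cases)
    case Nil
    then show ?thesis using Suc.prems by (simp add: s pmf_bind pmf_step_Nil)
  next
    case (snoc ys y)
    obtain ob a where y: "y = (ob, a)" by (cases y)
    let ?P = "\<not> at_goal (ys, ob) \<and> legal \<Phi> (ys, ob) a \<and> successor \<Phi> (ys, ob) a = (ys @ [(ob, a)], ob')"
    have "pmf (run \<Phi> \<pi> (Suc h)) (False, s)
        = (\<integral>c. (if c = (False, (ys, ob)) \<and> ?P then pmf (\<pi> (ys, ob)) a else 0) \<partial>run \<Phi> \<pi> h)"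
      using pmf_step_snoc[of ys ob a ob' \<Phi> \<pi>] Suc.prems by (simp add: s snoc y pmf_bind)
    also have "\<dots> = (\<Sum>c\<in>{(False, (ys, ob))}. (if c = (False, (ys, ob)) \<and> ?P then pmf (\<pi> (ys, ob)) a else 0)
        * pmf (run \<Phi> \<pi> h) c)"
      by (rule integral_measure_pmf_real) (auto split: if_splits)
    also have "\<dots> = (if ?P then pmf (\<pi> (ys, ob)) a * pmf (run \<Phi> \<pi> h) (False, (ys, ob)) else 0)"
      by simp
    also have "\<dots> = (if length (fst s) = Suc h \<and> compat \<Phi> s then path_weight \<pi> s else 0)"
      using Suc.IH[of "(ys, ob)"] by (auto simp: s snoc y compat_snoc path_weight_snoc)
    finally show ?thesis .
  qed
qed

lemma finite_actions: "finite (actions k)"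
  by (simp add: actions_def)

lemma finite_set_policy: "\<pi> \<in> policies k \<Longrightarrow> finite (set_pmf (\<pi> s))"
  unfolding policies_def using finite_subset[OF _ finite_actions] by blast

lemma finite_set_step: "\<pi> \<in> policies k \<Longrightarrow> finite (set_pmf (step \<Phi> \<pi> c))"
  using finite_set_policy by (simp add: step_def)

lemma finite_set_run: "\<pi> \<in> policies k \<Longrightarrow> finite (set_pmf (run \<Phi> \<pi> h))"
  by (induction h) (auto simp: finite_set_step)

context search
begin

abbreviation (input) init :: "environment \<Rightarrow> config" where
  "init \<Phi> \<equiv> (False, ([], observe \<Phi> (root (fst \<Phi>))))"

definition hybrid_value :: "(nat \<Rightarrow> real) \<Rightarrow> policy \<Rightarrow> nat \<Rightarrow> real" where
  "hybrid_value f \<pi> h = (\<Sum>T\<in>trees. \<Sum>g\<in>{1..N}. pmf tree_pmf T * pmf (goal_pmf pa T) g *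
     measure_pmf.expectation (run (T, g) \<pi> h) (\<lambda>c. payoff f (ranked_run (T, g) (2 * N - h) c)))"

lemma env_pmf_eq: "env_pmf k N \<omega> pa = bind_pmf tree_pmf (\<lambda>T. map_pmf (Pair T) (goal_pmf pa T))"
  by (simp add: env_pmf_def tree_pmf_def bind_assoc_pmf map_pmf_def)

lemma pmf_env: "pmf (env_pmf k N \<omega> pa) (T, g) = pmf tree_pmf T * pmf (goal_pmf pa T) g"
proof -
  have "pmf (map_pmf (Pair T') (goal_pmf pa T')) (T, g) = (if T' = T then pmf (goal_pmf pa T) g else 0)" for T'
  proof -
    have "Pair T' -` {(T, g)} = (if T' = T then {g} else {})" by auto
    then show ?thesis by (simp add: pmf_map measure_pmf_single)
  qed
  then have "pmf (env_pmf k N \<omega> pa) (T, g)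
      = (\<integral>T'. (if T' = T then pmf (goal_pmf pa T) g else 0) \<partial>tree_pmf)"
    by (simp add: env_pmf_eq pmf_bind)
  also have "\<dots> = (\<Sum>T'\<in>{T}. (if T' = T then pmf (goal_pmf pa T) g else 0) * pmf tree_pmf T')"
    by (rule integral_measure_pmf_real) (auto split: if_splits)
  finally show ?thesis by simp
qed

lemma goal_range:
  assumes "T \<in> trees" "g \<in> set_pmf (goal_pmf pa T)"
  shows "g \<in> {1..N}"
proof -
  interpret placed_tree k L N \<omega> pa T using assms trees_placed by simp
  show ?thesis using set_goal_pmf[OF full set_pa] nodes_range assms by blast
qed

lemma set_env: "(T, g) \<in> set_pmf (env_pmf k N \<omega> pa) \<longleftrightarrow> T \<in> trees \<and> g \<in> set_pmf (goal_pmf pa T)"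
  by (simp add: env_pmf_eq set_tree_pmf image_iff)

lemma expectation_after:
  assumes "\<pi> \<in> policies k"
  shows "measure_pmf.expectation (after k N \<omega> pa \<pi> h) F = (\<Sum>T\<in>trees. \<Sum>g\<in>{1..N}.
    pmf tree_pmf T * pmf (goal_pmf pa T) g * measure_pmf.expectation (run (T, g) \<pi> h) F)"
proof -
  have "set_pmf (env_pmf k N \<omega> pa) \<subseteq> trees \<times> {1..N}"
  proof
    fix \<Phi> assume "\<Phi> \<in> set_pmf (env_pmf k N \<omega> pa)"
    then show "\<Phi> \<in> trees \<times> {1..N}" using set_env goal_range by (cases \<Phi>) auto
  qed
  then have "measure_pmf.expectation (after k N \<omega> pa \<pi> h) F = (\<Sum>\<Phi>\<in>trees \<times> {1..N}.
      pmf (env_pmf k N \<omega> pa) \<Phi> *\<^sub>R measure_pmf.expectation (run \<Phi> \<pi> h) F)"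
    unfolding after_def using finite_set_run[OF assms] finite_trees by (intro pmf_expectation_bind) auto
  also have "\<dots> = (\<Sum>(T, g)\<in>trees \<times> {1..N}. pmf tree_pmf T * pmf (goal_pmf pa T) g *
      measure_pmf.expectation (run (T, g) \<pi> h) F)"
    by (intro sum.cong) (auto simp: pmf_env)
  finally show ?thesis by (simp add: sum.cartesian_product)
qed

lemma hybrid_value_end:
  assumes "\<pi> \<in> policies k"
  shows "measure_pmf.expectation (episode k N \<omega> pa \<pi>) (payoff f) = hybrid_value f \<pi> (2 * N)"
  unfolding episode_def horizon_def expectation_after[OF assms] hybrid_value_def by simp

lemma hybrid_value_start:
  "hybrid_value f \<pi> 0 = (\<Sum>T\<in>trees. \<Sum>g\<in>{1..N}. pmf tree_pmf T * pmf (goal_pmf pa T) g *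
     payoff f (ranked_run (T, g) (2 * N) (init (T, g))))"
  by (simp add: hybrid_value_def)

definition running_states :: "policy \<Rightarrow> nat \<Rightarrow> state set" where
  "running_states \<pi> h = {s. \<not> at_goal s \<and> (\<exists>T\<in>trees. \<exists>g\<in>{1..N}. (False, s) \<in> set_pmf (run (T, g) \<pi> h))}"

lemma finite_running_states:
  assumes "\<pi> \<in> policies k"
  shows "finite (running_states \<pi> h)"
proof -
  have "running_states \<pi> h \<subseteq> snd ` (\<Union>\<Phi>\<in>trees \<times> {1..N}. set_pmf (run \<Phi> \<pi> h))"
    by (force simp: running_states_def)
  then show ?thesis
    using finite_set_run[OF assms] finite_trees by (meson finite_UN finite_SigmaI finite_atLeastAtMost finite_imageI finite_subset)
qed

lemma running_length:
  assumes "s \<in> running_states \<pi> h"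
  shows "length (fst s) = h" "\<not> at_goal s" "0 < path_weight \<pi> s"
  using assms pmf_run[of s _ \<pi> h] path_weight_nonneg[of \<pi> s]
  by (auto simp: running_states_def set_pmf_iff split: if_splits)

lemma run_step_difference:
  assumes \<pi>: "\<pi> \<in> policies k" and \<Phi>: "T \<in> trees" "g \<in> {1..N}"
  shows "measure_pmf.expectation (run (T, g) \<pi> h) (\<lambda>c. payoff f (ranked_run (T, g) (Suc n) c))
      - measure_pmf.expectation (run (T, g) \<pi> (Suc h)) (\<lambda>c. payoff f (ranked_run (T, g) n c))
    = (\<Sum>s\<in>running_states \<pi> h. path_weight \<pi> s * (\<Sum>a\<in>actions k. pmf (\<pi> s) a *
        (if compat (T, g) s then payoff f (ranked_run (T, g) (Suc n) (False, s))
           - payoff f (ranked_run (T, g) n (act (T, g) a s)) else 0)))"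
proof -
  let ?R = "run (T, g) \<pi>" and ?Y = "\<lambda>c. payoff f (ranked_run (T, g) (Suc n) c)"
  let ?X = "\<lambda>c. payoff f (ranked_run (T, g) n c)"
  define Z where "Z c = ?Y c - measure_pmf.expectation (step (T, g) \<pi> c) ?X" for c
  have fin: "finite (set_pmf (?R h))" using finite_set_run[OF \<pi>] .
  have "measure_pmf.expectation (?R h) ?Y = (\<Sum>c\<in>set_pmf (?R h). pmf (?R h) c * ?Y c)"
    using integral_measure_pmf_real[OF fin, of "?R h" ?Y] by (simp add: mult.commute)
  moreover have "measure_pmf.expectation (?R (Suc h)) ?X
      = (\<Sum>c\<in>set_pmf (?R h). pmf (?R h) c * measure_pmf.expectation (step (T, g) \<pi> c) ?X)"
    using pmf_expectation_bind[where f = "step (T, g) \<pi>" and h = ?X, OF fin finite_set_step[OF \<pi>] order_refl]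
    by (simp only: run.simps real_scaleR_def)
  ultimately have "measure_pmf.expectation (?R h) ?Y - measure_pmf.expectation (?R (Suc h)) ?X
      = (\<Sum>c\<in>set_pmf (?R h). pmf (?R h) c * Z c)"
    by (simp add: Z_def right_diff_distrib sum_subtractf)
  also have "\<dots> = (\<Sum>c\<in>set_pmf (?R h) \<union> Pair False ` running_states \<pi> h. pmf (?R h) c * Z c)"
    using fin finite_running_states[OF \<pi>] by (intro sum.mono_neutral_left) (auto simp: set_pmf_iff)
  also have "\<dots> = (\<Sum>c\<in>Pair False ` running_states \<pi> h. pmf (?R h) c * Z c)"
  proof (intro sum.mono_neutral_right ballI)
    fix c assume c: "c \<in> set_pmf (?R h) \<union> Pair False ` running_states \<pi> h - Pair False ` running_states \<pi> h"
    have "ended c"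
    proof (rule ccontr)
      assume "\<not> ended c"
      then obtain s where "c = (False, s)" "\<not> at_goal s" by (cases c) (auto simp: ended_def)
      then have "s \<in> running_states \<pi> h" using c \<Phi> by (auto simp: running_states_def)
      then show False using c \<open>c = (False, s)\<close> by auto
    qed
    then show "pmf (?R h) c * Z c = 0" by (simp add: Z_def step_ended ranked_run_ended)
  qed (use fin finite_running_states[OF \<pi>] in auto)
  also have "\<dots> = (\<Sum>s\<in>running_states \<pi> h. pmf (?R h) (False, s) * Z (False, s))"
    by (simp add: sum.reindex inj_on_def)
  also have "\<dots> = (\<Sum>s\<in>running_states \<pi> h. path_weight \<pi> s * (\<Sum>a\<in>actions k. pmf (\<pi> s) a *
        (if compat (T, g) s then ?Y (False, s) - ?X (act (T, g) a s) else 0)))"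
  proof (rule sum.cong[OF refl])
    fix s assume s: "s \<in> running_states \<pi> h"
    have sub: "set_pmf (\<pi> s) \<subseteq> actions k" using \<pi> unfolding policies_def by blast
    have "measure_pmf.expectation (step (T, g) \<pi> (False, s)) ?X
        = (\<Sum>a\<in>actions k. ?X (act (T, g) a s) * pmf (\<pi> s) a)"
      unfolding step_running[OF running_length(2)[OF s]] integral_map_pmf
      using sub by (intro integral_measure_pmf_real finite_actions) auto
    moreover have "(\<Sum>a\<in>actions k. pmf (\<pi> s) a) = 1"
      using sub finite_actions by (intro sum_pmf_eq_1)
    then have "?Y (False, s) = (\<Sum>a\<in>actions k. ?Y (False, s) * pmf (\<pi> s) a)"
      by (simp add: sum_distrib_left[symmetric])
    ultimately have "Z (False, s) = (\<Sum>a\<in>actions k. pmf (\<pi> s) a * (?Y (False, s) - ?X (act (T, g) a s)))"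
      by (simp add: Z_def right_diff_distrib sum_subtractf mult.commute)
    then show "pmf (?R h) (False, s) * Z (False, s) = path_weight \<pi> s * (\<Sum>a\<in>actions k. pmf (\<pi> s) a *
        (if compat (T, g) s then ?Y (False, s) - ?X (act (T, g) a s) else 0))"
      using pmf_run[OF running_length(2)[OF s]] running_length(1)[OF s] by simp
  qed
  finally show ?thesis .
qed

lemma advantage_expand:
  assumes "\<not> at_goal s"
  shows "advantage f n s a = (\<Sum>T\<in>trees. \<Sum>g\<in>{1..N}. pmf tree_pmf T * pmf (goal_pmf pa T) g *
     (if compat (T, g) s then payoff f (ranked_run (T, g) (Suc n) (False, s))
           - payoff f (ranked_run (T, g) n (act (T, g) a s)) else 0))"
proof -
  have each: "(\<Sum>g\<in>{1..N}. pmf tree_pmf T * pmf (goal_pmf pa T) g *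
     (if compat (T, g) s then payoff f (ranked_run (T, g) (Suc n) (False, s))
           - payoff f (ranked_run (T, g) n (act (T, g) a s)) else 0))
    = (if compat (T, 0) s then pmf tree_pmf T * (ranked_gain f (Suc n) T s - action_gain f n T s a) else 0)"
    if T: "T \<in> trees" for T
  proof -
    interpret placed_tree k L N \<omega> pa T using T trees_placed by simp
    show ?thesis
    proof (cases "compat (T, 0) s")
      case True
      have "compat (T, g) s \<longleftrightarrow> g \<notin> visited s" for g using compat_goal_iff[OF assms] True by blast
      then show ?thesis
        unfolding ranked_gain_def action_gain_def sum_subtractf[symmetric] sum_distrib_left
        unfolding if_P[OF True]
        by (intro sum.cong refl) (simp add: right_diff_distrib mult.assoc)
    next
      case False
      then have "\<not> compat (T, g) s" for g using compat_goal_iff[OF assms] by blast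
      then show ?thesis using False by simp
    qed
  qed
  have "advantage f n s a = (\<Sum>T\<in>trees. if compat (T, 0) s
      then pmf tree_pmf T * (ranked_gain f (Suc n) T s - action_gain f n T s a) else 0)"
    unfolding advantage_def possible_def using finite_trees by (simp add: sum.inter_filter)
  then show ?thesis using each by simp
qed

lemma hybrid_value_step:
  assumes \<pi>: "\<pi> \<in> policies k" and n: "h + Suc n = 2 * N"
  shows "hybrid_value f \<pi> h - hybrid_value f \<pi> (Suc h) =
    (\<Sum>s\<in>running_states \<pi> h. path_weight \<pi> s * (\<Sum>a\<in>actions k. pmf (\<pi> s) a * advantage f n s a))"
proof -
  let ?d = "\<lambda>T g s a. (if compat (T, g) s then payoff f (ranked_run (T, g) (Suc n) (False, s))
           - payoff f (ranked_run (T, g) n (act (T, g) a s)) else 0)"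
  let ?q = "\<lambda>T g. pmf tree_pmf T * pmf (goal_pmf pa T) g"
  have times: "2 * N - h = Suc n" "2 * N - Suc h = n" using n by auto
  have "hybrid_value f \<pi> h - hybrid_value f \<pi> (Suc h) = (\<Sum>T\<in>trees. \<Sum>g\<in>{1..N}. ?q T g *
      (\<Sum>s\<in>running_states \<pi> h. path_weight \<pi> s * (\<Sum>a\<in>actions k. pmf (\<pi> s) a * ?d T g s a)))"
    unfolding hybrid_value_def times sum_subtractf[symmetric] right_diff_distrib[symmetric]
    using run_step_difference[OF \<pi>, of _ _ h f n] by (intro sum.cong refl) simp
  also have "\<dots> = (\<Sum>T\<in>trees. \<Sum>g\<in>{1..N}. \<Sum>s\<in>running_states \<pi> h. \<Sum>a\<in>actions k.
      path_weight \<pi> s * (pmf (\<pi> s) a * (?q T g * ?d T g s a)))"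
    unfolding sum_distrib_left by (intro sum.cong refl) (simp add: ac_simps)
  also have "\<dots> = (\<Sum>T\<in>trees. \<Sum>s\<in>running_states \<pi> h. \<Sum>a\<in>actions k. \<Sum>g\<in>{1..N}.
      path_weight \<pi> s * (pmf (\<pi> s) a * (?q T g * ?d T g s a)))"
    by (subst sum.swap[of _ "{1..N}"], subst sum.swap[of _ "{1..N}"]) simp
  also have "\<dots> = (\<Sum>s\<in>running_states \<pi> h. \<Sum>a\<in>actions k. \<Sum>T\<in>trees. \<Sum>g\<in>{1..N}.
      path_weight \<pi> s * (pmf (\<pi> s) a * (?q T g * ?d T g s a)))"
    by (subst sum.swap[of _ trees], subst sum.swap[of _ trees]) simp
  also have "\<dots> = (\<Sum>s\<in>running_states \<pi> h. path_weight \<pi> s *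
      (\<Sum>a\<in>actions k. pmf (\<pi> s) a * advantage f n s a))"
    unfolding sum_distrib_left[symmetric] using running_length(2)
    by (intro sum.cong refl) (simp add: advantage_expand)
  finally show ?thesis .
qed

end

section \<open>The two objectives\<close>

lemma run_invariant:
  assumes "c \<in> set_pmf (run \<Phi> \<pi> h)"
  shows "length (fst (snd c)) \<le> h" "\<forall>x\<in>set (fst (snd c)). snd (fst x) \<noteq> Goal"
    "fst (snd c) = [] \<Longrightarrow> snd (snd c) = observe \<Phi> (root (fst \<Phi>))"
proof -
  have "length (fst (snd c)) \<le> h \<and> (\<forall>x\<in>set (fst (snd c)). snd (fst x) \<noteq> Goal) \<and>
    (fst (snd c) = [] \<longrightarrow> snd (snd c) = observe \<Phi> (root (fst \<Phi>)))"
    using assms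
  proof (induction h arbitrary: c)
    case (Suc h)
    then obtain c' where c': "c' \<in> set_pmf (run \<Phi> \<pi> h)" "c \<in> set_pmf (step \<Phi> \<pi> c')" by auto
    show ?case
    proof (cases "ended c'")
      case True
      then show ?thesis using Suc.IH[OF c'(1)] c'(2) by (auto simp: step_ended)
    next
      case False
      then obtain s where s: "c' = (False, s)" "\<not> at_goal s" by (cases c') (auto simp: ended_def)
      then obtain a where "c = act \<Phi> a s" using c'(2) by (auto simp: step_running)
      then show ?thesis using Suc.IH[OF c'(1)] s
        by (auto simp: act_def successor_def at_goal_def)
    qed
  qed simp
  then show "length (fst (snd c)) \<le> h" "\<forall>x\<in>set (fst (snd c)). snd (fst x) \<noteq> Goal"
    "fst (snd c) = [] \<Longrightarrow> snd (snd c) = observe \<Phi> (root (fst \<Phi>))" by blast+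
qed

lemma sched_const_one:
  "(\<And>i s. i \<in> set is \<Longrightarrow> E i s = 1) \<Longrightarrow> sched p E sz \<tau> is = sum_list (map p is)"
  by (induction "is" arbitrary: \<tau>) auto

context search
begin

lemma ranked_run_add: "ranked_run \<Phi> (m + n) c = ranked_run \<Phi> m (ranked_run \<Phi> n c)"
  by (simp add: ranked_run_def funpow_add)

lemma tree_value_one:
  assumes "full_ktree k t"
  shows "tree_value p (\<lambda>_. 1) \<tau> t = 1"
  using assms
proof (induction t arbitrary: \<tau> rule: measure_induct_rule[where f = tsize])
  case (less t)
  show ?case
  proof (cases "children t = []")
    case False
    then have ind: "indices t = {1..k}" using full_ktree_indices less.prems by blast
    let ?is = "sorted_list_of_set (indices t)"
    have "order_value p (\<lambda>_. 1) \<tau> t ?is = sum_list (map p ?is)"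
      using less tsize_children[OF child_mem] full_ktree_subtree[OF less.prems subtree_child[OF subtree_refl]]
      by (intro sched_const_one) auto
    also have "\<dots> = 1" using sum_p unfolding ind by (simp add: sum_list_sorted)
    finally show ?thesis using False tree_value_step[of p "\<lambda>_. 1" \<tau> t] by simp
  qed (simp add: tree_value_leaf)
qed

lemma goal_not_root:
  assumes "T \<in> trees" "g \<in> set_pmf (goal_pmf pa T)"
  shows "g \<noteq> root T" "children T \<noteq> []"
proof -
  interpret placed_tree k L N \<omega> pa T using assms trees_placed by simp
  show ne: "children T \<noteq> []" using assms(1) by (cases T) (auto simp: trees_def ktrees_def)
  show "g \<noteq> root T"
    using pmf_goal_root[OF full set_pa distinct] ne assms(2) by (auto simp: set_pmf_iff)
qed

lemma ranked_success:
  assumes T: "T \<in> trees" and g: "g \<in> set_pmf (goal_pmf pa T)"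
  shows "at_goal (snd (ranked_run (T, g) (2 * N) (init (T, g))))"
proof -
  interpret placed_tree k L N \<omega> pa T using T trees_placed by simp
  let ?s = "([], observe (T, 0) (root T)) :: state"
  let ?y = "\<lambda>g. if g \<in> visited ?s then 0 else payoff (\<lambda>_. 1) (ranked_run (T, g) (2 * N) (False, ?s))"
  have ne: "children T \<noteq> []" using goal_not_root[OF T g] by simp
  have "stack_time [(1, T, indices T)] \<le> 2 * N"
    using tracks_time[OF tracks_start] tsize_le_N by simp
  then have "ranked_gain (\<lambda>_. 1) (2 * N) T ?s = stack_value p (\<lambda>_. 1) 0 [(1, T, indices T)]"
    using ranked_gain_eq[OF tracks_start] by simp
  also have "\<dots> = 1"
    using tree_value_one[OF full, of 0] tree_value_step[of p "\<lambda>_. 1" 0 T] ne by simp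
  finally have "(\<Sum>g\<in>{1..N}. pmf (goal_pmf pa T) g * ?y g) = 1" by (simp add: ranked_gain_def)
  moreover have "(\<Sum>g\<in>{1..N}. pmf (goal_pmf pa T) g) = 1"
    using goal_range[OF T] by (intro sum_pmf_eq_1) auto
  ultimately have "(\<Sum>g\<in>{1..N}. pmf (goal_pmf pa T) g * (1 - ?y g)) = 0"
    by (simp add: right_diff_distrib sum_subtractf)
  then have "pmf (goal_pmf pa T) g * (1 - ?y g) = 0"
    using goal_range[OF T g] by (subst (asm) sum_nonneg_eq_0_iff) (auto simp: payoff_def)
  then have "?y g = 1" using g by (simp add: set_pmf_iff)
  moreover have "observe (T, g) (root T) = observe (T, 0) (root T)"
    using observe_no_goal[OF root_in_nodes] goal_not_root[OF T g] by simp
  ultimately show ?thesis by (auto simp: payoff_def split: if_splits)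
qed

lemma set_after: "c \<in> set_pmf (after k N \<omega> pa \<pi> h) \<longleftrightarrow>
    (\<exists>T\<in>trees. \<exists>g\<in>set_pmf (goal_pmf pa T). c \<in> set_pmf (run (T, g) \<pi> h))"
proof -
  have "c \<in> set_pmf (after k N \<omega> pa \<pi> h) \<longleftrightarrow> (\<exists>T g. (T, g) \<in> set_pmf (env_pmf k N \<omega> pa) \<and> c \<in> set_pmf (run (T, g) \<pi> h))"
    unfolding after_def set_bind_pmf UN_iff by (metis surj_pair)
  then show ?thesis unfolding set_env by blast
qed

lemma reachable_iff: "s \<in> reachable_nonterminal k N \<omega> pa \<pi> \<longleftrightarrow>
    \<not> at_goal s \<and> length (fst s) < 2 * N \<and> 0 < path_weight \<pi> s \<and>
    (\<exists>T\<in>trees. \<exists>g\<in>set_pmf (goal_pmf pa T). compat (T, g) s)"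
proof -
  have run: "(False, s) \<in> set_pmf (run \<Phi> \<pi> h) \<longleftrightarrow> length (fst s) = h \<and> compat \<Phi> s \<and> 0 < path_weight \<pi> s"
    if "\<not> at_goal s" for \<Phi> h
    using pmf_run[OF that, of \<Phi> \<pi> h] path_weight_nonneg[of \<pi> s] by (auto simp: set_pmf_iff)
  then show ?thesis
    unfolding reachable_nonterminal_def horizon_def mem_Collect_eq set_after
  proof (cases "at_goal s")
    case False
    then show "(\<exists>h<2 * N. (\<exists>T\<in>trees. \<exists>g\<in>set_pmf (goal_pmf pa T). (False, s) \<in> set_pmf (run (T, g) \<pi> h)) \<and> \<not> at_goal s)
      \<longleftrightarrow> \<not> at_goal s \<and> length (fst s) < 2 * N \<and> 0 < path_weight \<pi> s \<and>
        (\<exists>T\<in>trees. \<exists>g\<in>set_pmf (goal_pmf pa T). compat (T, g) s)"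
      unfolding run[OF False] by blast
  qed simp
qed

lemma run_ranked:
  assumes \<pi>: "is_ranked_dfs k N \<omega> pa \<pi>\<^sub>0" and T: "T \<in> trees" and g: "g \<in> set_pmf (goal_pmf pa T)"
  shows "h \<le> 2 * N \<Longrightarrow> run (T, g) \<pi>\<^sub>0 h = return_pmf (ranked_run (T, g) h (init (T, g)))"
proof (induction h)
  case (Suc h)
  let ?c = "ranked_run (T, g) h (init (T, g))"
  have c: "run (T, g) \<pi>\<^sub>0 h = return_pmf ?c" using Suc by simp
  have next_c: "ranked_run (T, g) (Suc h) (init (T, g)) = ranked_step (T, g) ?c"
    by (simp add: ranked_run_def)
  have "step (T, g) \<pi>\<^sub>0 ?c = return_pmf (ranked_step (T, g) ?c)"
  proof (cases "ended ?c")
    case True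
    then show ?thesis by (simp add: step_ended ranked_step_def)
  next
    case False
    then obtain s where s: "?c = (False, s)" "\<not> at_goal s" by (cases ?c) (auto simp: ended_def)
    have "(False, s) \<in> set_pmf (run (T, g) \<pi>\<^sub>0 h)" using c s by simp
    then have "(False, s) \<in> set_pmf (after k N \<omega> pa \<pi>\<^sub>0 h)"
      unfolding set_after using T g by blast
    then have "s \<in> reachable_nonterminal k N \<omega> pa \<pi>\<^sub>0"
      using s Suc.prems unfolding reachable_nonterminal_def horizon_def mem_Collect_eq
      by (intro exI[of _ h]) simp
    then have "\<pi>\<^sub>0 s = return_pmf (ranked_dfs_action k pa s)" using \<pi> by (simp add: is_ranked_dfs_def)
    then show ?thesis using s by (simp add: step_running ranked_step_def ended_def)
  qed
  then show ?case using c next_c by (simp add: bind_return_pmf)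
qed simp

lemma ranked_policy: "is_ranked_dfs k N \<omega> pa \<pi>\<^sub>0 \<Longrightarrow> \<pi>\<^sub>0 \<in> policies k"
  by (simp add: is_ranked_dfs_def)

lemma ranked_value:
  assumes "is_ranked_dfs k N \<omega> pa \<pi>\<^sub>0"
  shows "measure_pmf.expectation (episode k N \<omega> pa \<pi>\<^sub>0) (payoff f) = hybrid_value f \<pi> 0"
proof -
  have "pmf (goal_pmf pa T) g * measure_pmf.expectation (run (T, g) \<pi>\<^sub>0 (2 * N)) (payoff f)
      = pmf (goal_pmf pa T) g * payoff f (ranked_run (T, g) (2 * N) (init (T, g)))" if "T \<in> trees" for T g
    using run_ranked[OF assms that, of g "2 * N"] by (cases "g \<in> set_pmf (goal_pmf pa T)") (auto simp: set_pmf_iff)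
  then show ?thesis
    unfolding episode_def horizon_def expectation_after[OF ranked_policy[OF assms]] hybrid_value_start
    by (intro sum.cong refl) (simp add: mult.assoc)
qed

lemma hybrid_value_mono:
  assumes "good_reward k L (p k) f" "\<pi> \<in> policies k" "i \<le> j" "j \<le> 2 * N"
  shows "hybrid_value f \<pi> j \<le> hybrid_value f \<pi> i"
  using assms(3,4)
proof (induction j rule: dec_induct)
  case (step h)
  then obtain n where n: "h + Suc n = 2 * N" by (metis Suc_le_lessD add_Suc_right less_iff_Suc_add)
  have "0 \<le> (\<Sum>s\<in>running_states \<pi> h. path_weight \<pi> s * (\<Sum>a\<in>actions k. pmf (\<pi> s) a * advantage f n s a))"
    using running_length(1) n assms(1)
    by (intro sum_nonneg mult_nonneg_nonneg path_weight_nonneg advantage_nonneg pmf_nonneg) auto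
  then show ?case using hybrid_value_step[OF assms(2) n, of f] step by simp
qed simp

lemma value_le:
  assumes "good_reward k L (p k) f" "\<pi> \<in> policies k" "is_ranked_dfs k N \<omega> pa \<pi>\<^sub>0"
  shows "measure_pmf.expectation (episode k N \<omega> pa \<pi>) (payoff f)
    \<le> measure_pmf.expectation (episode k N \<omega> pa \<pi>\<^sub>0) (payoff f)"
  using hybrid_value_mono[OF assms(1,2), of 0 "2 * N"] ranked_value[OF assms(3), of f \<pi>]
    hybrid_value_end[OF assms(2), of f] by simp

lemma path_weight_agree:
  assumes "\<And>s'. s' \<in> reachable_nonterminal k N \<omega> pa \<pi> \<Longrightarrow> length (fst s') < m \<Longrightarrow> \<pi> s' = \<pi>' s'"
  shows "s \<in> reachable_nonterminal k N \<omega> pa \<pi> \<Longrightarrow> length (fst s) \<le> m \<Longrightarrow> path_weight \<pi>' s = path_weight \<pi> s"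
proof (induction "fst s" arbitrary: s rule: rev_induct)
  case Nil
  then show ?case by (cases s) simp
next
  case (snoc y ys)
  obtain ob a where y: "y = (ob, a)" by (cases y)
  obtain ob' where s: "s = (ys @ [(ob, a)], ob')" using snoc.hyps(2) y by (cases s) auto
  have pw: "0 < path_weight \<pi> (ys, ob) * pmf (\<pi> (ys, ob)) a"
    using snoc.prems(1) by (simp add: reachable_iff s path_weight_snoc)
  then have "0 < path_weight \<pi> (ys, ob)"
    using path_weight_nonneg[of \<pi> "(ys, ob)"] by (cases "path_weight \<pi> (ys, ob) = 0") auto
  then have r: "(ys, ob) \<in> reachable_nonterminal k N \<omega> pa \<pi>"
    using snoc.prems(1) by (auto simp: reachable_iff s compat_snoc)
  have "path_weight \<pi>' (ys, ob) = path_weight \<pi> (ys, ob)"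
    using snoc.hyps(1)[of "(ys, ob)"] r snoc.prems(2) s by simp
  moreover have "\<pi> (ys, ob) = \<pi>' (ys, ob)" using assms[OF r] snoc.prems(2) s by simp
  ultimately show ?case by (simp add: s path_weight_snoc)
qed

lemma value_less:
  assumes good: "good_reward k L (p k) f" and \<pi>: "\<pi> \<in> policies k" and r: "is_ranked_dfs k N \<omega> pa \<pi>\<^sub>0"
    and differ: "\<not> same_reachable_behavior k N \<omega> pa \<pi> \<pi>\<^sub>0"
  shows "measure_pmf.expectation (episode k N \<omega> pa \<pi>) (payoff f)
    < measure_pmf.expectation (episode k N \<omega> pa \<pi>\<^sub>0) (payoff f)"
proof -
  let ?R = "reachable_nonterminal k N \<omega> pa"
  obtain s where s: "s \<in> ?R \<pi> \<union> ?R \<pi>\<^sub>0" "\<pi> s \<noteq> \<pi>\<^sub>0 s"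
    and least: "\<And>s'. s' \<in> ?R \<pi> \<union> ?R \<pi>\<^sub>0 \<Longrightarrow> \<pi> s' \<noteq> \<pi>\<^sub>0 s' \<Longrightarrow> length (fst s) \<le> length (fst s')"
    using differ ex_has_least_nat[of "\<lambda>s. s \<in> ?R \<pi> \<union> ?R \<pi>\<^sub>0 \<and> \<pi> s \<noteq> \<pi>\<^sub>0 s" _ "\<lambda>s. length (fst s)"]
    unfolding same_reachable_behavior_def by blast
  have agree: "\<pi> s' = \<pi>\<^sub>0 s'" if "s' \<in> ?R \<pi> \<union> ?R \<pi>\<^sub>0" "length (fst s') < length (fst s)" for s'
    using least[OF that(1)] that(2) by (meson not_le)
  have "path_weight \<pi>\<^sub>0 s = path_weight \<pi> s"
  proof (cases "s \<in> ?R \<pi>")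
    case True
    show ?thesis using path_weight_agree[of \<pi> "length (fst s)" \<pi>\<^sub>0 s] agree True by blast
  next
    case False
    then have "s \<in> ?R \<pi>\<^sub>0" using s by blast
    then have "path_weight \<pi> s = path_weight \<pi>\<^sub>0 s"
      using path_weight_agree[of \<pi>\<^sub>0 "length (fst s)" \<pi> s] agree by (metis UnI2 order_refl)
    then show ?thesis by simp
  qed
  then have sR: "s \<in> ?R \<pi>" "s \<in> ?R \<pi>\<^sub>0" using s(1) by (auto simp: reachable_iff)
  then have ng: "\<not> at_goal s" and len: "length (fst s) < 2 * N" and pw: "0 < path_weight \<pi> s"
    "0 < path_weight \<pi>\<^sub>0 s" by (auto simp: reachable_iff)
  obtain T g where T: "T \<in> trees" and g: "g \<in> set_pmf (goal_pmf pa T)" and co: "compat (T, g) s"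
    using sR by (auto simp: reachable_iff)
  interpret placed_tree k L N \<omega> pa T using T trees_placed by simp
  define h where "h = length (fst s)"
  obtain n where n: "h + Suc n = 2 * N" using len unfolding h_def
    by (metis add_Suc_right less_iff_Suc_add)
  have "(False, s) \<in> set_pmf (run (T, g) \<pi> h)"
    using pmf_run[OF ng, of "(T, g)" \<pi> h] co pw by (auto simp: set_pmf_iff h_def)
  then have run: "s \<in> running_states \<pi> h"
    using ng T goal_range[OF T g] unfolding running_states_def by blast
  have "(False, s) \<in> set_pmf (run (T, g) \<pi>\<^sub>0 h)"
    using pmf_run[OF ng, of "(T, g)" \<pi>\<^sub>0 h] co pw by (auto simp: set_pmf_iff h_def)
  then have here: "ranked_run (T, g) h (init (T, g)) = (False, s)"
    using run_ranked[OF r T g, of h] n by simp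
  have "ranked_run (T, g) (2 * N) (init (T, g)) = ranked_run (T, g) (Suc n) (False, s)"
    using ranked_run_add[of "(T, g)" "Suc n" h "init (T, g)"] here n by (simp add: add.commute)
  then have success: "at_goal (snd (ranked_run (T, g) (Suc n) (False, s)))"
    using ranked_success[OF T g] by simp
  have gv: "g \<notin> visited s" and poss: "T \<in> possible s"
    using compat_goal_iff[OF ng, of g] co T unfolding possible_def by blast+
  have f0: "0 < f t" for t using good by (simp add: good_reward_def)
  have "0 < pmf (goal_pmf pa T) g * payoff f (ranked_run (T, g) (Suc n) (False, s))"
    using g success f0 by (simp add: payoff_def pmf_positive)
  then have gain: "0 < ranked_gain f (Suc n) T s"
    unfolding ranked_gain_def using goal_range[OF T g] gv f0
    by (intro sum_pos2[of _ g]) (auto simp: payoff_def less_imp_le)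
  have "\<pi>\<^sub>0 s = return_pmf (ranked_dfs_action k pa s)" using r sR by (simp add: is_ranked_dfs_def)
  then have "\<not> set_pmf (\<pi> s) \<subseteq> {ranked_dfs_action k pa s}"
    using s(2) set_pmf_subset_singleton[of "\<pi> s" "ranked_dfs_action k pa s"] by simp
  then obtain a where a: "a \<in> set_pmf (\<pi> s)" "a \<noteq> ranked_dfs_action k pa s" by blast
  have aA: "a \<in> actions k" using a \<pi> unfolding policies_def by blast
  have hn: "length (fst s') + Suc n = 2 * N" if "s' \<in> running_states \<pi> h" for s'
    using running_length(1)[OF that] n by simp
  have "0 < (\<Sum>a\<in>actions k. pmf (\<pi> s) a * advantage f n s a)"
    using advantage_pos[OF good hn[OF run] aA a(2) poss gain] a(1) aA
    by (intro sum_pos2[OF finite_actions, of a] mult_nonneg_nonneg advantage_nonneg[OF good hn[OF run]] mult_pos_pos)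
      (auto simp: pmf_positive)
  then have "0 < (\<Sum>s\<in>running_states \<pi> h. path_weight \<pi> s * (\<Sum>a\<in>actions k. pmf (\<pi> s) a * advantage f n s a))"
    using pw run finite_running_states[OF \<pi>] hn
    by (intro sum_pos2[of _ s] mult_nonneg_nonneg sum_nonneg path_weight_nonneg advantage_nonneg[OF good] mult_pos_pos) auto
  then have "hybrid_value f \<pi> (Suc h) < hybrid_value f \<pi> h"
    using hybrid_value_step[OF \<pi> n, of f] by simp
  moreover have "hybrid_value f \<pi> (2 * N) \<le> hybrid_value f \<pi> (Suc h)" "hybrid_value f \<pi> h \<le> hybrid_value f \<pi> 0"
    using hybrid_value_mono[OF good \<pi>] n by auto
  ultimately show ?thesis using ranked_value[OF r, of f \<pi>] hybrid_value_end[OF \<pi>, of f] by simp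
qed

lemma ranked_in_success:
  assumes "is_ranked_dfs k N \<omega> pa \<pi>\<^sub>0"
  shows "\<pi>\<^sub>0 \<in> success_policies k N \<omega> pa"
proof -
  have "at_goal (snd c)" if "c \<in> set_pmf (episode k N \<omega> pa \<pi>\<^sub>0)" for c
    using that run_ranked[OF assms] ranked_success
    by (auto simp: episode_def horizon_def set_after)
  then have "success_prob k N \<omega> pa \<pi>\<^sub>0 = 1"
    unfolding success_prob_def by (subst measure_pmf.prob_eq_1) (auto simp: AE_measure_pmf_iff)
  then show ?thesis using ranked_policy[OF assms] by (simp add: success_policies_def)
qed

lemma finite_set_episode:
  assumes "\<pi> \<in> policies k"
  shows "finite (set_pmf (episode k N \<omega> pa \<pi>))"
proof -
  have "set_pmf (episode k N \<omega> pa \<pi>) \<subseteq> (\<Union>\<Phi>\<in>trees \<times> {1..N}. set_pmf (run \<Phi> \<pi> (2 * N)))"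
    using goal_range by (fastforce simp: episode_def horizon_def set_after)
  then show ?thesis
    using finite_set_run[OF assms] finite_trees
    by (meson finite_UN finite_SigmaI finite_atLeastAtMost finite_subset)
qed

lemma episode_config:
  assumes "c \<in> set_pmf (episode k N \<omega> pa \<pi>)"
  shows "length (fst (snd c)) \<le> 2 * N" "\<forall>x\<in>set (fst (snd c)). snd (fst x) \<noteq> Goal"
    "at_goal (snd c) \<Longrightarrow> 1 \<le> length (fst (snd c))"
proof -
  obtain T g where T: "T \<in> trees" "g \<in> set_pmf (goal_pmf pa T)" and c: "c \<in> set_pmf (run (T, g) \<pi> (2 * N))"
    using assms by (auto simp: episode_def horizon_def set_after)
  show "length (fst (snd c)) \<le> 2 * N" "\<forall>x\<in>set (fst (snd c)). snd (fst x) \<noteq> Goal"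
    using run_invariant[OF c] by auto
  have "observe (T, g) (root T) \<noteq> (root T, Goal)" using goal_not_root[OF T] by (simp add: observe_def)
  then show "at_goal (snd c) \<Longrightarrow> 1 \<le> length (fst (snd c))"
    using run_invariant(3)[OF c] by (cases "fst (snd c) = []") (auto simp: at_goal_def observe_def Suc_le_eq split: if_splits)
qed

lemma discounted_return_eq:
  "\<gamma> * discounted_return k N \<omega> pa \<gamma> \<pi> = measure_pmf.expectation (episode k N \<omega> pa \<pi>) (payoff (power \<gamma>))"
proof -
  have "\<gamma> * (\<Sum>h = 1..horizon N. \<gamma> ^ (h - 1) * reward (snd c) h) = payoff (power \<gamma>) c"
    if c: "c \<in> set_pmf (episode k N \<omega> pa \<pi>)" for c
  proof -
    let ?l = "length (fst (snd c))"
    have "reward (snd c) h = (if h = ?l then (if at_goal (snd c) then 1 else 0) else 0)" for h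
      using episode_config(2)[OF c] by (auto simp: reward_def observations_def nth_append at_goal_def)
    then have "(\<Sum>h = 1..horizon N. \<gamma> ^ (h - 1) * reward (snd c) h)
        = (\<Sum>h\<in>{1..2 * N}. if h = ?l then \<gamma> ^ (?l - 1) * (if at_goal (snd c) then 1 else 0) else 0)"
      unfolding horizon_def by (intro sum.cong) auto
    also have "\<dots> = (if ?l \<in> {1..2 * N} then \<gamma> ^ (?l - 1) * (if at_goal (snd c) then 1 else 0) else 0)"
      by (rule sum.delta) simp
    finally show ?thesis
      using episode_config(1,3)[OF c] power_eq_if[of \<gamma> ?l] by (auto simp: payoff_def)
  qed
  then have "AE c in measure_pmf (episode k N \<omega> pa \<pi>).
      \<gamma> * (\<Sum>h = 1..horizon N. \<gamma> ^ (h - 1) * reward (snd c) h) = payoff (power \<gamma>) c"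
    by (simp add: AE_measure_pmf_iff)
  then have "measure_pmf.expectation (episode k N \<omega> pa \<pi>) (\<lambda>c. \<gamma> * (\<Sum>h = 1..horizon N. \<gamma> ^ (h - 1) * reward (snd c) h))
      = measure_pmf.expectation (episode k N \<omega> pa \<pi>) (payoff (power \<gamma>))"
    by (intro integral_cong_AE) simp_all
  then show ?thesis by (simp add: discounted_return_def)
qed

lemma good_reward_power:
  assumes "1 - p k ^ L / 16 < \<gamma>" "\<gamma> < 1"
  shows "good_reward k L (p k) (power \<gamma>)"
proof -
  have pk: "0 < p k" "p k \<le> 1" using p_k_pos pmf_le_1 by auto
  have "p k ^ L \<le> 1" using pk by (intro power_le_one) auto
  then have \<gamma>: "0 < \<gamma>" "\<gamma> < 1" using assms by linarith+
  have "2 * (\<gamma> ^ t' - \<gamma> ^ (t' + 2 * m)) \<le> real u * p k ^ (d + 1) * \<gamma> ^ (t + 2 * m)"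
    if "t \<le> t'" "d < L" "u \<le> k" "m \<le> 2 * u * k ^ (L - d - 1)" for t t' d u m
  proof -
    define x where "x = real u * p k ^ (d + 1)"
    define y where "y = \<gamma> ^ (2 * m)"
    have "1 + real (2 * m) * (\<gamma> - 1) \<le> (1 + (\<gamma> - 1)) ^ (2 * m)"
      using \<gamma> by (intro Bernoulli_inequality) auto
    then have "1 - y \<le> 2 * real m * (1 - \<gamma>)" by (simp add: y_def algebra_simps)
    also have "\<dots> \<le> 2 * real m * (p k ^ L / 16)"
      using assms by (intro mult_left_mono) auto
    also have "\<dots> \<le> 2 * (2 * real u * real k ^ (L - d - 1)) * (p k ^ L / 16)"
    proof -
      have "real m \<le> real (2 * u * k ^ (L - d - 1))" using that(4) by (simp only: of_nat_le_iff)
      then show ?thesis using pk by (intro mult_right_mono mult_left_mono) auto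
    qed
    also have "\<dots> = x / 4 * (real k * p k) ^ (L - d - 1)"
    proof -
      have "L = (d + 1) + (L - d - 1)" using that(2) by simp
      then have "p k ^ L = p k ^ (d + 1) * p k ^ (L - d - 1)" by (metis power_add)
      then show ?thesis by (simp add: x_def power_mult_distrib)
    qed
    also have "\<dots> \<le> x / 4 * 1"
      using k_p_k_le pk by (intro mult_left_mono power_le_one) (auto simp: x_def)
    finally have y: "1 - y \<le> x / 4" by simp
    have x: "0 \<le> x" "x \<le> 1"
    proof -
      show "0 \<le> x" using pk by (simp add: x_def)
      have "real u * p k \<le> 1"
        by (rule order_trans[OF _ k_p_k_le]) (use that(3) pk in \<open>simp add: mult_right_mono\<close>)
      then have "real u * p k * p k ^ d \<le> 1 * 1"
        using pk by (intro mult_mono power_le_one) auto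
      then show "x \<le> 1" by (simp add: x_def ac_simps)
    qed
    have y1: "y \<le> 1" unfolding y_def using \<gamma> by (intro power_le_one) auto
    have "2 * (1 - y) \<le> x * y"
    proof -
      have "x * (3 / 4) \<le> x * y" using x y by (intro mult_left_mono) auto
      moreover have "2 * (1 - y) \<le> x / 2" using y by simp
      moreover have "x / 2 \<le> x * (3 / 4)" using x by simp
      ultimately show ?thesis by (meson order_trans)
    qed
    moreover have "\<gamma> ^ t' * (2 * (1 - y)) \<le> \<gamma> ^ t * (2 * (1 - y))"
      using that(1) \<gamma> y1 by (intro mult_right_mono power_decreasing) auto
    moreover have "\<gamma> ^ t * (2 * (1 - y)) \<le> \<gamma> ^ t * (x * y)" if "2 * (1 - y) \<le> x * y"
      using that \<gamma> by (intro mult_left_mono) auto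
    ultimately have "\<gamma> ^ t' * (2 * (1 - y)) \<le> \<gamma> ^ t * (x * y)" by linarith
    then show ?thesis by (simp add: x_def y_def power_add algebra_simps)
  qed
  moreover have "\<gamma> ^ t < \<gamma> ^ s" if "s < t" for s t
    using \<gamma> that by (intro power_strict_decreasing) auto
  ultimately show ?thesis using \<gamma> by (simp add: good_reward_def)
qed

text \<open>Affine on the possible hitting times, and continued so that it stays positive and strictly
  decreasing. The offset makes missing the goal worse than any delay.\<close>

definition step_reward :: "nat \<Rightarrow> real" where
  "step_reward t = (let M = 2 * (2 * real N + 2) / p k ^ L in
     if t \<le> 2 * N then M + 2 * real N + 1 - real t else M + 1 / (real t + 1))"

lemma good_reward_step: "good_reward k L (p k) step_reward"
proof -
  define M where "M = 2 * (2 * real N + 2) / p k ^ L"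
  have pk: "0 < p k" "p k \<le> 1" using p_k_pos pmf_le_1 by auto
  have M: "0 < M" "p k ^ L * M = 2 * (2 * real N + 2)" using pk by (simp_all add: M_def)
  have def: "step_reward t = (if t \<le> 2 * N then M + 2 * real N + 1 - real t else M + 1 / (real t + 1))" for t
    by (simp add: step_reward_def M_def Let_def)
  have lower: "M < step_reward t" for t using M by (auto simp: def)
  have upper: "step_reward t \<le> M + 2 * real N + 1" for t by (auto simp: def field_simps)
  have "step_reward t < step_reward s" if "s < t" for s t
  proof -
    have "real s < real t" using that by simp
    then have "1 / (real t + 1) < 1 / (real s + 1)" by (intro divide_strict_left_mono) auto
    moreover have "1 / (real t + 1) < 1" using that by simp
    moreover have "s \<le> 2 * N \<Longrightarrow> real s \<le> 2 * real N" by linarith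
    moreover have "step_reward t = (if t \<le> 2 * N then M + 2 * real N + 1 - real t else M + 1 / (real t + 1))"
      "step_reward s = (if s \<le> 2 * N then M + 2 * real N + 1 - real s else M + 1 / (real s + 1))"
      by (rule def)+
    ultimately show ?thesis using that by (smt (verit) of_nat_less_iff le_trans less_imp_le)
  qed
  moreover have "2 * (step_reward t' - step_reward (t' + 2 * m)) \<le> real u * p k ^ (d + 1) * step_reward (t + 2 * m)"
    if "d < L" "1 \<le> u" for t t' d u m
  proof -
    have "2 * (step_reward t' - step_reward (t' + 2 * m)) \<le> p k ^ L * M"
      using lower[of "t' + 2 * m"] upper[of t'] M by simp
    also have "\<dots> \<le> (real u * p k ^ (d + 1)) * step_reward (t + 2 * m)"
    proof (intro mult_mono)
      have "p k ^ L \<le> p k ^ (d + 1)" using that pk by (intro power_decreasing) auto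
      also have "\<dots> \<le> real u * p k ^ (d + 1)" using that pk by simp
      finally show "p k ^ L \<le> real u * p k ^ (d + 1)" .
    qed (use lower[of "t + 2 * m"] M pk in auto)
    finally show ?thesis .
  qed
  moreover have "0 < step_reward t" for t using lower[of t] M by linarith
  ultimately show ?thesis by (simp add: good_reward_def)
qed

lemma expected_steps_eq:
  assumes "\<pi> \<in> success_policies k N \<omega> pa"
  shows "expected_steps k N \<omega> pa \<pi> = 2 * (2 * real N + 2) / p k ^ L + 2 * real N + 1
    - measure_pmf.expectation (episode k N \<omega> pa \<pi>) (payoff step_reward)"
proof -
  let ?E = "episode k N \<omega> pa \<pi>" and ?B = "2 * (2 * real N + 2) / p k ^ L + 2 * real N + 1"
  have \<pi>: "\<pi> \<in> policies k" and "measure_pmf.prob ?E {c. at_goal (snd c)} = 1"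
    using assms by (auto simp: success_policies_def success_prob_def)
  then have "\<forall>c\<in>set_pmf ?E. at_goal (snd c)"
    by (subst (asm) measure_pmf.prob_eq_1) (auto simp: AE_measure_pmf_iff)
  then have "AE c in measure_pmf ?E. payoff step_reward c = ?B - real (length (fst (snd c)))"
    using episode_config(1) by (auto simp: AE_measure_pmf_iff payoff_def step_reward_def Let_def)
  then have "measure_pmf.expectation ?E (payoff step_reward)
      = measure_pmf.expectation ?E (\<lambda>c. ?B - real (length (fst (snd c))))"
    by (intro integral_cong_AE) simp_all
  also have "\<dots> = ?B - expected_steps k N \<omega> pa \<pi>"
    unfolding expected_steps_def
    using integrable_measure_pmf_finite[OF finite_set_episode[OF \<pi>]] by (subst Bochner_Integration.integral_diff) auto
  finally show ?thesis by simp
qed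

end

theorem proposition2:
  shows "(\<forall>k L N \<omega> pa \<pi>\<^sub>0.
            setting k L N \<omega> pa \<longrightarrow> imbalanced k pa \<longrightarrow> is_ranked_dfs k N \<omega> pa \<pi>\<^sub>0 \<longrightarrow>
              \<pi>\<^sub>0 \<in> success_policies k N \<omega> pa \<and>
              (\<forall>\<pi> \<in> success_policies k N \<omega> pa.
                 \<not> same_reachable_behavior k N \<omega> pa \<pi> \<pi>\<^sub>0 \<longrightarrow>
                 expected_steps k N \<omega> pa \<pi>\<^sub>0 < expected_steps k N \<omega> pa \<pi>)) \<and>
         (\<exists>C > 0. \<forall>k L N \<omega> pa \<pi>\<^sub>0.
            setting k L N \<omega> pa \<longrightarrow> imbalanced k pa \<longrightarrow> is_ranked_dfs k N \<omega> pa \<pi>\<^sub>0 \<longrightarrow>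
              (\<forall>\<gamma> \<in> {1 - C * pmf pa k ^ L <..< 1}.
                 is_arg_max (discounted_return k N \<omega> pa \<gamma>) (\<lambda>\<pi>. \<pi> \<in> policies k) \<pi>\<^sub>0 \<and>
                 (\<forall>\<pi>. is_arg_max (discounted_return k N \<omega> pa \<gamma>) (\<lambda>\<pi>. \<pi> \<in> policies k) \<pi> \<longrightarrow>
                      same_reachable_behavior k N \<omega> pa \<pi> \<pi>\<^sub>0)))"
proof (intro conjI exI[of _ "1 / 16 :: real"] allI impI ballI)
  fix k L N \<omega> pa \<pi>\<^sub>0
  assume "setting k L N \<omega> pa" "imbalanced k pa" and r: "is_ranked_dfs k N \<omega> pa \<pi>\<^sub>0"
  then interpret search k L N \<omega> pa by unfold_locales
  show success: "\<pi>\<^sub>0 \<in> success_policies k N \<omega> pa" by (rule ranked_in_success[OF r])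
  show "expected_steps k N \<omega> pa \<pi>\<^sub>0 < expected_steps k N \<omega> pa \<pi>"
    if \<pi>: "\<pi> \<in> success_policies k N \<omega> pa" and "\<not> same_reachable_behavior k N \<omega> pa \<pi> \<pi>\<^sub>0" for \<pi>
    using value_less[OF good_reward_step _ r that(2)] \<pi>
    unfolding expected_steps_eq[OF success] expected_steps_eq[OF \<pi>] by (simp add: success_policies_def)
next
  fix k L N \<omega> pa \<pi>\<^sub>0 and \<gamma> :: real
  assume "setting k L N \<omega> pa" "imbalanced k pa" and r: "is_ranked_dfs k N \<omega> pa \<pi>\<^sub>0"
    and \<gamma>: "\<gamma> \<in> {1 - 1 / 16 * pmf pa k ^ L <..< 1}"
  then interpret search k L N \<omega> pa by unfold_locales
  have good: "good_reward k L (pmf pa k) (power \<gamma>)" using \<gamma> by (intro good_reward_power) auto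
  then have pos: "0 < \<gamma>" unfolding good_reward_def by (metis power_one_right)
  have le: "discounted_return k N \<omega> pa \<gamma> \<pi> \<le> discounted_return k N \<omega> pa \<gamma> \<pi>\<^sub>0" if "\<pi> \<in> policies k" for \<pi>
    using value_le[OF good that r] pos unfolding discounted_return_eq[symmetric] by simp
  then show "is_arg_max (discounted_return k N \<omega> pa \<gamma>) (\<lambda>\<pi>. \<pi> \<in> policies k) \<pi>\<^sub>0"
    using ranked_policy[OF r] by (auto simp: is_arg_max_def not_less)
  show "same_reachable_behavior k N \<omega> pa \<pi> \<pi>\<^sub>0"
    if am: "is_arg_max (discounted_return k N \<omega> pa \<gamma>) (\<lambda>\<pi>. \<pi> \<in> policies k) \<pi>" for \<pi>
  proof (rule ccontr)
    assume "\<not> same_reachable_behavior k N \<omega> pa \<pi> \<pi>\<^sub>0"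
    then have "discounted_return k N \<omega> pa \<gamma> \<pi> < discounted_return k N \<omega> pa \<gamma> \<pi>\<^sub>0"
      using value_less[OF good _ r] am pos unfolding discounted_return_eq[symmetric]
      by (auto simp: is_arg_max_def)
    then show False using am ranked_policy[OF r] by (auto simp: is_arg_max_def)
  qed
qed simp

end
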